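(* Let $G$ be a finite solvable group, and let $\chi\in\mathrm{Irr}(G)$ be a faithful primitive character. Then $\mathrm{cod}(\chi)$ is divisible by each prime factor of $|G|$, that is, $\pi(\mathrm{cod}(\chi))=\pi(|G|)$.
   Context: All groups are finite and all characters are over the complex numbers. $\mathrm{Irr}(G)$ denotes the set of irreducible complex characters of $G$. For a character $\chi$ of $G$, the codegree of $\chi$ is $\mathrm{cod}(\chi)=|G:\mathrm{Ker}\,\chi|/\chi(1)$, where $\mathrm{Ker}\,\chi=\{g\in G:\chi(g)=\chi(1)\}$; $\chi$ is faithful if $\mathrm{Ker}\,\chi=1$. A character $\chi\in\mathrm{Irr}(G)$ is primitive if it is not induced from a character of any proper subgroup of $G$. For a positive integer $n$, $\pi(n)$ denotes the set of prime divisors of $n$. *)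

theory Defs
  imports
    "HOL-Algebra.Solvable_Groups"
    "HOL-Computational_Algebra.Primes"
    "Jordan_Normal_Form.VS_Connect"
begin

abbreviation GL :: "nat \<Rightarrow> complex mat monoid" where
  "GL n \<equiv> units_of (ring_mat TYPE(complex) n ())"

definition is_rep :: "('a, 'b) monoid_scheme \<Rightarrow> nat \<Rightarrow> ('a \<Rightarrow> complex mat) \<Rightarrow> bool" where
  "is_rep G n \<rho> \<longleftrightarrow> n > 0 \<and> \<rho> \<in> hom G (GL n)"

definition irreducible_rep :: "('a, 'b) monoid_scheme \<Rightarrow> nat \<Rightarrow> ('a \<Rightarrow> complex mat) \<Rightarrow> bool" where
  "irreducible_rep G n \<rho> \<longleftrightarrow> is_rep G n \<rho> \<and>
     (\<forall>W. VectorSpace.subspace class_ring W (module_vec TYPE(complex) n) \<and>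
          (\<forall>g\<in>carrier G. \<forall>w\<in>W. \<rho> g *\<^sub>v w \<in> W)
        \<longrightarrow> W = {0\<^sub>v n} \<or> W = carrier_vec n)"

definition mat_trace :: "complex mat \<Rightarrow> complex" where
  "mat_trace A = (\<Sum>i<dim_row A. A $$ (i, i))"

(* Characters are normalised to be undefined outside the carrier, so that equality of
   functions is equality of characters. *)
definition rep_char :: "('a, 'b) monoid_scheme \<Rightarrow> ('a \<Rightarrow> complex mat) \<Rightarrow> 'a \<Rightarrow> complex" where
  "rep_char G \<rho> = (\<lambda>g\<in>carrier G. mat_trace (\<rho> g))"

definition characters :: "('a, 'b) monoid_scheme \<Rightarrow> ('a \<Rightarrow> complex) set" where
  "characters G = {rep_char G \<rho> | n \<rho>. is_rep G n \<rho>}"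

definition Irr :: "('a, 'b) monoid_scheme \<Rightarrow> ('a \<Rightarrow> complex) set" where
  "Irr G = {rep_char G \<rho> | n \<rho>. irreducible_rep G n \<rho>}"

definition char_kernel :: "('a, 'b) monoid_scheme \<Rightarrow> ('a \<Rightarrow> complex) \<Rightarrow> 'a set" where
  "char_kernel G \<chi> = {g \<in> carrier G. \<chi> g = \<chi> \<one>\<^bsub>G\<^esub>}"

definition faithful :: "('a, 'b) monoid_scheme \<Rightarrow> ('a \<Rightarrow> complex) \<Rightarrow> bool" where
  "faithful G \<chi> \<longleftrightarrow> char_kernel G \<chi> = {\<one>\<^bsub>G\<^esub>}"

(* A complex number by definition, since \<chi>(1) is one; that it is a positive integer for
   irreducible \<chi> is a theorem. *)
definition cod :: "('a, 'b) monoid_scheme \<Rightarrow> ('a \<Rightarrow> complex) \<Rightarrow> complex" where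
  "cod G \<chi> = of_nat (card (rcosets\<^bsub>G\<^esub> (char_kernel G \<chi>))) / \<chi> \<one>\<^bsub>G\<^esub>"

definition induced_char ::
  "('a, 'b) monoid_scheme \<Rightarrow> 'a set \<Rightarrow> ('a \<Rightarrow> complex) \<Rightarrow> 'a \<Rightarrow> complex" where
  "induced_char G H \<psi> = (\<lambda>g\<in>carrier G.
     (1 / of_nat (card H)) *
     (\<Sum>x \<in> {x \<in> carrier G. x \<otimes>\<^bsub>G\<^esub> g \<otimes>\<^bsub>G\<^esub> inv\<^bsub>G\<^esub> x \<in> H}. \<psi> (x \<otimes>\<^bsub>G\<^esub> g \<otimes>\<^bsub>G\<^esub> inv\<^bsub>G\<^esub> x)))"

definition primitive :: "('a, 'b) monoid_scheme \<Rightarrow> ('a \<Rightarrow> complex) \<Rightarrow> bool" where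
  "primitive G \<chi> \<longleftrightarrow> \<chi> \<in> Irr G \<and>
     \<not> (\<exists>H \<psi>. subgroup H G \<and> H \<noteq> carrier G \<and>
            \<psi> \<in> characters (G\<lparr>carrier := H\<rparr>) \<and> \<chi> = induced_char G H \<psi>)"

end

theory Submission
  imports
    Defs
    "Jordan_Normal_Form.Schur_Decomposition"
    "Jordan_Normal_Form.Spectral_Radius"
    "HOL-Algebra.Sylow"
    "HOL-Algebra.Multiplicative_Group"
begin

text \<open>
  Since \<open>\<chi>\<close> is faithful, its codegree is the quotient \<open>q = |G| / \<chi>(1)\<close>, an integer because
  degrees of irreducible characters divide the group order (\<open>degree_dvd_order\<close>). The point is
  that a prime \<open>p\<close> dividing \<open>|G|\<close> also divides \<open>q\<close>. Suppose that it does not.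

  The central idempotent of the group algebra that belongs to \<open>\<chi>\<close> has the coefficients
  \<open>\<chi>(g\<^sup>-\<^sup>1) / q\<close>, which are cyclotomic integers up to a factor prime to \<open>p\<close>. It equals its own
  power with exponent \<open>p\<^sup>j\<close>. Expand that power as a sum over words of length \<open>p\<^sup>j\<close> and take the
  coefficients at the conjugacy class of a nontrivial \<open>p\<close>-element: the words that occur have
  large orbits under cyclic rotation, because a word with a small orbit is a high power of a
  shorter word and so its product is \<open>p\<close>-regular. Letting \<open>j\<close> grow, the value of \<open>\<chi>\<close> at the
  element is divisible by every power of \<open>p\<close>, which for the present purpose is as good as
  being zero (\<open>vanishing_on_p_elements\<close>).

  By solvability there are normal subgroups \<open>L \<le> M\<close> of \<open>G\<close> such that \<open>p\<close> does not divide \<open>|L|\<close>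
  and \<open>|M : L| = p\<^sup>b\<close> with \<open>b > 0\<close> (\<open>exists_p'_by_p_section\<close>). By Clifford theory and primitivity the
  restrictions of \<open>\<chi>\<close> to \<open>M\<close> and \<open>L\<close> are multiples of irreducible characters \<open>\<psi>\<close> and \<open>\<theta>\<close>
  (\<open>primitive_imp_homogeneous\<close>). Write \<open>\<psi>(1) = e \<theta>(1)\<close>. Let \<open>P\<close> be a Sylow \<open>p\<close>-subgroup of \<open>M\<close>, of
  order \<open>p\<^sup>b\<close>. The sum of \<open>\<psi>\<close> over \<open>P\<close> is an integer multiple of \<open>|P|\<close>, and only the identity
  contributes to it, so \<open>p\<^sup>b\<close> divides \<open>\<psi>(1)\<close>. As \<open>\<theta>(1)\<close> divides \<open>|L|\<close>, it is prime to \<open>p\<close>, and so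
  \<open>p\<^sup>b\<close> divides \<open>e\<close>. On the other hand, \<open>e\<^sup>2 |L|\<close> is the sum of \<open>|\<psi>|\<^sup>2\<close> over \<open>L\<close>, which is at most
  the sum over \<open>M\<close>, that is \<open>|M|\<close>; hence \<open>e\<^sup>2 \<le> p\<^sup>b\<close>. This is a contradiction
  (\<open>primitive_codegree_dvd\<close>).
\<close>

section \<open>Matrices, traces and sums of matrices\<close>

text \<open>The sum of a family of matrices of known size. It is defined entrywise because matrices
  of all sizes share one type, which has no zero.\<close>

definition msum :: "nat \<Rightarrow> nat \<Rightarrow> ('b \<Rightarrow> complex mat) \<Rightarrow> 'b set \<Rightarrow> complex mat" where
  "msum n m F S = mat n m (\<lambda>(i, j). \<Sum>x\<in>S. F x $$ (i, j))"

lemma msum_carrier [simp, intro]: "msum n m F S \<in> carrier_mat n m"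
  and msum_dim [simp]: "dim_row (msum n m F S) = n" "dim_col (msum n m F S) = m"
  by (auto simp: msum_def)

lemma msum_index [simp]:
  "i < n \<Longrightarrow> j < m \<Longrightarrow> msum n m F S $$ (i, j) = (\<Sum>x\<in>S. F x $$ (i, j))"
  by (simp add: msum_def)

lemma msum_cong: "S = T \<Longrightarrow> (\<And>x. x \<in> T \<Longrightarrow> F x = H x) \<Longrightarrow> msum n m F S = msum n m H T"
  by (auto simp: msum_def)

lemma msum_reindex_bij:
  "bij_betw h S T \<Longrightarrow> msum n m F T = msum n m (\<lambda>x. F (h x)) S"
  unfolding msum_def by (rule cong_mat) (auto simp: sum.reindex_bij_betw[symmetric])

lemma msum_mult_left:
  assumes "A \<in> carrier_mat k n" "\<And>x. x \<in> S \<Longrightarrow> F x \<in> carrier_mat n m"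
  shows "A * msum n m F S = msum k m (\<lambda>x. A * F x) S"
proof (rule eq_matI)
  fix i j assume ij: "i < dim_row (msum k m (\<lambda>x. A * F x) S)" "j < dim_col (msum k m (\<lambda>x. A * F x) S)"
  have "(A * msum n m F S) $$ (i, j) = (\<Sum>l<n. A $$ (i, l) * (\<Sum>x\<in>S. F x $$ (l, j)))"
    using ij assms by (auto simp: scalar_prod_def intro!: sum.cong)
  also have "\<dots> = (\<Sum>x\<in>S. \<Sum>l<n. A $$ (i, l) * F x $$ (l, j))"
    by (subst sum.swap) (simp add: sum_distrib_left)
  also have "\<dots> = (\<Sum>x\<in>S. (A * F x) $$ (i, j))"
  proof (rule sum.cong)
    fix x assume "x \<in> S"
    then have "F x \<in> carrier_mat n m" using assms by auto
    then show "(\<Sum>l<n. A $$ (i, l) * F x $$ (l, j)) = (A * F x) $$ (i, j)"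
      using ij assms by (auto simp: scalar_prod_def intro!: sum.cong)
  qed simp
  finally show "(A * msum n m F S) $$ (i, j) = msum k m (\<lambda>x. A * F x) S $$ (i, j)"
    using ij by simp
qed (use assms in auto)

lemma msum_mult_right:
  assumes "A \<in> carrier_mat m k" "\<And>x. x \<in> S \<Longrightarrow> F x \<in> carrier_mat n m"
  shows "msum n m F S * A = msum n k (\<lambda>x. F x * A) S"
proof (rule eq_matI)
  fix i j assume ij: "i < dim_row (msum n k (\<lambda>x. F x * A) S)" "j < dim_col (msum n k (\<lambda>x. F x * A) S)"
  have "(msum n m F S * A) $$ (i, j) = (\<Sum>l<m. (\<Sum>x\<in>S. F x $$ (i, l)) * A $$ (l, j))"
    using ij assms by (auto simp: scalar_prod_def intro!: sum.cong)
  also have "\<dots> = (\<Sum>x\<in>S. \<Sum>l<m. F x $$ (i, l) * A $$ (l, j))"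
    by (subst sum.swap) (simp add: sum_distrib_right)
  also have "\<dots> = (\<Sum>x\<in>S. (F x * A) $$ (i, j))"
  proof (rule sum.cong)
    fix x assume "x \<in> S"
    then have "F x \<in> carrier_mat n m" using assms by auto
    then show "(\<Sum>l<m. F x $$ (i, l) * A $$ (l, j)) = (F x * A) $$ (i, j)"
      using ij assms by (auto simp: scalar_prod_def intro!: sum.cong)
  qed simp
  finally show "(msum n m F S * A) $$ (i, j) = msum n k (\<lambda>x. F x * A) S $$ (i, j)"
    using ij by simp
qed (use assms in auto)

lemma msum_smult:
  assumes "\<And>x. x \<in> S \<Longrightarrow> F x \<in> carrier_mat n m"
  shows "c \<cdot>\<^sub>m msum n m F S = msum n m (\<lambda>x. c \<cdot>\<^sub>m F x) S"
  using assms by (intro eq_matI) (fastforce simp: sum_distrib_left intro!: sum.cong)+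

lemma msum_smult_const:
  assumes "A \<in> carrier_mat n m"
  shows "msum n m (\<lambda>x. f x \<cdot>\<^sub>m A) S = (\<Sum>x\<in>S. f x) \<cdot>\<^sub>m A"
  using assms by (intro eq_matI) (auto simp: sum_distrib_right)

lemma msum_swap:
  "msum n m (\<lambda>x. msum n m (F x) T) S = msum n m (\<lambda>y. msum n m (\<lambda>x. F x y) S) T"
  by (rule eq_matI) (auto intro: sum.swap)

lemma mat_trace_msum:
  assumes "\<And>x. x \<in> S \<Longrightarrow> F x \<in> carrier_mat n n"
  shows "mat_trace (msum n n F S) = (\<Sum>x\<in>S. mat_trace (F x))"
proof -
  have "mat_trace (msum n n F S) = (\<Sum>x\<in>S. \<Sum>i<n. F x $$ (i, i))"
    unfolding mat_trace_def by (subst sum.swap) simp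
  also have "\<dots> = (\<Sum>x\<in>S. mat_trace (F x))"
    unfolding mat_trace_def using assms by (intro sum.cong) auto
  finally show ?thesis .
qed

lemma mat_trace_smult: "A \<in> carrier_mat n n \<Longrightarrow> mat_trace (c \<cdot>\<^sub>m A) = c * mat_trace A"
  by (auto simp: mat_trace_def sum_distrib_left)

lemma mat_trace_one [simp]: "mat_trace (1\<^sub>m n) = of_nat n"
  by (simp add: mat_trace_def)

lemma mat_trace_mult_comm:
  assumes "A \<in> carrier_mat n m" "B \<in> carrier_mat m n"
  shows "mat_trace (A * B) = mat_trace (B * A)"
proof -
  have "mat_trace (A * B) = (\<Sum>i<n. \<Sum>j<m. A $$ (i, j) * B $$ (j, i))"
    unfolding mat_trace_def using assms by (auto simp: scalar_prod_def intro!: sum.cong)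
  also have "\<dots> = (\<Sum>j<m. \<Sum>i<n. A $$ (i, j) * B $$ (j, i))"
    by (rule sum.swap)
  also have "\<dots> = mat_trace (B * A)"
    unfolding mat_trace_def using assms by (auto simp: scalar_prod_def intro!: sum.cong)
  finally show ?thesis .
qed

lemma mat_trace_conj:
  assumes "A \<in> carrier_mat n n" "P \<in> carrier_mat n n" "Q \<in> carrier_mat n n" "P * Q = 1\<^sub>m n"
  shows "mat_trace (Q * A * P) = mat_trace A"
proof -
  have "mat_trace (Q * A * P) = mat_trace (P * (Q * A))"
    using assms by (intro mat_trace_mult_comm[of _ n n]) auto
  also have "P * (Q * A) = P * Q * A"
    using assms by (intro assoc_mult_mat[symmetric]) auto
  finally show ?thesis using assms by simp
qed

lemma smult_mult_mat:
  fixes A :: "complex mat"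
  assumes "A \<in> carrier_mat n m" "B \<in> carrier_mat m k"
  shows "(c \<cdot>\<^sub>m A) * B = c \<cdot>\<^sub>m (A * B)" "A * (c \<cdot>\<^sub>m B) = c \<cdot>\<^sub>m (A * B)"
  using mult_smult_assoc_mat[OF assms] mult_smult_distrib[OF assms] by auto

lemma smult_cancel_mat:
  fixes A :: "complex mat"
  assumes "c \<cdot>\<^sub>m A = d \<cdot>\<^sub>m A" "A \<in> carrier_mat n m" "A \<noteq> 0\<^sub>m n m"
  shows "c = d"
proof -
  obtain i j where ij: "i < n" "j < m" "A $$ (i, j) \<noteq> 0"
    using assms(2,3) by (metis carrier_matD eq_matI index_zero_mat)
  have "(c \<cdot>\<^sub>m A) $$ (i, j) = (d \<cdot>\<^sub>m A) $$ (i, j)" using assms by simp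
  then have "c * A $$ (i, j) = d * A $$ (i, j)" using ij(1,2) assms(2) by simp
  then show ?thesis using ij(3) by simp
qed

lemma smult_smult_mat: "a \<cdot>\<^sub>m (b \<cdot>\<^sub>m A) = (a * b) \<cdot>\<^sub>m (A :: complex mat)"
  by (rule eq_matI) auto

lemma one_smult_mat [simp]: "1 \<cdot>\<^sub>m A = (A :: complex mat)"
  by (rule eq_matI) auto

lemma sq_mult: "A \<in> carrier_mat n n \<Longrightarrow> B \<in> carrier_mat n n \<Longrightarrow> A * B \<in> carrier_mat n n"
  and sq_assoc: "A \<in> carrier_mat n n \<Longrightarrow> B \<in> carrier_mat n n \<Longrightarrow> C \<in> carrier_mat n n
    \<Longrightarrow> A * B * C = A * (B * (C :: complex mat))"
  by (auto intro: assoc_mult_mat)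

lemma smult_eq_self:
  fixes A :: "complex mat"
  assumes "A \<in> carrier_mat n m" "A \<noteq> 0\<^sub>m n m" "c \<cdot>\<^sub>m A = A"
  shows "c = 1"
  using smult_cancel_mat[of c A 1 n m] assms by simp

lemma zero_smult_mat: "A \<in> carrier_mat n m \<Longrightarrow> 0 \<cdot>\<^sub>m A = 0\<^sub>m n (m::nat)" for A :: "complex mat"
  by (rule eq_matI) auto

lemma upper_triangular_mult:
  fixes A B :: "complex mat"
  assumes A: "A \<in> carrier_mat n n" "upper_triangular A"
    and B: "B \<in> carrier_mat n n" "upper_triangular B"
  shows "upper_triangular (A * B)" "\<And>i. i < n \<Longrightarrow> (A * B) $$ (i, i) = A $$ (i, i) * B $$ (i, i)"
proof -
  have z: "A $$ (i, k) * B $$ (k, j) = 0" if "i < n" "j < n" "k < n" "k < i \<or> j < k" for i j k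
    using that A B by (auto dest: upper_triangularD)
  have ix: "(A * B) $$ (i, j) = (\<Sum>k<n. A $$ (i, k) * B $$ (k, j))" if "i < n" "j < n" for i j
    using that A B by (auto simp: scalar_prod_def intro!: sum.cong)
  show "upper_triangular (A * B)"
  proof (rule upper_triangularI)
    fix i j assume "j < i" "i < dim_row (A * B)"
    then have "i < n" "j < n" using A by auto
    moreover have "(\<Sum>k<n. A $$ (i, k) * B $$ (k, j)) = 0"
      using \<open>j < i\<close> calculation by (intro sum.neutral ballI z) auto
    ultimately show "(A * B) $$ (i, j) = 0" using ix by simp
  qed
  fix i assume i: "i < n"
  have "(\<Sum>k<n. A $$ (i, k) * B $$ (k, i)) = (\<Sum>k\<in>{i}. A $$ (i, k) * B $$ (k, i))"
    using i by (intro sum.mono_neutral_right ballI z) auto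
  then show "(A * B) $$ (i, i) = A $$ (i, i) * B $$ (i, i)" using ix i by simp
qed

text \<open>The power sums of the eigenvalues, counted with multiplicity, are the traces of the powers.\<close>

lemma trace_powers_eigenvalues:
  fixes A :: "complex mat"
  assumes A: "A \<in> carrier_mat n n"
  obtains es where "length es = n" "\<And>e. e \<in> set es \<Longrightarrow> eigenvalue A e"
    "\<And>k. mat_trace (A ^\<^sub>m k) = (\<Sum>e\<leftarrow>es. e ^ k)"
proof -
  obtain es where es: "char_poly A = (\<Prod>a\<leftarrow>es. [:- a, 1:])" "length es = n"
    using char_poly_factorized[OF A] by auto
  obtain B P Q where BPQ: "schur_decomposition A es = (B, P, Q)"
    by (cases "schur_decomposition A es") auto
  from schur_decomposition[OF A es(1) BPQ]
  have sim: "similar_mat_wit A B P Q" and ut: "upper_triangular B" and dB: "diag_mat B = es" by auto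
  note w = similar_mat_witD2[OF A sim]
  have B: "B \<in> carrier_mat n n" using w by auto
  have Bk: "upper_triangular (B ^\<^sub>m k) \<and> (\<forall>i<n. (B ^\<^sub>m k) $$ (i, i) = (B $$ (i, i)) ^ k)" for k
  proof (induction k)
    case (Suc k)
    have Bkc: "B ^\<^sub>m k \<in> carrier_mat n n" using B by simp
    show ?case using upper_triangular_mult[OF Bkc _ B ut] Suc by (simp add: mult.commute)
  qed (use B in \<open>auto intro!: upper_triangularI\<close>)
  have tr: "mat_trace (A ^\<^sub>m k) = (\<Sum>e\<leftarrow>es. e ^ k)" for k
  proof -
    have "similar_mat_wit (A ^\<^sub>m k) (B ^\<^sub>m k) P Q" by (rule similar_mat_wit_pow[OF sim])
    then have "A ^\<^sub>m k = P * B ^\<^sub>m k * Q"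
      using similar_mat_witD2(3)[of "A ^\<^sub>m k" n n "B ^\<^sub>m k" P Q] A by simp
    then have "mat_trace (A ^\<^sub>m k) = mat_trace (B ^\<^sub>m k)"
      using mat_trace_conj[of "B ^\<^sub>m k" n Q P] w B by simp
    also have "\<dots> = (\<Sum>i<n. (B $$ (i, i)) ^ k)"
      unfolding mat_trace_def using Bk B by simp
    also have "\<dots> = (\<Sum>e\<leftarrow>es. e ^ k)"
      unfolding dB[symmetric] diag_mat_def using B
      by (simp add: comp_def interv_sum_list_conv_sum_set_nat atLeast0LessThan)
    finally show ?thesis .
  qed
  have "eigenvalue A e" if "e \<in> set es" for e
    unfolding eigenvalue_root_char_poly[OF A] es(1) using that
    by (induction es) (auto simp: poly_prod_list)
  with tr es(2) that show thesis by blast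
qed

text \<open>The natural number in question is the rank of the idempotent.\<close>

lemma idempotent_trace_nat:
  fixes E :: "complex mat"
  assumes E: "E \<in> carrier_mat n n" "E * E = E"
  obtains k where "mat_trace E = of_nat k" "k \<le> n"
proof -
  obtain es where es: "length es = n" "\<And>e. e \<in> set es \<Longrightarrow> eigenvalue E e"
    "\<And>k. mat_trace (E ^\<^sub>m k) = (\<Sum>e\<leftarrow>es. e ^ k)"
    using trace_powers_eigenvalues[OF E(1)] by blast
  have e01: "e = 0 \<or> e = 1" if "e \<in> set es" for e
  proof -
    have "eigenvalue E e" by (rule es(2)[OF that])
    then obtain v where v: "eigenvector E v e" unfolding eigenvalue_def by auto
    then have vc: "v \<in> carrier_vec n" "v \<noteq> 0\<^sub>v n" and Ev: "E *\<^sub>v v = e \<cdot>\<^sub>v v"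
      using E unfolding eigenvector_def by auto
    have "e \<cdot>\<^sub>v v = (E * E) *\<^sub>v v" using E Ev by simp
    also have "\<dots> = E *\<^sub>v (E *\<^sub>v v)" using E vc by (intro assoc_mult_mat_vec) auto
    also have "\<dots> = e \<cdot>\<^sub>v (E *\<^sub>v v)" unfolding Ev using E vc mult_mat_vec by (metis Ev)
    also have "\<dots> = (e * e) \<cdot>\<^sub>v v" unfolding Ev by (simp add: smult_smult_assoc)
    finally have eq: "e \<cdot>\<^sub>v v = (e * e) \<cdot>\<^sub>v v" .
    obtain i where i: "i < n" "v $ i \<noteq> 0"
      using vc by (metis carrier_vecD eq_vecI index_zero_vec(1) index_zero_vec(2))
    have "(e \<cdot>\<^sub>v v) $ i = ((e * e) \<cdot>\<^sub>v v) $ i" using eq by simp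
    then show ?thesis using i vc by auto
  qed
  have "(\<Sum>e\<leftarrow>es. e) = of_nat (length (filter (\<lambda>e. e = 1) es))"
    using e01 by (induction es) auto
  moreover have "mat_trace E = (\<Sum>e\<leftarrow>es. e)" using es(3)[of 1] E by simp
  ultimately show thesis using that es(1) by (metis length_filter_le)
qed

text \<open>The eigenvalues of a matrix of finite order are roots of unity. One list of eigenvalues
  serves all powers, so that the trace of the inverse can be compared with the trace.\<close>

lemma finite_order_trace:
  fixes A :: "complex mat"
  assumes A: "A \<in> carrier_mat n n" and m: "A ^\<^sub>m m = 1\<^sub>m n" "m > 0"
  obtains es where "\<And>e. e \<in> set es \<Longrightarrow> e ^ m = 1"
    "\<And>k. mat_trace (A ^\<^sub>m k) = (\<Sum>e\<leftarrow>es. e ^ k)"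
proof -
  obtain es where es: "length es = n" "\<And>e. e \<in> set es \<Longrightarrow> eigenvalue A e"
    "\<And>k. mat_trace (A ^\<^sub>m k) = (\<Sum>e\<leftarrow>es. e ^ k)"
    using trace_powers_eigenvalues[OF A] by blast
  have "e ^ m = 1" if "e \<in> set es" for e
  proof -
    have "eigenvalue A e" by (rule es(2)[OF that])
    then obtain v where v: "eigenvector A v e" unfolding eigenvalue_def by auto
    then have vc: "v \<in> carrier_vec n" "v \<noteq> 0\<^sub>v n"
      using A unfolding eigenvector_def by auto
    have eq: "v = e ^ m \<cdot>\<^sub>v v" using eigenvector_pow[OF A v, of m] m vc by simp
    obtain i where i: "i < n" "v $ i \<noteq> 0"
      using vc by (metis carrier_vecD eq_vecI index_zero_vec(1) index_zero_vec(2))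
    have "v $ i = (e ^ m \<cdot>\<^sub>v v) $ i" using eq by simp
    then show ?thesis using i vc by auto
  qed
  then show thesis using that es by blast
qed

section \<open>Cyclotomic integers\<close>

text \<open>The ring generated by the \<open>m\<close>-th roots of unity, as the set of integer combinations of the
  powers of a primitive root. For \<open>m > 0\<close> it contains the values of the characters of a group
  of order \<open>m\<close>.\<close>

definition cyc_ints :: "nat \<Rightarrow> complex set" where
  "cyc_ints m = {x. \<exists>c :: nat \<Rightarrow> int. x = (\<Sum>i<m. of_int (c i) * cis (2 * pi / of_nat m) ^ i)}"

lemma cyc_ints_0 [simp]: "0 \<in> cyc_ints m"
  unfolding cyc_ints_def by (auto intro!: exI[of _ "\<lambda>_. 0"])

lemma cyc_ints_add: "x \<in> cyc_ints m \<Longrightarrow> y \<in> cyc_ints m \<Longrightarrow> x + y \<in> cyc_ints m"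
proof -
  assume "x \<in> cyc_ints m" "y \<in> cyc_ints m"
  then obtain c d :: "nat \<Rightarrow> int" where
    "x = (\<Sum>i<m. of_int (c i) * cis (2 * pi / of_nat m) ^ i)"
    "y = (\<Sum>i<m. of_int (d i) * cis (2 * pi / of_nat m) ^ i)"
    unfolding cyc_ints_def by blast
  then have "x + y = (\<Sum>i<m. of_int (c i + d i) * cis (2 * pi / of_nat m) ^ i)"
    by (simp add: sum.distrib algebra_simps)
  then show ?thesis unfolding cyc_ints_def by (intro CollectI exI[of _ "\<lambda>i. c i + d i"])
qed

lemma cyc_ints_smult: "x \<in> cyc_ints m \<Longrightarrow> of_int k * x \<in> cyc_ints m"
proof -
  assume "x \<in> cyc_ints m"
  then obtain c :: "nat \<Rightarrow> int" where
    "x = (\<Sum>i<m. of_int (c i) * cis (2 * pi / of_nat m) ^ i)"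
    unfolding cyc_ints_def by blast
  then have "of_int k * x = (\<Sum>i<m. of_int (k * c i) * cis (2 * pi / of_nat m) ^ i)"
    by (simp add: sum_distrib_left algebra_simps)
  then show ?thesis unfolding cyc_ints_def by (intro CollectI exI[of _ "\<lambda>i. k * c i"])
qed

lemma cyc_ints_sum: "(\<And>i. i \<in> A \<Longrightarrow> f i \<in> cyc_ints m) \<Longrightarrow> (\<Sum>i\<in>A. f i) \<in> cyc_ints m"
  by (induction A rule: infinite_finite_induct) (auto intro: cyc_ints_add)

lemma cyc_ints_sum_list: "(\<And>x. x \<in> set xs \<Longrightarrow> f x \<in> cyc_ints m) \<Longrightarrow> (\<Sum>x\<leftarrow>xs. f x) \<in> cyc_ints m"
  by (induction xs) (auto intro: cyc_ints_add)

lemma cyc_ints_root_of_unity: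
  assumes "m > 0" "z ^ m = 1"
  shows "z \<in> cyc_ints m"
proof -
  have "z \<in> (\<lambda>k. cis (2 * pi * real k / real m)) ` {..<m}"
    using bij_betw_roots_unity[OF assms(1)] assms(2) unfolding bij_betw_def by blast
  then obtain k where k: "k < m" "z = cis (2 * pi * real k / real m)" by auto
  have z: "z = cis (2 * pi / of_nat m) ^ k"
    unfolding k(2) DeMoivre by (simp add: field_simps)
  have "(\<Sum>i<m. of_int (if i = k then 1 else 0) * cis (2 * pi / of_nat m) ^ i) = z"
    using k(1) unfolding z by (subst sum.remove[of _ k]) (auto intro!: sum.neutral)
  then show ?thesis unfolding cyc_ints_def 
    by (intro CollectI exI[of _ "\<lambda>i. if i = k then 1 else 0"]) (rule sym)
qed

lemma cis_pow_root: "m > 0 \<Longrightarrow> (cis (2 * pi / of_nat m) ^ k) ^ m = 1"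
proof -
  assume "m > 0"
  then have "cis (2 * pi / of_nat m) ^ m = 1" unfolding DeMoivre by simp
  then have "(cis (2 * pi / of_nat m) ^ m) ^ k = 1" by simp
  then show ?thesis by (simp only: power_mult[symmetric] mult.commute)
qed

lemma cyc_ints_mult:
  assumes "m > 0" "x \<in> cyc_ints m" "y \<in> cyc_ints m"
  shows "x * y \<in> cyc_ints m"
proof -
  obtain c d :: "nat \<Rightarrow> int" where
    "x = (\<Sum>i<m. of_int (c i) * cis (2 * pi / of_nat m) ^ i)"
    "y = (\<Sum>i<m. of_int (d i) * cis (2 * pi / of_nat m) ^ i)"
    using assms unfolding cyc_ints_def by blast
  then have eq: "x * y = (\<Sum>i<m. \<Sum>j<m. of_int (c i * d j) * (cis (2 * pi / of_nat m) ^ (i + j)))"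
    by (simp add: sum_product power_add algebra_simps)
  show ?thesis unfolding eq
    by (intro cyc_ints_sum cyc_ints_smult cyc_ints_root_of_unity[OF assms(1)] cis_pow_root[OF assms(1)])
qed

lemma cyc_ints_of_int: "m > 0 \<Longrightarrow> of_int k \<in> cyc_ints m"
  using cyc_ints_smult[OF cyc_ints_root_of_unity[of m 1], of k] by simp

lemma cyc_ints_of_nat: "m > 0 \<Longrightarrow> of_nat k \<in> cyc_ints m"
  using cyc_ints_of_int[of m "int k"] by simp

lemma cyc_ints_prod_list:
  "m > 0 \<Longrightarrow> (\<And>x. x \<in> set xs \<Longrightarrow> f x \<in> cyc_ints m) \<Longrightarrow> (\<Prod>x\<leftarrow>xs. f x) \<in> cyc_ints m"
  by (induction xs) (use cyc_ints_of_nat[of m 1] in \<open>auto intro: cyc_ints_mult\<close>)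

text \<open>Multiplication by an element of the ring is given by an integer matrix, so the element
  is an eigenvalue of that matrix and hence an algebraic integer.\<close>

lemma cyc_ints_rational_imp_int:
  assumes m: "m > 0" and r: "r \<in> cyc_ints m" "r \<in> \<rat>"
  shows "r \<in> \<int>"
proof -
  define z where "z = cis (2 * pi / of_nat m)"
  have "\<exists>c :: nat \<Rightarrow> int. r * z ^ i = (\<Sum>j<m. of_int (c j) * z ^ j)" for i
    using cyc_ints_mult[OF m r(1) cyc_ints_root_of_unity[OF m cis_pow_root[OF m, of i]]]
    unfolding z_def cyc_ints_def mem_Collect_eq .
  then obtain c :: "nat \<Rightarrow> nat \<Rightarrow> int" where c: "r * z ^ i = (\<Sum>j<m. of_int (c i j) * z ^ j)" for i
    by metis
  define M where "M = mat m m (\<lambda>(i, j). c i j)"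
  have M: "M \<in> carrier_mat m m" by (simp add: M_def)
  let ?M = "map_mat complex_of_int M"
  define v where "v = vec m (\<lambda>j. z ^ j)"
  have "?M *\<^sub>v v = r \<cdot>\<^sub>v v"
  proof (rule eq_vecI)
    fix i assume "i < dim_vec (r \<cdot>\<^sub>v v)"
    then have i: "i < m" by (simp add: v_def)
    then have "(?M *\<^sub>v v) $ i = (\<Sum>j<m. of_int (c i j) * z ^ j)"
      by (simp add: M_def v_def scalar_prod_def atLeast0LessThan)
    also have "\<dots> = r * z ^ i" by (rule c[symmetric])
    finally show "(?M *\<^sub>v v) $ i = (r \<cdot>\<^sub>v v) $ i" using i by (simp add: v_def)
  qed (simp add: M_def v_def)
  moreover have "v \<noteq> 0\<^sub>v m"
  proof
    assume "v = 0\<^sub>v m"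
    then have "v $ 0 = 0" using m by simp
    then show False using m by (simp add: v_def)
  qed
  ultimately have "eigenvalue ?M r"
    unfolding eigenvalue_def eigenvector_def by (intro exI[of _ v]) (auto simp: M_def v_def)
  then have root: "poly (char_poly ?M) r = 0"
    using eigenvalue_root_char_poly[of ?M m] M by simp
  have cp: "char_poly ?M = map_poly of_int (char_poly M)"
    by (rule of_int_hom.char_poly_hom[OF M])
  have "algebraic_int r"
  proof (rule algebraic_int.intros)
    show "lead_coeff (char_poly ?M) = 1" using degree_monic_char_poly[of ?M m] M by simp
    show "\<forall>i. Polynomial.coeff (char_poly ?M) i \<in> \<int>" unfolding cp by simp
  qed (rule root)
  then show ?thesis using rational_algebraic_int_is_int r(2) by blast
qed

lemma cyc_ints_of_int_dvd:
  assumes "m > 0" "r \<in> cyc_ints m" "of_int z = of_int k * r"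
  shows "k dvd z"
proof (cases "k = 0")
  case False
  then have "r = of_int z / of_int k" using assms(3) by simp
  then have "r \<in> \<rat>" by simp
  then have "r \<in> \<int>" by (rule cyc_ints_rational_imp_int[OF assms(1,2)])
  then obtain y where "r = of_int y" by (elim Ints_cases)
  then have "(of_int z :: complex) = of_int (k * y)" using assms(3) by simp
  then have "z = k * y" by (rule of_int_eq_iff[THEN iffD1])
  then show ?thesis by simp
next
  case True
  then show ?thesis using assms(3) by simp
qed

text \<open>A rational number whose powers all become cyclotomic integers after multiplication by one
  fixed positive integer \<open>d\<close> is an integer: the powers of its denominator divide \<open>d\<close>.\<close>

lemma dvd_of_powers_cyc_ints:
  fixes a b d :: nat
  assumes m: "m > 0" and b: "b > 0" and d: "d > 0"
    and int: "\<And>k. (of_nat a / of_nat b) ^ k * of_nat d \<in> cyc_ints m"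
  shows "b dvd a"
proof -
  have dv: "b ^ k dvd a ^ k * d" for k
  proof -
    have "(of_int (int (a ^ k * d)) :: complex) = of_int (int (b ^ k)) * ((of_nat a / of_nat b) ^ k * of_nat d)"
      unfolding power_divide using b by simp
    then have "int (b ^ k) dvd int (a ^ k * d)" by (rule cyc_ints_of_int_dvd[OF m int])
    then show ?thesis by (rule of_nat_dvd_iff[THEN iffD1])
  qed
  define g where "g = gcd a b"
  have g: "g > 0" using b by (simp add: g_def)
  obtain a' b' where ab: "a = a' * g" "b = b' * g" "coprime a' b'"
    using gcd_coprime_exists[of a b] g unfolding g_def by (metis less_not_refl2)
  have "b' ^ k dvd d" for k
  proof -
    have "b' ^ k * g ^ k dvd (a' ^ k * d) * g ^ k"
      using dv[of k] unfolding ab(1,2) power_mult_distrib by (simp only: mult_ac)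
    then have "b' ^ k dvd a' ^ k * d" using g by simp
    then show ?thesis using ab(3) by (simp add: coprime_commute coprime_dvd_mult_right_iff)
  qed
  then have "b' ^ d dvd d" .
  then have "b' ^ d \<le> d" using d by (rule dvd_imp_le)
  have "b' = 1"
  proof (rule ccontr)
    assume "b' \<noteq> 1"
    moreover have "b' \<noteq> 0" using b ab by auto
    ultimately have "b' \<ge> 2" by simp
    then have "(2::nat) ^ d \<le> b' ^ d" by (rule power_mono) simp
    moreover have "d < 2 ^ d" by simp
    ultimately show False using \<open>b' ^ d \<le> d\<close> by linarith
  qed
  then show ?thesis using ab by simp
qed

section \<open>Representations and Schur's lemma\<close>

lemma mat_eqI_mult_vec:
  fixes A B :: "complex mat"
  assumes "A \<in> carrier_mat m n" "B \<in> carrier_mat m n" "\<And>v. v \<in> carrier_vec n \<Longrightarrow> A *\<^sub>v v = B *\<^sub>v v"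
  shows "A = B"
proof (rule eq_matI)
  fix i j assume ij: "i < dim_row B" "j < dim_col B"
  have "(A *\<^sub>v unit_vec n j) $ i = (B *\<^sub>v unit_vec n j) $ i" using assms(3) by simp
  then show "A $$ (i, j) = B $$ (i, j)" using ij assms(1,2) by simp
qed (use assms in auto)

lemma subspace_vecI:
  assumes "W \<subseteq> carrier_vec n" "0\<^sub>v n \<in> W"
    "\<And>v w. v \<in> W \<Longrightarrow> w \<in> W \<Longrightarrow> v + w \<in> W" "\<And>c v. v \<in> W \<Longrightarrow> c \<cdot>\<^sub>v v \<in> W"
  shows "VectorSpace.subspace class_ring W (module_vec TYPE(complex) n)"
  unfolding VectorSpace.subspace_def submodule_def
  using assms vec_vs[of n] vec_module[of n] by (auto simp: module_vec_simps)

lemma subspace_vecD: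
  assumes "VectorSpace.subspace class_ring W (module_vec TYPE(complex) n)"
  shows "W \<subseteq> carrier_vec n" "0\<^sub>v n \<in> W"
    "\<And>v w. v \<in> W \<Longrightarrow> w \<in> W \<Longrightarrow> v + w \<in> W" "\<And>c v. v \<in> W \<Longrightarrow> c \<cdot>\<^sub>v v \<in> W"
  using assms unfolding VectorSpace.subspace_def submodule_def
  by (auto simp: module_vec_simps)

text \<open>A finite group with a complex matrix representation of degree \<open>n\<close>. The character is written
  as the trace, without restriction to the carrier, and \<open>N\<close> is the group order.\<close>

locale fin_rep = group G for G (structure) +
  fixes n :: nat and \<rho> :: "'a \<Rightarrow> complex mat"
  assumes fin [simp]: "finite (carrier G)" and rep: "is_rep G n \<rho>"
begin

abbreviation \<chi> :: "'a \<Rightarrow> complex" where "\<chi> g \<equiv> mat_trace (\<rho> g)"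

abbreviation N :: nat where "N \<equiv> card (carrier G)"

lemma n_pos: "n > 0" and hom: "\<rho> \<in> hom G (GL n)"
  using rep unfolding is_rep_def by auto

lemma N_pos: "N > 0"
  using fin one_closed card_gt_0_iff by blast

lemma N_nonzero: "of_nat N \<noteq> (0::complex)"
  using N_pos by (metis less_irrefl of_nat_eq_0_iff)

lemma rho_carrier [simp, intro]: "g \<in> carrier G \<Longrightarrow> \<rho> g \<in> carrier_mat n n"
  using hom unfolding hom_def units_of_def Units_def by (auto simp: ring_mat_def)

lemma rho_dim [simp]: "g \<in> carrier G \<Longrightarrow> dim_row (\<rho> g) = n" "g \<in> carrier G \<Longrightarrow> dim_col (\<rho> g) = n"
  by (auto dest: rho_carrier simp del: rho_carrier)

lemma rho_mult: "g \<in> carrier G \<Longrightarrow> h \<in> carrier G \<Longrightarrow> \<rho> (g \<otimes> h) = \<rho> g * \<rho> h"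
  using hom unfolding hom_def units_of_def by (auto simp: ring_mat_def)

lemma rho_one [simp]: "\<rho> \<one> = 1\<^sub>m n"
proof -
  have "\<rho> \<one> \<in> Units (ring_mat TYPE(complex) n ())"
    using hom unfolding hom_def units_of_def by auto
  then obtain B where B: "B \<in> carrier_mat n n" "\<rho> \<one> * B = 1\<^sub>m n"
    unfolding Units_def by (auto simp: ring_mat_def)
  have "\<rho> \<one> = \<rho> \<one> * (\<rho> \<one> * B)" using B by simp
  also have "\<dots> = \<rho> \<one> * \<rho> \<one> * B" using B by (intro assoc_mult_mat[symmetric]) auto
  also have "\<dots> = 1\<^sub>m n" using B rho_mult[of \<one> \<one>] by simp
  finally show ?thesis .
qed

lemma rho_inv: "g \<in> carrier G \<Longrightarrow> \<rho> g * \<rho> (inv g) = 1\<^sub>m n" "g \<in> carrier G \<Longrightarrow> \<rho> (inv g) * \<rho> g = 1\<^sub>m n"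
  using rho_mult[of g "inv g"] rho_mult[of "inv g" g] by auto

lemma rho_pow: "g \<in> carrier G \<Longrightarrow> \<rho> (g [^] (k::nat)) = \<rho> g ^\<^sub>m k"
  by (induction k) (auto simp: rho_mult)

lemma chi_one [simp]: "\<chi> \<one> = of_nat n"
  by simp

lemma chi_mult_comm: "g \<in> carrier G \<Longrightarrow> h \<in> carrier G \<Longrightarrow> \<chi> (g \<otimes> h) = \<chi> (h \<otimes> g)"
  by (simp add: rho_mult mat_trace_mult_comm[of _ n n])

lemma chi_conj: "g \<in> carrier G \<Longrightarrow> u \<in> carrier G \<Longrightarrow> \<chi> (u \<otimes> g \<otimes> inv u) = \<chi> g"
  using chi_mult_comm[of "u \<otimes> g" "inv u"] by (simp add: m_assoc[symmetric])

lemma pow_N: "g \<in> carrier G \<Longrightarrow> g [^] N = \<one>"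
  using pow_order_eq_1 fin unfolding Coset.order_def by blast

lemma chi_cyc_ints:
  assumes g: "g \<in> carrier G"
  shows "\<chi> g \<in> cyc_ints N"
proof -
  have "\<rho> g ^\<^sub>m N = 1\<^sub>m n" using rho_pow[OF g, of N] pow_N[OF g] by simp
  then obtain es where es: "\<And>e. e \<in> set es \<Longrightarrow> e ^ N = 1"
    "\<And>k. mat_trace (\<rho> g ^\<^sub>m k) = (\<Sum>e\<leftarrow>es. e ^ k)"
    using finite_order_trace[OF rho_carrier[OF g] _ N_pos] by blast
  have "\<chi> g = (\<Sum>e\<leftarrow>es. e)" using es(2)[of 1] g by simp
  also have "\<dots> \<in> cyc_ints N"
    by (intro cyc_ints_sum_list cyc_ints_root_of_unity[OF N_pos] es(1))
  finally show ?thesis .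
qed

lemma chi_inv:
  assumes g: "g \<in> carrier G"
  shows "\<chi> (inv g) = cnj (\<chi> g)"
proof -
  have "\<rho> g ^\<^sub>m N = 1\<^sub>m n" using rho_pow[OF g, of N] pow_N[OF g] by simp
  then obtain es where es: "\<And>e. e \<in> set es \<Longrightarrow> e ^ N = 1"
    "\<And>k. mat_trace (\<rho> g ^\<^sub>m k) = (\<Sum>e\<leftarrow>es. e ^ k)"
    using finite_order_trace[OF rho_carrier[OF g] _ N_pos] by blast
  have cnj: "e ^ (N - 1) = cnj e" if "e \<in> set es" for e
  proof -
    have e: "e ^ N = 1" using es(1) that .
    then have "norm e ^ N = 1" by (metis norm_one norm_power)
    then have "norm e = 1" using power_eq_imp_eq_base[of "norm e" N 1] N_pos by simp
    then have "e * cnj e = 1" by (simp add: complex_norm_square[symmetric])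
    moreover have "e * e ^ (N - 1) = 1" using e N_pos by (metis Suc_pred' power_Suc)
    ultimately show ?thesis by (metis mult_cancel_left mult_zero_left zero_neq_one)
  qed
  have "g [^] (N - 1) \<otimes> g = \<one>" using pow_N[OF g] N_pos g
    by (metis One_nat_def Suc_pred nat_pow_Suc)
  then have "inv g = g [^] (N - 1)" using g by (simp add: inv_equality)
  then have "\<chi> (inv g) = (\<Sum>e\<leftarrow>es. e ^ (N - 1))" using rho_pow[OF g] es(2) by simp
  also have "\<dots> = (\<Sum>e\<leftarrow>es. cnj e)" using cnj by (intro arg_cong[where f = sum_list] map_cong) auto
  also have "\<dots> = cnj (\<Sum>e\<leftarrow>es. e)" by (induction es) auto
  also have "(\<Sum>e\<leftarrow>es. e) = \<chi> g" using es(2)[of 1] g by simp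
  finally show ?thesis .
qed

lemma bij_mult_right: "g \<in> carrier G \<Longrightarrow> bij_betw (\<lambda>x. x \<otimes> g) (carrier G) (carrier G)"
  by (rule bij_betw_byWitness[where f' = "\<lambda>x. x \<otimes> inv g"]) (auto simp: m_assoc)

lemma bij_mult_left: "g \<in> carrier G \<Longrightarrow> bij_betw (\<lambda>x. g \<otimes> x) (carrier G) (carrier G)"
  by (rule bij_betw_byWitness[where f' = "\<lambda>x. inv g \<otimes> x"]) (auto simp: m_assoc[symmetric])

text \<open>The sum of the conjugates of a matrix, which commutes with the representation.\<close>

definition conj_sum :: "complex mat \<Rightarrow> complex mat" where
  "conj_sum B = msum n n (\<lambda>x. \<rho> (inv x) * B * \<rho> x) (carrier G)"

lemma conj_sum_carrier [simp, intro]: "conj_sum B \<in> carrier_mat n n"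
  by (simp add: conj_sum_def)

lemma conj_sum_commute:
  assumes g: "g \<in> carrier G" and B: "B \<in> carrier_mat n n"
  shows "conj_sum B * \<rho> g = \<rho> g * conj_sum B"
proof -
  have "\<rho> g * conj_sum B = msum n n (\<lambda>x. \<rho> g * (\<rho> (inv x) * B * \<rho> x)) (carrier G)"
    unfolding conj_sum_def using B g by (intro msum_mult_left) auto
  also have "\<dots> = msum n n (\<lambda>x. \<rho> g * (\<rho> (inv (x \<otimes> g)) * B * \<rho> (x \<otimes> g))) (carrier G)"
    by (rule msum_reindex_bij[OF bij_mult_right[OF g]])
  also have "\<dots> = msum n n (\<lambda>x. \<rho> (inv x) * B * \<rho> x * \<rho> g) (carrier G)"
  proof (rule msum_cong[OF refl])
    fix x assume x: "x \<in> carrier G"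
    have [simp]: "\<rho> (inv x) * B * \<rho> x \<in> carrier_mat n n" using x B by auto
    have "\<rho> (inv (x \<otimes> g)) * B * \<rho> (x \<otimes> g) = \<rho> (inv g) * \<rho> (inv x) * B * (\<rho> x * \<rho> g)"
      using x g by (simp add: rho_mult inv_mult_group)
    also have "\<dots> = \<rho> (inv g) * (\<rho> (inv x) * (B * (\<rho> x * \<rho> g)))"
      using x g B by (simp add: sq_mult[of _ n] sq_assoc[of _ n])
    also have "\<rho> (inv x) * (B * (\<rho> x * \<rho> g)) = \<rho> (inv x) * B * \<rho> x * \<rho> g"
      using x g B by (simp add: sq_mult[of _ n] sq_assoc[of _ n])
    finally have "\<rho> g * (\<rho> (inv (x \<otimes> g)) * B * \<rho> (x \<otimes> g)) = \<rho> g * (\<rho> (inv g) * (\<rho> (inv x) * B * \<rho> x * \<rho> g))"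
      by simp
    also have "\<dots> = \<rho> g * \<rho> (inv g) * (\<rho> (inv x) * B * \<rho> x * \<rho> g)"
      using x g B by (intro sq_assoc[of _ n, symmetric] sq_mult) auto
    also have "\<dots> = \<rho> (inv x) * B * \<rho> x * \<rho> g" using rho_inv[OF g] x g B by simp
    finally show "\<rho> g * (\<rho> (inv (x \<otimes> g)) * B * \<rho> (x \<otimes> g)) = \<rho> (inv x) * B * \<rho> x * \<rho> g" .
  qed
  also have "\<dots> = conj_sum B * \<rho> g"
    unfolding conj_sum_def using B g by (intro msum_mult_right[symmetric]) auto
  finally show ?thesis ..
qed

lemma trace_conj_sum:
  assumes B: "B \<in> carrier_mat n n"
  shows "mat_trace (conj_sum B) = of_nat N * mat_trace B"
proof -
  have "mat_trace (conj_sum B) = (\<Sum>x\<in>carrier G. mat_trace (\<rho> (inv x) * B * \<rho> x))"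
    unfolding conj_sum_def using B by (intro mat_trace_msum) auto
  also have "\<dots> = (\<Sum>x\<in>carrier G. mat_trace B)"
    using B rho_inv by (intro sum.cong refl mat_trace_conj[of _ n]) auto
  finally show ?thesis by simp
qed

end

locale irr_rep = fin_rep +
  assumes irr: "irreducible_rep G n \<rho>"
begin

text \<open>Schur's lemma: an eigenspace of a matrix that commutes with the representation is
  invariant.\<close>

lemma schur:
  assumes A: "A \<in> carrier_mat n n" and comm: "\<And>g. g \<in> carrier G \<Longrightarrow> A * \<rho> g = \<rho> g * A"
  obtains c where "A = c \<cdot>\<^sub>m 1\<^sub>m n"
proof -
  obtain c where "eigenvalue A c"
    using spectrum_non_empty[OF A n_pos] unfolding spectrum_def by auto
  then obtain v0 where v0: "v0 \<in> carrier_vec n" "v0 \<noteq> 0\<^sub>v n" "A *\<^sub>v v0 = c \<cdot>\<^sub>v v0"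
    using A unfolding eigenvalue_def eigenvector_def by auto
  define W where "W = {v \<in> carrier_vec n. A *\<^sub>v v = c \<cdot>\<^sub>v v}"
  have sub: "VectorSpace.subspace class_ring W (module_vec TYPE(complex) n)"
  proof (rule subspace_vecI)
    fix d v assume "v \<in> W"
    then have v: "v \<in> carrier_vec n" "A *\<^sub>v v = c \<cdot>\<^sub>v v" by (auto simp: W_def)
    have "A *\<^sub>v (d \<cdot>\<^sub>v v) = d \<cdot>\<^sub>v (A *\<^sub>v v)" using A v(1) by (rule mult_mat_vec)
    also have "\<dots> = c \<cdot>\<^sub>v (d \<cdot>\<^sub>v v)" unfolding v(2) by (simp add: smult_smult_assoc mult.commute)
    finally show "d \<cdot>\<^sub>v v \<in> W" using v by (simp add: W_def)
  qed (use A in \<open>auto simp: W_def mult_add_distrib_mat_vec smult_add_distrib_vec\<close>)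
  have "\<rho> g *\<^sub>v w \<in> W" if g: "g \<in> carrier G" and w: "w \<in> W" for g w
  proof -
    have wc: "w \<in> carrier_vec n" "A *\<^sub>v w = c \<cdot>\<^sub>v w" using w by (auto simp: W_def)
    have "A *\<^sub>v (\<rho> g *\<^sub>v w) = (A * \<rho> g) *\<^sub>v w" using A g wc by (intro assoc_mult_mat_vec[symmetric]) auto
    also have "\<dots> = \<rho> g *\<^sub>v (A *\<^sub>v w)" unfolding comm[OF g] using A g wc(1) by (intro assoc_mult_mat_vec) auto
    also have "\<dots> = c \<cdot>\<^sub>v (\<rho> g *\<^sub>v w)" unfolding wc(2) using g wc(1) by (intro mult_mat_vec) auto
    finally show ?thesis using mult_mat_vec_carrier[OF rho_carrier[OF g] wc(1)] by (simp add: W_def)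
  qed
  with sub irr have "W = {0\<^sub>v n} \<or> W = carrier_vec n" unfolding irreducible_rep_def by blast
  moreover have "v0 \<in> W" using v0 by (simp add: W_def)
  ultimately have W: "W = carrier_vec n" using v0 by auto
  have "A = c \<cdot>\<^sub>m 1\<^sub>m n"
  proof (rule mat_eqI_mult_vec[OF A])
    fix v :: "complex vec" assume v: "v \<in> carrier_vec n"
    then have "A *\<^sub>v v = c \<cdot>\<^sub>v v" using W by (auto simp: W_def)
    also have "\<dots> = (c \<cdot>\<^sub>m 1\<^sub>m n) *\<^sub>v v" using v by (intro eq_vecI) (auto simp: scalar_prod_left_unit)
    finally show "A *\<^sub>v v = (c \<cdot>\<^sub>m 1\<^sub>m n) *\<^sub>v v" .
  qed simp
  then show thesis using that by blast
qed

lemma schur_trace: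
  assumes A: "A \<in> carrier_mat n n" and comm: "\<And>g. g \<in> carrier G \<Longrightarrow> A * \<rho> g = \<rho> g * A"
  shows "A = (mat_trace A / of_nat n) \<cdot>\<^sub>m 1\<^sub>m n"
proof -
  obtain c where c: "A = c \<cdot>\<^sub>m 1\<^sub>m n" using schur[OF assms] by blast
  have "mat_trace A = c * of_nat n" unfolding c by (simp add: mat_trace_smult[of _ n])
  then show ?thesis using c n_pos by simp
qed

lemma conj_sum_eq:
  assumes "B \<in> carrier_mat n n"
  shows "conj_sum B = (of_nat N * mat_trace B / of_nat n) \<cdot>\<^sub>m 1\<^sub>m n"
  using schur_trace[of "conj_sum B"] conj_sum_commute[OF _ assms] trace_conj_sum[OF assms] by simp

text \<open>Schur's orthogonality relations for the matrix coefficients.\<close>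

lemma coeff_orthogonality:
  assumes "i < n" "j < n" "k < n" "l < n"
  shows "(\<Sum>x\<in>carrier G. \<rho> (inv x) $$ (i, j) * \<rho> x $$ (k, l))
    = (if i = l \<and> j = k then of_nat N / of_nat n else 0)"
proof -
  define B where "B = mat n n (\<lambda>(a, b). if a = j \<and> b = k then 1 else (0::complex))"
  have B: "B \<in> carrier_mat n n" by (simp add: B_def)
  have trB: "mat_trace B = (if j = k then 1 else 0)"
    unfolding mat_trace_def B_def using assms by (simp add: if_distrib sum.delta cong: if_cong)
  have "(\<rho> (inv x) * B * \<rho> x) $$ (i, l) = \<rho> (inv x) $$ (i, j) * \<rho> x $$ (k, l)"
    if x: "x \<in> carrier G" for x
  proof -
    have 1: "(\<rho> (inv x) * B) $$ (i, b) = (if b = k then \<rho> (inv x) $$ (i, j) else 0)" if "b < n" for b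
    proof -
      have "(\<rho> (inv x) * B) $$ (i, b) = (\<Sum>a<n. \<rho> (inv x) $$ (i, a) * (if a = j \<and> b = k then 1 else 0))"
        using assms x that by (auto simp: B_def scalar_prod_def atLeast0LessThan)
      also have "\<dots> = (\<Sum>a\<in>{j}. \<rho> (inv x) $$ (i, a) * (if a = j \<and> b = k then 1 else 0))"
        using assms by (intro sum.mono_neutral_right) auto
      finally show ?thesis by simp
    qed
    have "(\<rho> (inv x) * B * \<rho> x) $$ (i, l) = (\<Sum>b<n. (\<rho> (inv x) * B) $$ (i, b) * \<rho> x $$ (b, l))"
      using assms x B by (auto simp: scalar_prod_def atLeast0LessThan)
    also have "\<dots> = (\<Sum>b<n. (if b = k then \<rho> (inv x) $$ (i, j) else 0) * \<rho> x $$ (b, l))"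
      using 1 by (intro sum.cong) auto
    also have "\<dots> = (\<Sum>b\<in>{k}. (if b = k then \<rho> (inv x) $$ (i, j) else 0) * \<rho> x $$ (b, l))"
      using assms by (intro sum.mono_neutral_right) auto
    finally show ?thesis by simp
  qed
  then have "(\<Sum>x\<in>carrier G. \<rho> (inv x) $$ (i, j) * \<rho> x $$ (k, l)) = conj_sum B $$ (i, l)"
    unfolding conj_sum_def using assms by simp
  also have "\<dots> = (if i = l \<and> j = k then of_nat N / of_nat n else 0)"
    unfolding conj_sum_eq[OF B] trB using assms by simp
  finally show ?thesis .
qed

lemma chi_conj_sum:
  assumes y: "y \<in> carrier G" and z: "z \<in> carrier G"
  shows "(\<Sum>u\<in>carrier G. \<chi> (inv u \<otimes> y \<otimes> u \<otimes> z)) = of_nat N / of_nat n * \<chi> y * \<chi> z"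
proof -
  have "(\<Sum>u\<in>carrier G. \<chi> (inv u \<otimes> y \<otimes> u \<otimes> z))
      = mat_trace (msum n n (\<lambda>u. \<rho> (inv u) * \<rho> y * \<rho> u * \<rho> z) (carrier G))"
    by (subst mat_trace_msum) (use y z in \<open>auto simp: rho_mult\<close>)
  also have "msum n n (\<lambda>u. \<rho> (inv u) * \<rho> y * \<rho> u * \<rho> z) (carrier G) = conj_sum (\<rho> y) * \<rho> z"
    unfolding conj_sum_def using y z by (intro msum_mult_right[symmetric]) auto
  also have "\<dots> = (of_nat N * \<chi> y / of_nat n) \<cdot>\<^sub>m \<rho> z"
    using y z by (simp add: conj_sum_eq smult_mult_mat[of _ n n _ n])
  also have "mat_trace \<dots> = of_nat N * \<chi> y / of_nat n * \<chi> z"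
    using z by (simp add: mat_trace_smult[of _ n])
  finally show ?thesis by simp
qed

text \<open>For \<open>z = \<one>\<close> this is the norm relation; in general it says that an irreducible character is
  idempotent under convolution up to the scalar \<open>N / n\<close>.\<close>

lemma chi_convolution:
  assumes z: "z \<in> carrier G"
  shows "(\<Sum>x\<in>carrier G. \<chi> (inv x) * \<chi> (x \<otimes> z)) = of_nat N / of_nat n * \<chi> z"
proof -
  have tr: "\<chi> (x \<otimes> z) = (\<Sum>k<n. \<Sum>l<n. \<rho> x $$ (k, l) * \<rho> z $$ (l, k))" if "x \<in> carrier G" for x
    unfolding mat_trace_def using that z
    by (auto simp: rho_mult scalar_prod_def atLeast0LessThan intro!: sum.cong)
  have "(\<Sum>x\<in>carrier G. \<chi> (inv x) * \<chi> (x \<otimes> z))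
      = (\<Sum>x\<in>carrier G. (\<Sum>i<n. \<rho> (inv x) $$ (i, i)) * (\<Sum>k<n. \<Sum>l<n. \<rho> x $$ (k, l) * \<rho> z $$ (l, k)))"
    using tr by (intro sum.cong) (auto simp: mat_trace_def)
  also have "\<dots> = (\<Sum>x\<in>carrier G. \<Sum>i<n. \<Sum>k<n. \<Sum>l<n. (\<rho> (inv x) $$ (i, i) * \<rho> x $$ (k, l)) * \<rho> z $$ (l, k))"
    by (simp only: sum_distrib_right) (simp add: sum_distrib_left mult.assoc)
  also have "\<dots> = (\<Sum>i<n. \<Sum>k<n. \<Sum>l<n. (\<Sum>x\<in>carrier G. \<rho> (inv x) $$ (i, i) * \<rho> x $$ (k, l)) * \<rho> z $$ (l, k))"
    by (subst sum.swap, intro sum.cong refl, subst sum.swap, intro sum.cong refl, subst sum.swap)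
      (simp add: sum_distrib_right)
  also have "\<dots> = (\<Sum>i<n. \<Sum>k<n. \<Sum>l<n. (if i = l \<and> i = k then of_nat N / of_nat n else 0) * \<rho> z $$ (l, k))"
    by (intro sum.cong refl arg_cong2[where f = "(*)"] coeff_orthogonality) auto
  also have "\<dots> = (\<Sum>i<n. of_nat N / of_nat n * \<rho> z $$ (i, i))"
  proof (intro sum.cong refl)
    fix i assume "i \<in> {..<n}"
    have "(\<Sum>k<n. \<Sum>l<n. (if i = l \<and> i = k then of_nat N / of_nat n else 0) * \<rho> z $$ (l, k))
        = (\<Sum>k\<in>{i}. \<Sum>l<n. (if i = l \<and> i = k then of_nat N / of_nat n else 0) * \<rho> z $$ (l, k))"
      using \<open>i \<in> {..<n}\<close> by (intro sum.mono_neutral_right) auto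
    also have "\<dots> = (\<Sum>l<n. (if i = l then of_nat N / of_nat n else 0) * \<rho> z $$ (l, i))"
      by simp
    also have "\<dots> = (\<Sum>l\<in>{i}. (if i = l then of_nat N / of_nat n else 0) * \<rho> z $$ (l, i))"
      using \<open>i \<in> {..<n}\<close> by (intro sum.mono_neutral_right) auto
    finally show "(\<Sum>k<n. \<Sum>l<n. (if i = l \<and> i = k then of_nat N / of_nat n else 0) * \<rho> z $$ (l, k))
        = of_nat N / of_nat n * \<rho> z $$ (i, i)" by simp
  qed
  also have "\<dots> = of_nat N / of_nat n * \<chi> z"
    using z by (simp add: mat_trace_def sum_distrib_left)
  finally show ?thesis .
qed

lemma chi_norm: "(\<Sum>x\<in>carrier G. (cmod (\<chi> x))\<^sup>2) = real N"
proof -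
  have "complex_of_real (\<Sum>x\<in>carrier G. (cmod (\<chi> x))\<^sup>2) = (\<Sum>x\<in>carrier G. \<chi> (inv x) * \<chi> (x \<otimes> \<one>))"
    
    unfolding of_real_sum complex_norm_square by (simp add: chi_inv mult.commute)
  also have "\<dots> = complex_of_real (real N)"
    using n_pos by (subst chi_convolution) auto
  finally show ?thesis unfolding of_real_eq_iff .
qed

text \<open>Convolution with the character multiplies its values by the quotient \<open>N / n\<close>, so all powers
  of this quotient times the degree are cyclotomic integers.\<close>

lemma degree_dvd_order: "n dvd N"
proof (rule dvd_of_powers_cyc_ints[OF N_pos n_pos n_pos])
  have "(of_nat N / of_nat n) ^ k * \<chi> z \<in> cyc_ints N" if "z \<in> carrier G" for k z
    using that
  proof (induction k arbitrary: z)
    case (Suc k)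
    have "(of_nat N / of_nat n) ^ Suc k * \<chi> z
        = (\<Sum>x\<in>carrier G. \<chi> (inv x) * ((of_nat N / of_nat n) ^ k * \<chi> (x \<otimes> z)))"
    proof -
      have "(of_nat N / of_nat n) ^ Suc k * \<chi> z = (of_nat N / of_nat n) ^ k * (\<Sum>x\<in>carrier G. \<chi> (inv x) * \<chi> (x \<otimes> z))"
        unfolding chi_convolution[OF Suc.prems] by simp
      then show ?thesis unfolding sum_distrib_left by (simp only: mult.left_commute)
    qed
    also have "\<dots> \<in> cyc_ints N"
      by (intro cyc_ints_sum cyc_ints_mult[OF N_pos] chi_cyc_ints Suc.IH) (use Suc.prems in auto)
    finally show ?case .
  qed (simp add: chi_cyc_ints)
  from this[of \<one>] show "(of_nat N / of_nat n) ^ k * of_nat n \<in> cyc_ints N" for k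
    by simp
qed

end

section \<open>Characters of defect zero on p-elements\<close>

text \<open>Under a cyclic action of order dividing \<open>p\<^sup>j\<close> without fixed points of the \<open>p\<^sup>i\<close>-th power, all
  orbits have length divisible by \<open>p\<^sup>i\<^sup>+\<^sup>1\<close>. The set \<open>T\<close> consists of orbit representatives, so that the
  sum of an invariant function is \<open>p\<^sup>i\<^sup>+\<^sup>1\<close> times a combination of its values with natural
  coefficients.\<close>

lemma sum_over_cyclic_orbits:
  fixes w :: "'b \<Rightarrow> complex" and p i j :: nat
  assumes p: "prime p" and S: "finite S"
    and closed: "\<And>x. x \<in> S \<Longrightarrow> \<sigma> x \<in> S"
    and period: "\<And>x. x \<in> S \<Longrightarrow> (\<sigma> ^^ (p ^ j)) x = x"
    and nofix: "\<And>x. x \<in> S \<Longrightarrow> (\<sigma> ^^ (p ^ i)) x \<noteq> x"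
    and inv: "\<And>x. x \<in> S \<Longrightarrow> w (\<sigma> x) = w x"
  shows "\<exists>T m. T \<subseteq> S \<and> (\<Sum>x\<in>S. w x) = of_nat (p ^ Suc i) * (\<Sum>x\<in>T. of_nat (m x) * w x)"
  using S closed period nofix inv
proof (induction S rule: finite_psubset_induct)
  case (psubset S)
  show ?case
  proof (cases "S = {}")
    case False
    then obtain x where x: "x \<in> S" by blast
    have pow_in: "(\<sigma> ^^ t) y \<in> S" if "y \<in> S" for y t
      by (induction t) (use that psubset.prems(1) in auto)
    have pow_w: "w ((\<sigma> ^^ t) x) = w x" for t
      by (induction t) (use x pow_in psubset.prems(4) in auto)
    \<comment> \<open>The length of the orbit of \<open>x\<close>, a power of \<open>p\<close> that does not divide \<open>p ^ i\<close>.\<close>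
    define d where "d = (LEAST t. t > 0 \<and> (\<sigma> ^^ t) x = x)"
    have ex: "p ^ j > 0 \<and> (\<sigma> ^^ (p ^ j)) x = x"
      using p psubset.prems(2)[OF x] by (auto simp: prime_gt_0_nat)
    have d: "d > 0" "(\<sigma> ^^ d) x = x" unfolding d_def using LeastI[of "\<lambda>t. t > 0 \<and> (\<sigma> ^^ t) x = x", OF ex] by auto
    have least: "\<not> (0 < t \<and> t < d \<and> (\<sigma> ^^ t) x = x)" for t
      using not_less_Least[of t "\<lambda>t. t > 0 \<and> (\<sigma> ^^ t) x = x"] unfolding d_def by auto
    have "(\<sigma> ^^ (p ^ j mod d)) x = x" using funpow_mod_eq[OF d(2)] ex by metis
    then have "p ^ j mod d = 0" using least[of "p ^ j mod d"] d by auto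
    then have "d dvd p ^ j" by auto
    then obtain r where r: "d = p ^ r" using divides_primepow_nat[OF p] by blast
    have "\<not> r \<le> i"
    proof
      assume "r \<le> i"
      then have "p ^ i mod d = 0" unfolding r by (simp add: le_imp_power_dvd)
      then have "(\<sigma> ^^ (p ^ i)) x = x" using funpow_mod_eq[OF d(2), of "p ^ i"] by simp
      then show False using psubset.prems(3)[OF x] by simp
    qed
    then have "p ^ Suc i dvd d" unfolding r by (intro le_imp_power_dvd) auto
    then obtain c where c: "d = p ^ Suc i * c" by blast
    define Ob where "Ob = (\<lambda>t. (\<sigma> ^^ t) x) ` {..<d}"
    have inj: "inj_on (\<lambda>t. (\<sigma> ^^ t) x) {..<d}"
    proof (rule linorder_inj_onI)
      fix a b assume ab: "a < b" "a \<in> {..<d}" "b \<in> {..<d}"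
      show "(\<sigma> ^^ a) x \<noteq> (\<sigma> ^^ b) x"
      proof
        assume "(\<sigma> ^^ a) x = (\<sigma> ^^ b) x"
        then have "(\<sigma> ^^ (d - b + a)) x = (\<sigma> ^^ (d - b + b)) x" by (simp only: funpow_add comp_def)
        also have "\<dots> = x" using ab d by simp
        finally show False using least[of "d - b + a"] ab by auto
      qed
    qed auto
    have all_Ob: "(\<sigma> ^^ t) x \<in> Ob" for t
      using funpow_mod_eq[OF d(2), of t] d(1) unfolding Ob_def by (metis imageI lessThan_iff mod_less_divisor)
    have Ob: "Ob \<subseteq> S" unfolding Ob_def using pow_in[OF x] by auto
    have "x \<in> Ob" using all_Ob[of 0] by simp
    have cl: "\<sigma> y \<in> S - Ob" if y: "y \<in> S - Ob" for y
    proof -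
      have "\<sigma> y \<notin> Ob"
      proof
        assume "\<sigma> y \<in> Ob"
        then obtain t where t: "\<sigma> y = (\<sigma> ^^ t) x" unfolding Ob_def by auto
        obtain k where k: "p ^ j = Suc k" using ex by (metis gr0_implies_Suc)
        have "y = (\<sigma> ^^ k) (\<sigma> y)" using psubset.prems(2)[of y] y unfolding k by (simp add: funpow_swap1)
        also have "\<dots> = (\<sigma> ^^ (k + t)) x" unfolding t by (simp add: funpow_add)
        finally have "y \<in> Ob" using all_Ob by metis
        then show False using y by simp
      qed
      then show ?thesis using y psubset.prems(1) by auto
    qed
    have "\<exists>T m. T \<subseteq> S - Ob \<and> (\<Sum>x\<in>S - Ob. w x) = of_nat (p ^ Suc i) * (\<Sum>x\<in>T. of_nat (m x) * w x)"
      by (rule psubset.IH) (use \<open>x \<in> Ob\<close> Ob cl psubset.prems(2-4) in auto)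
    then obtain T m where T: "T \<subseteq> S - Ob"
      "(\<Sum>x\<in>S - Ob. w x) = of_nat (p ^ Suc i) * (\<Sum>x\<in>T. of_nat (m x) * w x)" by blast
    have finT: "finite T" using T(1) psubset.hyps by (meson finite_Diff finite_subset)
    have xT: "x \<notin> T" using T(1) \<open>x \<in> Ob\<close> by auto
    have "(\<Sum>x\<in>Ob. w x) = (\<Sum>t<d. w ((\<sigma> ^^ t) x))"
      unfolding Ob_def by (rule sum.reindex_cong[OF inj refl]) simp
    also have "\<dots> = of_nat (p ^ Suc i) * (of_nat c * w x)" using pow_w by (simp add: c)
    finally have "(\<Sum>x\<in>S. w x) = of_nat (p ^ Suc i) * (\<Sum>x\<in>T. of_nat (m x) * w x) + of_nat (p ^ Suc i) * (of_nat c * w x)"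
      using sum.subset_diff[OF Ob psubset.hyps, of w] T(2) by simp
    also have "\<dots> = of_nat (p ^ Suc i) * (\<Sum>y\<in>insert x T. of_nat ((m(x := c)) y) * w y)"
    proof -
      have "(\<Sum>y\<in>insert x T. of_nat ((m(x := c)) y) * w y) = of_nat c * w x + (\<Sum>y\<in>T. of_nat ((m(x := c)) y) * w y)"
        using finT xT by simp
      also have "(\<Sum>y\<in>T. of_nat ((m(x := c)) y) * w y) = (\<Sum>y\<in>T. of_nat (m y) * w y)"
        using xT by (intro sum.cong) auto
      finally show ?thesis by (simp only: ring_distribs add.commute)
    qed
    finally show ?thesis using T(1) x by (intro exI[of _ "insert x T"] exI[of _ "m(x := c)"]) auto
  qed auto
qed

context group
begin

lemma conj_pow:
  assumes "v \<in> carrier G" "x \<in> carrier G"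
  shows "(v \<otimes> x \<otimes> inv v) [^] (t::nat) = v \<otimes> x [^] t \<otimes> inv v"
proof (induction t)
  case (Suc t)
  have "inv v \<otimes> (v \<otimes> y) = y" if "y \<in> carrier G" for y
    using assms that by (simp add: m_assoc[symmetric])
  then show ?case using assms Suc by (simp add: m_assoc)
qed (use assms in simp)

text \<open>The product of a word.\<close>

definition lprod :: "'a list \<Rightarrow> 'a" where
  "lprod l = foldr (\<otimes>) l \<one>"

lemma lprod_simps [simp]: "lprod [] = \<one>" "lprod (x # l) = x \<otimes> lprod l"
  by (simp_all add: lprod_def)

lemma lprod_closed [simp, intro]: "set l \<subseteq> carrier G \<Longrightarrow> lprod l \<in> carrier G"
  by (induction l) auto

lemma lprod_append: "set k \<subseteq> carrier G \<Longrightarrow> set l \<subseteq> carrier G \<Longrightarrow> lprod (k @ l) = lprod k \<otimes> lprod l"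
  by (induction k) (auto simp: m_assoc)

text \<open>If two words commute and the length of one is a multiple of the length of the other, then
  the longer one is a power of the shorter one.\<close>

lemma lprod_periodic:
  assumes "set s \<subseteq> carrier G" "set l \<subseteq> carrier G" "length l = c * length s" "l @ s = s @ l"
  shows "lprod l = lprod s [^] c"
  using assms(2-4)
proof (induction c arbitrary: l)
  case (Suc c)
  have "length s \<le> length l" using Suc.prems(2) by simp
  then have "take (length s) l = take (length s) (l @ s)" by simp
  also have "\<dots> = s" unfolding Suc.prems(3) by simp
  finally have "take (length s) l = s" .
  then obtain l' where l: "l = s @ l'" by (metis append_take_drop_id)
  have "lprod l' = lprod s [^] c"
    by (rule Suc.IH) (use Suc.prems l in auto)
  then show ?case using l assms(1) Suc.prems
    by (simp add: lprod_append nat_pow_Suc2[symmetric])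
qed simp

lemma lprod_rotate_fixed:
  assumes "set l \<subseteq> carrier G" "length l = c * d" "c > 0" "rotate d l = l"
  obtains s where "s \<in> carrier G" "lprod l = s [^] c"
proof -
  define s l' where "s = take d l" and "l' = drop d l"
  have l: "l = s @ l'" by (simp add: s_def l'_def)
  have "d \<le> length l" using assms(2,3) by simp
  then have len: "length s = d" "length l' = (c - 1) * length s"
    using assms(2) by (auto simp: s_def l'_def diff_mult_distrib)
  have sub: "set s \<subseteq> carrier G" "set l' \<subseteq> carrier G" using assms(1) unfolding l by auto
  have "rotate (length s) (s @ l') = l' @ s" by (rule rotate_append)
  then have "l' @ s = s @ l'" using assms(4) l len by simp
  then have "lprod l' = lprod s [^] (c - 1)" using lprod_periodic[OF sub len(2)] by simp
  then have "lprod l = lprod s [^] c"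
    using sub assms(3) unfolding l by (simp add: lprod_append nat_pow_Suc2[symmetric])
  then show thesis using that sub by blast
qed

end

context irr_rep
begin

text \<open>The coefficients of the central idempotent of the group algebra that belongs to the
  irreducible character.\<close>

definition e_coeff :: "'a \<Rightarrow> complex" where
  "e_coeff g = of_nat n / of_nat N * \<chi> (inv g)"

lemma e_coeff_convolution:
  assumes z: "z \<in> carrier G"
  shows "(\<Sum>x\<in>carrier G. e_coeff x * e_coeff (inv x \<otimes> z)) = e_coeff z"
proof -
  have "(\<Sum>x\<in>carrier G. e_coeff x * e_coeff (inv x \<otimes> z))
      = (\<Sum>x\<in>carrier G. (of_nat n / of_nat N)\<^sup>2 * (\<chi> (inv x) * \<chi> (x \<otimes> inv z)))"
    using z by (intro sum.cong refl)
      (simp add: e_coeff_def inv_mult_group power2_eq_square chi_mult_comm[of "inv z"])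
  also have "\<dots> = (of_nat n / of_nat N)\<^sup>2 * (of_nat N / of_nat n * \<chi> (inv z))"
    using z by (simp add: sum_distrib_left[symmetric] chi_convolution)
  also have "\<dots> = e_coeff z"
    using n_pos N_pos by (simp add: e_coeff_def power2_eq_square)
  finally show ?thesis .
qed

text \<open>The words of length \<open>k\<close> with product \<open>z\<close>.\<close>

definition lists_with_prod :: "nat \<Rightarrow> 'a \<Rightarrow> 'a list set" where
  "lists_with_prod k z = {l. length l = k \<and> set l \<subseteq> carrier G \<and> lprod l = z}"

lemma finite_lists_with_prod [simp]: "finite (lists_with_prod k z)"
  by (rule finite_subset[OF _ finite_lists_length_eq[OF fin, of k]]) (auto simp: lists_with_prod_def)

text \<open>The power of the idempotent with exponent \<open>k + 1\<close>, expanded into words, is the idempotent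
  itself.\<close>

lemma sum_lists_with_prod:
  "z \<in> carrier G \<Longrightarrow> (\<Sum>l\<in>lists_with_prod (Suc k) z. \<Prod>g\<leftarrow>l. e_coeff g) = e_coeff z"
proof (induction k arbitrary: z)
  case 0
  then have "lists_with_prod (Suc 0) z = {[z]}"
    by (auto simp: lists_with_prod_def length_Suc_conv)
  then show ?case by simp
next
  case (Suc k)
  have eq: "lists_with_prod (Suc (Suc k)) z
      = (\<lambda>(x, l). x # l) ` (SIGMA x:carrier G. lists_with_prod (Suc k) (inv x \<otimes> z))"
  proof (intro equalityI subsetI)
    fix l assume l: "l \<in> lists_with_prod (Suc (Suc k)) z"
    then obtain x l' where xl: "l = x # l'" "length l' = Suc k" "x \<in> carrier G" "set l' \<subseteq> carrier G"
      "x \<otimes> lprod l' = z"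
      by (auto simp: lists_with_prod_def length_Suc_conv)
    then have "lprod l' = inv x \<otimes> z" by (metis inv_solve_left lprod_closed Suc.prems)
    then show "l \<in> (\<lambda>(x, l). x # l) ` (SIGMA x:carrier G. lists_with_prod (Suc k) (inv x \<otimes> z))"
      using xl by (auto simp: lists_with_prod_def)
  next
    fix l assume "l \<in> (\<lambda>(x, l). x # l) ` (SIGMA x:carrier G. lists_with_prod (Suc k) (inv x \<otimes> z))"
    then show "l \<in> lists_with_prod (Suc (Suc k)) z"
      using Suc.prems by (auto simp: lists_with_prod_def m_assoc[symmetric])
  qed
  have "(\<Sum>l\<in>lists_with_prod (Suc (Suc k)) z. \<Prod>g\<leftarrow>l. e_coeff g)
      = (\<Sum>(x, l)\<in>(SIGMA x:carrier G. lists_with_prod (Suc k) (inv x \<otimes> z)). e_coeff x * (\<Prod>g\<leftarrow>l. e_coeff g))"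
    unfolding eq by (subst sum.reindex) (auto simp: inj_on_def comp_def case_prod_beta)
  also have "\<dots> = (\<Sum>x\<in>carrier G. \<Sum>l\<in>lists_with_prod (Suc k) (inv x \<otimes> z). e_coeff x * (\<Prod>g\<leftarrow>l. e_coeff g))"
    by (rule sum.Sigma[symmetric]) auto
  also have "\<dots> = (\<Sum>x\<in>carrier G. e_coeff x * e_coeff (inv x \<otimes> z))"
    using Suc by (intro sum.cong refl) (simp add: sum_distrib_left[symmetric])
  finally show ?case using e_coeff_convolution[OF Suc.prems] by simp
qed

text \<open>If \<open>p\<close> does not divide \<open>N / n\<close>, then up to a factor prime to \<open>p\<close> the value of the character at
  a nontrivial \<open>p\<close>-element is divisible by every power of \<open>p\<close> in the cyclotomic integers. (Hence it
  is zero, but this is not needed.)\<close>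

lemma vanishing_on_p_elements:
  assumes p: "prime p" and q: "N = q * n" "\<not> p dvd q"
    and u: "u \<in> carrier G" "u \<noteq> \<one>" "u [^] (p ^ b :: nat) = \<one>"
  shows "\<exists>s r. coprime s p \<and> r \<in> cyc_ints N \<and> of_nat s * \<chi> u = of_nat (p ^ k) * r"
proof -
  \<comment> \<open>The class of the inverse of \<open>u\<close>, since the idempotent has the coefficient \<open>\<chi> (inv g) / q\<close> at \<open>g\<close>.\<close>
  define K where "K = {v \<otimes> inv u \<otimes> inv v | v. v \<in> carrier G}"
  have Ksub: "K \<subseteq> carrier G" using u by (auto simp: K_def)
  then have finK: "finite K" using fin finite_subset by blast
  have "\<one> \<otimes> inv u \<otimes> inv \<one> \<in> K" unfolding K_def using one_closed by blast
  then have K0: "card K \<noteq> 0" using finK by auto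
  have Kconj: "inv x \<otimes> g \<otimes> x \<in> K" if g: "g \<in> K" and x: "x \<in> carrier G" for g x
  proof -
    obtain v where v: "v \<in> carrier G" "g = v \<otimes> inv u \<otimes> inv v" using g by (auto simp: K_def)
    then have "inv x \<otimes> g \<otimes> x = (inv x \<otimes> v) \<otimes> inv u \<otimes> inv (inv x \<otimes> v)"
      using x u by (simp add: inv_mult_group m_assoc)
    then show ?thesis unfolding K_def using x v by blast
  qed
  have q0: "q > 0" using q N_pos by (metis gr0I mult_0)
  have eK: "e_coeff g = e_coeff (inv u)" if gK: "g \<in> K" for g
  proof -
    obtain v where v: "v \<in> carrier G" "g = v \<otimes> inv u \<otimes> inv v" using gK unfolding K_def by blast
    then have "inv g = v \<otimes> u \<otimes> inv v" using u by (simp add: inv_mult_group m_assoc)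
    then show ?thesis unfolding e_coeff_def using chi_conj[OF u(1) v(1)] u by simp
  qed
  define a where "a = multiplicity p N"
  obtain m0 where m0: "N = p ^ a * m0" "\<not> p dvd m0"
    using multiplicity_decompose'[of N p] N_pos p unfolding a_def by (metis not_prime_unit less_not_refl)
  define c where "c = multiplicity p (card K)"
  obtain m1 where m1: "card K = p ^ c * m1" "\<not> p dvd m1"
    using multiplicity_decompose'[of "card K" p] K0 p unfolding c_def by (metis not_prime_unit)
  \<comment> \<open>The power \<open>p ^ c\<close> compensates for the size of the class. Words whose rotation period divides
    \<open>p ^ i\<close> are powers with exponent \<open>p ^ a\<close> of shorter words, hence have \<open>p\<close>-regular products.\<close>
  define i where "i = k + c"
  define Q where "Q = p ^ (i + a)"
  have Qpos: "Q > 0" using p by (simp add: Q_def prime_gt_0_nat)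
  define S where "S = (\<Union>z\<in>K. lists_with_prod Q z)"
  define w where "w l = (\<Prod>g\<leftarrow>l. e_coeff g)" for l
  have Smem: "l \<in> S \<longleftrightarrow> length l = Q \<and> set l \<subseteq> carrier G \<and> lprod l \<in> K" for l
    by (auto simp: S_def lists_with_prod_def)
  have "(\<Sum>l\<in>S. w l) = (\<Sum>z\<in>K. \<Sum>l\<in>lists_with_prod Q z. w l)"
    unfolding S_def by (rule sum.UNION_disjoint) (simp_all add: finK, auto simp: lists_with_prod_def)
  also have "\<dots> = (\<Sum>z\<in>K. e_coeff (inv u))"
  proof (rule sum.cong[OF refl])
    fix z assume z: "z \<in> K"
    have "(\<Sum>l\<in>lists_with_prod Q z. w l) = e_coeff z"
      using sum_lists_with_prod[of z "Q - 1"] z Ksub Qpos unfolding w_def by auto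
    then show "(\<Sum>l\<in>lists_with_prod Q z. w l) = e_coeff (inv u)" using eK[OF z] by simp
  qed
  finally have sumS: "(\<Sum>l\<in>S. w l) = of_nat (card K) * e_coeff (inv u)" by simp
  have "\<exists>T m. T \<subseteq> S \<and> (\<Sum>l\<in>S. w l) = of_nat (p ^ Suc i) * (\<Sum>l\<in>T. of_nat (m l) * w l)"
  proof (rule sum_over_cyclic_orbits[OF p, where \<sigma> = rotate1 and j = "i + a"])
    show "finite S" unfolding S_def using finK by auto
  next
    fix l assume l: "l \<in> S"
    then obtain x l' where xl: "l = x # l'" using Qpos unfolding Smem by (cases l) auto
    have cl: "x \<in> carrier G" "set l' \<subseteq> carrier G" using l unfolding Smem xl by auto
    have "lprod (rotate1 l) = inv x \<otimes> lprod l \<otimes> x"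
      unfolding xl using cl by (simp add: lprod_append m_assoc[symmetric])
    then show "rotate1 l \<in> S" using l Kconj cl(1) unfolding Smem by simp
    show "w (rotate1 l) = w l" unfolding w_def xl by (simp add: mult.commute)
    show "(rotate1 ^^ (p ^ (i + a))) l = l"
      using l unfolding Smem Q_def rotate_def[symmetric] by (simp add: rotate_id)
    show "(rotate1 ^^ (p ^ i)) l \<noteq> l"
    proof
      assume "(rotate1 ^^ (p ^ i)) l = l"
      \<comment> \<open>Then the order of the product divides \<open>m0\<close>, which is prime to \<open>p\<close>, although the product is
        conjugate to the inverse of the nontrivial \<open>p\<close>-element \<open>u\<close>.\<close>
      then have "rotate (p ^ i) l = l" by (simp add: rotate_def)
      moreover have "length l = p ^ a * p ^ i" using l unfolding Smem Q_def by (simp add: power_add)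
      moreover have "p ^ a > 0" using p by (simp add: prime_gt_0_nat)
      ultimately obtain s where s: "s \<in> carrier G" "lprod l = s [^] (p ^ a)"
        using lprod_rotate_fixed l unfolding Smem by blast
      have lp: "lprod l [^] m0 = \<one>"
        unfolding s(2) using s(1) pow_N[OF s(1)] m0(1) by (simp add: nat_pow_pow)
      have "lprod l \<in> K" using l unfolding Smem by blast
      then obtain v where v: "v \<in> carrier G" "lprod l = v \<otimes> inv u \<otimes> inv v" unfolding K_def by blast
      have cp: "(v \<otimes> inv u \<otimes> inv v) [^] t = v \<otimes> inv u [^] t \<otimes> inv v" for t :: nat
        using v(1) u(1) by (intro conj_pow) auto
      have "v \<otimes> inv u [^] m0 \<otimes> inv v = \<one>" using lp cp unfolding v(2) by simp
      then have "inv u [^] m0 = \<one>" using v(1) u(1)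
        by (metis inv_closed inv_comm inv_equality inv_inv l_cancel_one' m_closed nat_pow_closed r_one)
      then have "u [^] m0 = \<one>" using u(1) by (simp add: nat_pow_inv)
      then have "ord u dvd m0" "ord u dvd p ^ b" using u pow_eq_id by auto
      moreover have "coprime m0 (p ^ b)" 
        using prime_imp_coprime[OF p m0(2)] by (simp add: coprime_commute)
      ultimately have "ord u = 1" by (metis coprime_common_divisor_nat)
      then show False using u ord_eq_1 by blast
    qed
  qed
  then obtain T m where T: "T \<subseteq> S"
    "(\<Sum>l\<in>S. w l) = of_nat (p ^ Suc i) * (\<Sum>l\<in>T. of_nat (m l) * w l)" by blast
  define r where "r = (\<Sum>l\<in>T. of_nat (m l) * (of_nat (q ^ Q) * w l))"
  have e_q: "e_coeff g = \<chi> (inv g) / of_nat q" for g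
    unfolding e_coeff_def q(1) using n_pos by simp
  have r: "r \<in> cyc_ints N"
    unfolding r_def
  proof (rule cyc_ints_sum, rule cyc_ints_mult[OF N_pos cyc_ints_of_nat[OF N_pos]])
    fix l assume "l \<in> T"
    then have l: "length l = Q" "set l \<subseteq> carrier G" using T(1) Smem by blast+
    have "of_nat (q ^ length k) * w k = (\<Prod>g\<leftarrow>k. \<chi> (inv g))" for k
      using q0 unfolding w_def e_q by (induction k) auto
    then have "of_nat (q ^ Q) * w l = (\<Prod>g\<leftarrow>l. \<chi> (inv g))" using l(1) by metis
    also have "(\<Prod>g\<leftarrow>l. \<chi> (inv g)) \<in> cyc_ints N"
      using l(2) by (intro cyc_ints_prod_list[OF N_pos] chi_cyc_ints) auto
    finally show "of_nat (q ^ Q) * w l \<in> cyc_ints N" .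
  qed
  have "of_nat (q ^ Q) * (of_nat (card K) * e_coeff (inv u)) = of_nat (p ^ Suc i) * r"
    unfolding sumS[symmetric] T(2) r_def by (simp add: sum_distrib_left mult_ac)
  moreover have "e_coeff (inv u) = \<chi> u / of_nat q" unfolding e_q using u by simp
  ultimately have "of_nat (q ^ Q) * (of_nat (p ^ c * m1) * \<chi> u) = of_nat (p ^ Suc i) * r * of_nat q"
    unfolding m1(1) using q0 by (simp add: field_simps)
  then have "of_nat (p ^ c) * (of_nat (q ^ Q * m1) * \<chi> u) = of_nat (p ^ c) * (of_nat (p ^ k) * (of_nat p * r * of_nat q))"
    unfolding i_def by (simp add: power_add mult_ac)
  then have "of_nat (q ^ Q * m1) * \<chi> u = of_nat (p ^ k) * (of_nat p * r * of_nat q)"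
    using p by (simp add: prime_gt_0_nat)
  moreover have "coprime (q ^ Q * m1) p"
    using prime_imp_coprime[OF p q(2)] prime_imp_coprime[OF p m1(2)] by (simp add: coprime_commute)
  moreover have "of_nat p * r * of_nat q \<in> cyc_ints N"
    by (intro cyc_ints_mult[OF N_pos] cyc_ints_of_nat[OF N_pos] r)
  ultimately show ?thesis by blast
qed

end

section \<open>Subrepresentations and irreducible constituents\<close>

lemma left_inverse_dims_le:
  fixes J K :: "complex mat"
  assumes J: "J \<in> carrier_mat n d" and K: "K \<in> carrier_mat d n" and KJ: "K * J = 1\<^sub>m d"
  shows "d \<le> n"
proof -
  have "(J * K) * (J * K) = J * (K * (J * K))" using J K by (intro assoc_mult_mat) auto
  also have "K * (J * K) = (K * J) * K" using J K by (intro assoc_mult_mat[symmetric]) auto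
  finally have idem: "(J * K) * (J * K) = J * K" using KJ K by simp
  have JK: "J * K \<in> carrier_mat n n" using J K by auto
  obtain k where k: "mat_trace (J * K) = of_nat k" "k \<le> n" by (rule idempotent_trace_nat[OF JK idem])
  have "mat_trace (J * K) = mat_trace (K * J)" by (rule mat_trace_mult_comm[OF J K])
  then have "(of_nat k :: complex) = of_nat d" using k KJ by simp
  then show ?thesis using k by simp
qed

text \<open>A subspace is the image of a matrix \<open>J\<close> with a left inverse \<open>K\<close>, namely of one with as many
  columns as possible among those whose image lies in the subspace.\<close>

lemma subspace_basis_matrix:
  fixes W :: "complex vec set"
  assumes W: "W \<subseteq> carrier_vec n" "0\<^sub>v n \<in> W"
    "\<And>v w. v \<in> W \<Longrightarrow> w \<in> W \<Longrightarrow> v + w \<in> W" "\<And>c v. v \<in> W \<Longrightarrow> c \<cdot>\<^sub>v v \<in> W"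
  obtains d J K where "J \<in> carrier_mat n d" "K \<in> carrier_mat d n" "K * J = 1\<^sub>m d"
    "W = (\<lambda>v. J *\<^sub>v v) ` carrier_vec d"
proof -
  define P where "P d \<longleftrightarrow> (\<exists>J K. J \<in> carrier_mat n d \<and> K \<in> carrier_mat d n \<and> K * J = 1\<^sub>m d
    \<and> (\<forall>v\<in>carrier_vec d. J *\<^sub>v v \<in> W))" for d
  have "P 0" unfolding P_def
  proof (rule exI[of _ "0\<^sub>m n 0"], rule exI[of _ "0\<^sub>m 0 n"], intro conjI ballI)
    fix v :: "complex vec" assume "v \<in> carrier_vec 0"
    then have "0\<^sub>m n 0 *\<^sub>v v = 0\<^sub>v n" by (intro eq_vecI) (auto simp: scalar_prod_def)
    then show "0\<^sub>m n 0 *\<^sub>v v \<in> W" using W(2) by simp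
  qed auto
  moreover have bound: "d \<le> n" if "P d" for d
    using that unfolding P_def by (auto intro: left_inverse_dims_le)
  ultimately obtain d where Pd: "P d" and max: "\<And>d'. P d' \<Longrightarrow> d' \<le> d"
    using GreatestI_nat[of P 0 n] Greatest_le_nat[of P _ n] by metis
  from Pd obtain J K where J: "J \<in> carrier_mat n d" and K: "K \<in> carrier_mat d n" and KJ: "K * J = 1\<^sub>m d"
    and im: "\<And>v. v \<in> carrier_vec d \<Longrightarrow> J *\<^sub>v v \<in> W" unfolding P_def by blast
  have "w \<in> (\<lambda>v. J *\<^sub>v v) ` carrier_vec d" if w: "w \<in> W" for w
  proof (rule ccontr)
    assume no: "w \<notin> (\<lambda>v. J *\<^sub>v v) ` carrier_vec d"
    have wc: "w \<in> carrier_vec n" using w W by auto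
    have Kw: "K *\<^sub>v w \<in> carrier_vec d" using K wc by auto
    \<comment> \<open>The component of \<open>w\<close> in the kernel of \<open>K\<close> serves as an additional column of \<open>J\<close>, and a row of
      \<open>1 - J K\<close>, suitably scaled, as an additional row of \<open>K\<close>.\<close>
    define w' where "w' = w - J *\<^sub>v (K *\<^sub>v w)"
    have w'c: "w' \<in> carrier_vec n" using wc J Kw by (auto simp: w'_def)
    have "w' = w + (-1) \<cdot>\<^sub>v (J *\<^sub>v (K *\<^sub>v w))" using wc J Kw unfolding w'_def by (intro eq_vecI) auto
    then have w'W: "w' \<in> W" using W(3)[OF w W(4)[OF im[OF Kw]]] by simp
    have "w' \<noteq> 0\<^sub>v n"
    proof
      assume "w' = 0\<^sub>v n"
      have "w = J *\<^sub>v (K *\<^sub>v w)"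
      proof (rule eq_vecI)
        fix i assume "i < dim_vec (J *\<^sub>v (K *\<^sub>v w))"
        then have i: "i < n" using J by simp
        have "w' $ i = 0" using \<open>w' = 0\<^sub>v n\<close> i by simp
        then show "w $ i = (J *\<^sub>v (K *\<^sub>v w)) $ i" using i wc J unfolding w'_def by simp
      qed (use wc J in auto)
      then show False using no Kw by blast
    qed
    then obtain a where a: "a < n" "w' $ a \<noteq> 0"
      using w'c by (metis carrier_vecD eq_vecI index_zero_vec(1) index_zero_vec(2))
    have Kw': "K *\<^sub>v w' = 0\<^sub>v d"
    proof -
      have "K *\<^sub>v w' = K *\<^sub>v w - K *\<^sub>v (J *\<^sub>v (K *\<^sub>v w))"
        unfolding w'_def using K J wc Kw by (intro mult_minus_distrib_mat_vec[of _ d n]) auto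
      also have "K *\<^sub>v (J *\<^sub>v (K *\<^sub>v w)) = (K * J) *\<^sub>v (K *\<^sub>v w)"
        using K J Kw by (intro assoc_mult_mat_vec[symmetric]) auto
      finally show ?thesis using KJ Kw by simp
    qed
    define D where "D = 1\<^sub>m n - J * K"
    have Dc: "D \<in> carrier_mat n n" using J K by (auto simp: D_def)
    have DJ: "D * J = 0\<^sub>m n d"
    proof -
      have "D * J = 1\<^sub>m n * J - (J * K) * J"
        unfolding D_def using J K by (intro minus_mult_distrib_mat) auto
      also have "(J * K) * J = J * (K * J)" using J K by (intro assoc_mult_mat) auto
      finally show ?thesis using KJ J by simp
    qed
    have Dw: "D *\<^sub>v w' = w'"
    proof -
      have "D *\<^sub>v w' = 1\<^sub>m n *\<^sub>v w' - (J * K) *\<^sub>v w'"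
        unfolding D_def using J K w'c by (intro minus_mult_distrib_mat_vec) auto
      also have "(J * K) *\<^sub>v w' = J *\<^sub>v (K *\<^sub>v w')" using J K w'c by (intro assoc_mult_mat_vec) auto
      also have "\<dots> = 0\<^sub>v n" unfolding Kw' using J by (intro eq_vecI) (auto simp: scalar_prod_def)
      finally show ?thesis using w'c by simp
    qed
    define J' where "J' = mat n (Suc d) (\<lambda>(i, j). if j < d then J $$ (i, j) else w' $ i)"
    define K' where "K' = mat (Suc d) n (\<lambda>(i, j). if i < d then K $$ (i, j) else D $$ (a, j) / w' $ a)"
    have e1: "(\<Sum>l<n. K $$ (i, l) * J $$ (l, j)) = (if i = j then 1 else 0)" if "i < d" "j < d" for i j
    proof -
      have "(K * J) $$ (i, j) = (\<Sum>l<n. K $$ (i, l) * J $$ (l, j))"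
        using that J K by (auto simp: scalar_prod_def atLeast0LessThan)
      then show ?thesis unfolding KJ using that by simp
    qed
    have e2: "(\<Sum>l<n. K $$ (i, l) * w' $ l) = 0" if "i < d" for i
    proof -
      have "(K *\<^sub>v w') $ i = (\<Sum>l<n. K $$ (i, l) * w' $ l)"
        using that w'c K by (auto simp: scalar_prod_def atLeast0LessThan)
      then show ?thesis unfolding Kw' using that by simp
    qed
    have e3: "(\<Sum>l<n. D $$ (a, l) / w' $ a * J $$ (l, j)) = 0" if "j < d" for j
    proof -
      have "(D * J) $$ (a, j) = (\<Sum>l<n. D $$ (a, l) * J $$ (l, j))"
        using that a J Dc by (auto simp: scalar_prod_def atLeast0LessThan)
      then have "(\<Sum>l<n. D $$ (a, l) * J $$ (l, j)) / w' $ a = 0" unfolding DJ using that a by simp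
      then show ?thesis unfolding sum_divide_distrib by simp
    qed
    have e4: "(\<Sum>l<n. D $$ (a, l) / w' $ a * w' $ l) = 1"
    proof -
      have "(D *\<^sub>v w') $ a = (\<Sum>l<n. D $$ (a, l) * w' $ l)"
        using a w'c Dc by (auto simp: scalar_prod_def atLeast0LessThan)
      then have "(\<Sum>l<n. D $$ (a, l) * w' $ l) / w' $ a = 1" unfolding Dw using a by simp
      then show ?thesis unfolding sum_divide_distrib by simp
    qed
    have "P (Suc d)" unfolding P_def
    proof (rule exI[of _ J'], rule exI[of _ K'], intro conjI ballI)
      show "J' \<in> carrier_mat n (Suc d)" "K' \<in> carrier_mat (Suc d) n" by (auto simp: J'_def K'_def)
      show "K' * J' = 1\<^sub>m (Suc d)"
      proof (rule eq_matI)
        fix i j assume ij: "i < dim_row (1\<^sub>m (Suc d) :: complex mat)" "j < dim_col (1\<^sub>m (Suc d) :: complex mat)"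
        have "(K' * J') $$ (i, j) = (\<Sum>l<n. K' $$ (i, l) * J' $$ (l, j))"
          using ij by (auto simp: scalar_prod_def atLeast0LessThan J'_def K'_def)
        also have "\<dots> = (\<Sum>l<n. (if i < d then K $$ (i, l) else D $$ (a, l) / w' $ a) * (if j < d then J $$ (l, j) else w' $ l))"
          using ij by (intro sum.cong) (auto simp: J'_def K'_def)
        also have "\<dots> = (if i = j then 1 else 0)"
          using ij e1[of i j] e2[of i] e3[of j] e4 by (cases "i < d"; cases "j < d") auto
        finally show "(K' * J') $$ (i, j) = 1\<^sub>m (Suc d) $$ (i, j)" using ij by simp
      qed (auto simp: J'_def K'_def)
      fix v :: "complex vec" assume v: "v \<in> carrier_vec (Suc d)"
      define v1 where "v1 = vec d (\<lambda>i. v $ i)"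
      have "J' *\<^sub>v v = J *\<^sub>v v1 + v $ d \<cdot>\<^sub>v w'"
      proof (rule eq_vecI)
        fix i assume "i < dim_vec (J *\<^sub>v v1 + v $ d \<cdot>\<^sub>v w')"
        then have i: "i < n" using w'c by simp
        have "(J' *\<^sub>v v) $ i = (\<Sum>l<Suc d. J' $$ (i, l) * v $ l)"
          using i v by (auto simp: scalar_prod_def atLeast0LessThan J'_def)
        also have "\<dots> = (\<Sum>l<d. J $$ (i, l) * v $ l) + w' $ i * v $ d"
          using i by (simp add: J'_def)
        also have "\<dots> = (J *\<^sub>v v1 + v $ d \<cdot>\<^sub>v w') $ i"
          using i J w'c by (auto simp: scalar_prod_def atLeast0LessThan v1_def)
        finally show "(J' *\<^sub>v v) $ i = (J *\<^sub>v v1 + v $ d \<cdot>\<^sub>v w') $ i" .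
      qed (use w'c in \<open>auto simp: J'_def\<close>)
      moreover have "v1 \<in> carrier_vec d" by (simp add: v1_def)
      ultimately show "J' *\<^sub>v v \<in> W" using W(3)[OF im W(4)[OF w'W]] by simp
    qed
    then show False using max[of "Suc d"] by simp
  qed
  then have "W = (\<lambda>v. J *\<^sub>v v) ` carrier_vec d" using im by blast
  then show thesis using that J K KJ by blast
qed

lemma is_repI:
  assumes "group G" "d > 0" "\<And>g. g \<in> carrier G \<Longrightarrow> \<psi> g \<in> carrier_mat d d"
    "\<And>g h. g \<in> carrier G \<Longrightarrow> h \<in> carrier G \<Longrightarrow> \<psi> (g \<otimes>\<^bsub>G\<^esub> h) = \<psi> g * \<psi> h" "\<psi> \<one>\<^bsub>G\<^esub> = 1\<^sub>m d"
  shows "is_rep G d \<psi>"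
proof -
  interpret group G by fact
  have "\<psi> g \<in> Units (ring_mat TYPE(complex) d ())" if g: "g \<in> carrier G" for g
  proof -
    have "\<psi> g * \<psi> (inv\<^bsub>G\<^esub> g) = 1\<^sub>m d" "\<psi> (inv\<^bsub>G\<^esub> g) * \<psi> g = 1\<^sub>m d"
      using assms(4)[of g "inv\<^bsub>G\<^esub> g"] assms(4)[of "inv\<^bsub>G\<^esub> g" g] assms(5) g by auto
    then show ?thesis using assms(3)[OF g] assms(3)[of "inv\<^bsub>G\<^esub> g"] g
      unfolding Units_def ring_mat_def by auto
  qed
  then show ?thesis
    using assms(2,4) unfolding is_rep_def hom_def units_of_def by (auto simp: ring_mat_def)
qed

context fin_rep
begin

text \<open>If the image of \<open>J\<close> is invariant, the representation on it has the matrices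
  \<open>K * (\<rho> g * J)\<close> with respect to the columns of \<open>J\<close>.\<close>

lemma compress_rep:
  assumes J: "J \<in> carrier_mat n d" and K: "K \<in> carrier_mat d n" and KJ: "K * J = 1\<^sub>m d" and d: "d > 0"
    and im: "\<And>g. g \<in> carrier G \<Longrightarrow> J * (K * (\<rho> g * J)) = \<rho> g * J"
  shows "is_rep G d (\<lambda>g. K * (\<rho> g * J))"
proof (rule is_repI[OF is_group d])
  show "K * (\<rho> g * J) \<in> carrier_mat d d" if "g \<in> carrier G" for g
    using that J K by (meson mult_carrier_mat rho_carrier)
  show "K * (\<rho> (g \<otimes> h) * J) = K * (\<rho> g * J) * (K * (\<rho> h * J))" if g: "g \<in> carrier G" and h: "h \<in> carrier G" for g h
  proof -
    have c: "\<rho> g * J \<in> carrier_mat n d" "\<rho> h * J \<in> carrier_mat n d" "K * (\<rho> h * J) \<in> carrier_mat d d"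
      using g h J K by auto
    have "K * (\<rho> g * J) * (K * (\<rho> h * J)) = K * ((\<rho> g * J) * (K * (\<rho> h * J)))"
      using c K by (intro assoc_mult_mat) auto
    also have "(\<rho> g * J) * (K * (\<rho> h * J)) = \<rho> g * (J * (K * (\<rho> h * J)))"
      by (rule assoc_mult_mat[OF rho_carrier[OF g] J c(3)])
    also have "\<dots> = \<rho> g * (\<rho> h * J)" using im[OF h] by simp
    also have "\<dots> = \<rho> (g \<otimes> h) * J"
      unfolding rho_mult[OF g h] using g h J by (intro assoc_mult_mat[symmetric]) auto
    finally show ?thesis ..
  qed
  show "K * (\<rho> \<one> * J) = 1\<^sub>m d" using J KJ by simp
qed

text \<open>An invariant subspace of least positive dimension, given by the columns of an intertwining
  matrix \<open>J\<close>, carries an irreducible representation.\<close>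

lemma irreducible_constituent:
  obtains d \<psi> J where "irreducible_rep G d \<psi>" "J \<in> carrier_mat n d" "J \<noteq> 0\<^sub>m n d"
    "\<And>g. g \<in> carrier G \<Longrightarrow> \<rho> g * J = J * \<psi> g"
proof -
  define P where "P d \<longleftrightarrow> (\<exists>J K \<psi>. J \<in> carrier_mat n d \<and> K \<in> carrier_mat d n \<and> K * J = 1\<^sub>m d
    \<and> is_rep G d \<psi> \<and> (\<forall>g\<in>carrier G. \<rho> g * J = J * \<psi> g))" for d
  have "P n" unfolding P_def
    by (intro exI[of _ "1\<^sub>m n"] exI[of _ \<rho>]) (use rep in auto)
  define d where "d = (LEAST d. P d)"
  have "P d" unfolding d_def using \<open>P n\<close> by (rule LeastI)
  have min: "d \<le> d'" if "P d'" for d' unfolding d_def using that by (rule Least_le)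
  from \<open>P d\<close> obtain J K \<psi> where J: "J \<in> carrier_mat n d" and K: "K \<in> carrier_mat d n" and KJ: "K * J = 1\<^sub>m d"
    and psi: "is_rep G d \<psi>" and int: "\<And>g. g \<in> carrier G \<Longrightarrow> \<rho> g * J = J * \<psi> g" unfolding P_def by blast
  interpret psi: fin_rep G d \<psi> by unfold_locales (simp_all add: psi)
  have "irreducible_rep G d \<psi>" unfolding irreducible_rep_def
  proof (intro conjI psi allI impI)
    fix W assume asm: "VectorSpace.subspace class_ring W (module_vec TYPE(complex) d) \<and> (\<forall>g\<in>carrier G. \<forall>w\<in>W. \<psi> g *\<^sub>v w \<in> W)"
    note Ws = subspace_vecD[OF conjunct1[OF asm]]
    have inv: "\<psi> g *\<^sub>v w \<in> W" if "g \<in> carrier G" "w \<in> W" for g w using asm that by blast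
    obtain d' J' K' where J': "J' \<in> carrier_mat d d'" and K': "K' \<in> carrier_mat d' d" and KJ': "K' * J' = 1\<^sub>m d'"
      and W: "W = (\<lambda>v. J' *\<^sub>v v) ` carrier_vec d'"
      by (rule subspace_basis_matrix[OF Ws])
    show "W = {0\<^sub>v d} \<or> W = carrier_vec d"
    proof (cases "d' = 0")
      case True
      have "J' *\<^sub>v v = 0\<^sub>v d" if "v \<in> carrier_vec 0" for v
        using J' that True by (intro eq_vecI) (auto simp: scalar_prod_def)
      then have "W \<subseteq> {0\<^sub>v d}" unfolding W True by auto
      then show ?thesis using Ws(2) by auto
    next
      case False
      have im: "J' * (K' * (\<psi> g * J')) = \<psi> g * J'" if g: "g \<in> carrier G" for g
      proof (rule mat_eqI_mult_vec[of _ d d'])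
        fix v :: "complex vec" assume v: "v \<in> carrier_vec d'"
        have c: "\<psi> g * J' \<in> carrier_mat d d'" "K' * (\<psi> g * J') \<in> carrier_mat d' d'" using g J' K' by auto
        have "(\<psi> g * J') *\<^sub>v v = \<psi> g *\<^sub>v (J' *\<^sub>v v)" using g J' v by (intro assoc_mult_mat_vec) auto
        also have "\<dots> \<in> W" using inv[OF g] W v by blast
        finally obtain v' where v': "v' \<in> carrier_vec d'" "(\<psi> g * J') *\<^sub>v v = J' *\<^sub>v v'" unfolding W by blast
        have "J' * (K' * (\<psi> g * J')) *\<^sub>v v = J' *\<^sub>v ((K' * (\<psi> g * J')) *\<^sub>v v)"
          using J' c v by (intro assoc_mult_mat_vec) auto
        also have "(K' * (\<psi> g * J')) *\<^sub>v v = K' *\<^sub>v ((\<psi> g * J') *\<^sub>v v)"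
          using K' c v by (intro assoc_mult_mat_vec) auto
        also have "\<dots> = (K' * J') *\<^sub>v v'"
          unfolding v'(2) using K' J' v' by (intro assoc_mult_mat_vec[symmetric]) auto
        finally show "J' * (K' * (\<psi> g * J')) *\<^sub>v v = (\<psi> g * J') *\<^sub>v v" unfolding KJ' v'(2) using v' by simp
      qed (use g J' K' in auto)
      have rep': "is_rep G d' (\<lambda>g. K' * (\<psi> g * J'))"
        using psi.compress_rep[OF J' K' KJ' _ im] False by simp
      have JJ: "J * J' \<in> carrier_mat n d'" "K' * K \<in> carrier_mat d' n" using J J' K K' by auto
      have "(K' * K) * (J * J') = K' * (K * (J * J'))" using J J' K K' by (intro assoc_mult_mat) auto
      also have "K * (J * J') = (K * J) * J'" using J J' K K' by (intro assoc_mult_mat[symmetric]) auto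
      finally have one: "(K' * K) * (J * J') = 1\<^sub>m d'" unfolding KJ using J' KJ' by simp
      have "\<rho> g * (J * J') = (J * J') * (K' * (\<psi> g * J'))" if g: "g \<in> carrier G" for g
      proof -
        have c: "\<psi> g * J' \<in> carrier_mat d d'" "K' * (\<psi> g * J') \<in> carrier_mat d' d'" using g J' K' by auto
        have "\<rho> g * (J * J') = (\<rho> g * J) * J'" using g J J' by (intro assoc_mult_mat[symmetric]) auto
        also have "\<dots> = J * (\<psi> g * J')" unfolding int[OF g] using g J J' by (intro assoc_mult_mat) auto
        also have "\<dots> = J * (J' * (K' * (\<psi> g * J')))" using im[OF g] by simp
        also have "\<dots> = (J * J') * (K' * (\<psi> g * J'))" using c J J' by (intro assoc_mult_mat[symmetric]) auto
        finally show ?thesis .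
      qed
      then have "P d'" unfolding P_def using JJ one rep' by blast
      then have dd: "d' = d" using min[of d'] left_inverse_dims_le[OF J' K' KJ'] by simp
      have "J' * K' = 1\<^sub>m d"
        using mat_mult_left_right_inverse[of K' d J'] J' K' KJ' unfolding dd by simp
      have "v \<in> W" if v: "v \<in> carrier_vec d" for v
      proof -
        have "v = (J' * K') *\<^sub>v v" using \<open>J' * K' = 1\<^sub>m d\<close> v by simp
        also have "\<dots> = J' *\<^sub>v (K' *\<^sub>v v)" using J' K' v by (intro assoc_mult_mat_vec) auto
        finally show ?thesis unfolding W using K' v by auto
      qed
      then show ?thesis using Ws(1) by auto
    qed
  qed
  moreover have "J \<noteq> 0\<^sub>m n d"
  proof
    assume "J = 0\<^sub>m n d"
    then have "(1\<^sub>m d :: complex mat) = 0\<^sub>m d d" using KJ K by simp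
    then have "(1\<^sub>m d :: complex mat) $$ (0, 0) = 0\<^sub>m d d $$ (0, 0)" by simp
    then show False using psi.n_pos by simp
  qed
  ultimately show thesis using that J int by blast
qed

end

section \<open>Central idempotents and Clifford theory\<close>

context fin_rep
begin

text \<open>The action of the element of the group algebra with coefficients \<open>f\<close>.\<close>

definition alg :: "('a \<Rightarrow> complex) \<Rightarrow> complex mat" where
  "alg f = msum n n (\<lambda>x. f x \<cdot>\<^sub>m \<rho> x) (carrier G)"

lemma alg_carrier [simp, intro]: "alg f \<in> carrier_mat n n"
  by (simp add: alg_def)

lemma alg_dim [simp]: "dim_row (alg f) = n" "dim_col (alg f) = n"
  by (simp_all add: alg_def)

lemma alg_index: "i < n \<Longrightarrow> j < n \<Longrightarrow> alg f $$ (i, j) = (\<Sum>x\<in>carrier G. f x * \<rho> x $$ (i, j))"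
  by (simp add: alg_def)

lemma alg_cong: "(\<And>x. x \<in> carrier G \<Longrightarrow> f x = h x) \<Longrightarrow> alg f = alg h"
  unfolding alg_def by (intro msum_cong) auto

lemma alg_smult: "c \<cdot>\<^sub>m alg f = alg (\<lambda>x. c * f x)"
  unfolding alg_def by (subst msum_smult) (auto intro!: msum_cong)

lemma trace_alg: "mat_trace (alg f) = (\<Sum>x\<in>carrier G. f x * \<chi> x)"
  unfolding alg_def by (subst mat_trace_msum) (auto simp: mat_trace_smult[of _ n] intro!: sum.cong)

lemma alg_mult_left:
  assumes "A \<in> carrier_mat m n"
  shows "A * alg f = msum m n (\<lambda>x. f x \<cdot>\<^sub>m (A * \<rho> x)) (carrier G)"
  unfolding alg_def using assms
  by (subst msum_mult_left[OF assms]) (auto intro!: msum_cong simp: smult_mult_mat[of _ m n _ n])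

lemma alg_mult_right:
  assumes "A \<in> carrier_mat n m"
  shows "alg f * A = msum n m (\<lambda>x. f x \<cdot>\<^sub>m (\<rho> x * A)) (carrier G)"
  unfolding alg_def using assms
  by (subst msum_mult_right[OF assms]) (auto intro!: msum_cong simp: smult_mult_mat[of _ n n _ m])

lemma alg_commute:
  assumes "A \<in> carrier_mat n n" "\<And>x. x \<in> carrier G \<Longrightarrow> A * \<rho> x = \<rho> x * A"
  shows "A * alg f = alg f * A"
  unfolding alg_mult_left[OF assms(1)] alg_mult_right[OF assms(1)] using assms(2)
  by (intro msum_cong) auto

lemma alg_mult: "alg f * alg h = alg (\<lambda>z. \<Sum>x\<in>carrier G. f x * h (inv x \<otimes> z))"
proof -
  have "\<rho> x * alg h = msum n n (\<lambda>z. h (inv x \<otimes> z) \<cdot>\<^sub>m \<rho> z) (carrier G)" if x: "x \<in> carrier G" for x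
  proof -
    have "msum n n (\<lambda>z. h (inv x \<otimes> z) \<cdot>\<^sub>m \<rho> z) (carrier G)
        = msum n n (\<lambda>y. h (inv x \<otimes> (x \<otimes> y)) \<cdot>\<^sub>m \<rho> (x \<otimes> y)) (carrier G)"
      by (rule msum_reindex_bij[OF bij_mult_left[OF x]])
    also have "\<dots> = msum n n (\<lambda>y. h y \<cdot>\<^sub>m (\<rho> x * \<rho> y)) (carrier G)"
      using x by (intro msum_cong) (auto simp: m_assoc[symmetric] rho_mult)
    also have "\<dots> = \<rho> x * alg h" using x by (intro alg_mult_left[symmetric]) auto
    finally show ?thesis ..
  qed
  then have "alg f * alg h = msum n n (\<lambda>x. f x \<cdot>\<^sub>m msum n n (\<lambda>z. h (inv x \<otimes> z) \<cdot>\<^sub>m \<rho> z) (carrier G)) (carrier G)"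
    by (subst alg_mult_right) (auto intro!: msum_cong)
  also have "\<dots> = alg (\<lambda>z. \<Sum>x\<in>carrier G. f x * h (inv x \<otimes> z))"
  proof (rule eq_matI)
    fix i j assume "i < dim_row (alg (\<lambda>z. \<Sum>x\<in>carrier G. f x * h (inv x \<otimes> z)))"
      "j < dim_col (alg (\<lambda>z. \<Sum>x\<in>carrier G. f x * h (inv x \<otimes> z)))"
    then have ij: "i < n" "j < n" by simp_all
    have "msum n n (\<lambda>x. f x \<cdot>\<^sub>m msum n n (\<lambda>z. h (inv x \<otimes> z) \<cdot>\<^sub>m \<rho> z) (carrier G)) (carrier G) $$ (i, j)
        = (\<Sum>x\<in>carrier G. \<Sum>z\<in>carrier G. f x * h (inv x \<otimes> z) * \<rho> z $$ (i, j))"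
      using ij by (simp add: sum_distrib_left mult.assoc)
    also have "\<dots> = (\<Sum>z\<in>carrier G. (\<Sum>x\<in>carrier G. f x * h (inv x \<otimes> z)) * \<rho> z $$ (i, j))"
      by (subst sum.swap) (simp add: sum_distrib_right)
    finally show "msum n n (\<lambda>x. f x \<cdot>\<^sub>m msum n n (\<lambda>z. h (inv x \<otimes> z) \<cdot>\<^sub>m \<rho> z) (carrier G)) (carrier G) $$ (i, j)
        = alg (\<lambda>z. \<Sum>x\<in>carrier G. f x * h (inv x \<otimes> z)) $$ (i, j)"
      using ij by (simp add: alg_index)
  qed auto
  finally show ?thesis .
qed

end

text \<open>A representation \<open>\<rho>\<close> together with an irreducible representation \<open>\<psi>\<close> of the same group. The
  matrix \<open>e_psi\<close> is the projection onto the isotypic component of \<open>\<rho>\<close> that belongs to \<open>\<psi>\<close>.\<close>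

locale rep_with_irr = fin_rep G n \<rho> + psi: irr_rep G d \<psi>
  for G (structure) and n \<rho> d \<psi>
begin

abbreviation e_psi :: "complex mat" where "e_psi \<equiv> alg psi.e_coeff"

lemma e_psi_idem: "e_psi * e_psi = e_psi"
  unfolding alg_mult by (intro alg_cong psi.e_coeff_convolution)

lemma e_psi_commute:
  assumes g: "g \<in> carrier G"
  shows "e_psi * \<rho> g = \<rho> g * e_psi"
proof -
  have "\<rho> g * e_psi = msum n n (\<lambda>x. psi.e_coeff x \<cdot>\<^sub>m \<rho> (g \<otimes> x)) (carrier G)"
    using g by (subst alg_mult_left) (auto intro!: msum_cong simp: rho_mult)
  also have "\<dots> = msum n n (\<lambda>x. psi.e_coeff (inv g \<otimes> (x \<otimes> g)) \<cdot>\<^sub>m \<rho> (g \<otimes> (inv g \<otimes> (x \<otimes> g)))) (carrier G)"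
    using g bij_betw_trans[OF bij_mult_right[OF g] bij_mult_left[of "inv g"]]
    by (intro msum_reindex_bij) (auto simp: comp_def)
  also have "\<dots> = msum n n (\<lambda>x. psi.e_coeff x \<cdot>\<^sub>m (\<rho> x * \<rho> g)) (carrier G)"
  proof (rule msum_cong[OF refl])
    fix x assume x: "x \<in> carrier G"
    have "inv (inv g \<otimes> (x \<otimes> g)) = inv g \<otimes> inv x \<otimes> inv (inv g)"
      using x g by (simp add: inv_mult_group m_assoc)
    then have "psi.e_coeff (inv g \<otimes> (x \<otimes> g)) = psi.e_coeff x"
      unfolding psi.e_coeff_def using psi.chi_conj[of "inv x" "inv g"] x g by simp
    moreover have "g \<otimes> (inv g \<otimes> (x \<otimes> g)) = x \<otimes> g" using x g by (simp add: m_assoc[symmetric])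
    ultimately show "psi.e_coeff (inv g \<otimes> (x \<otimes> g)) \<cdot>\<^sub>m \<rho> (g \<otimes> (inv g \<otimes> (x \<otimes> g))) = psi.e_coeff x \<cdot>\<^sub>m (\<rho> x * \<rho> g)"
      using x g by (simp add: rho_mult)
  qed
  also have "\<dots> = e_psi * \<rho> g" using g by (intro alg_mult_right[symmetric]) auto
  finally show ?thesis ..
qed

lemma psi_alg_e_coeff: "psi.alg psi.e_coeff = 1\<^sub>m d"
proof -
  interpret self: rep_with_irr G d \<psi> d \<psi> by unfold_locales
  have "psi.alg psi.e_coeff = (mat_trace (psi.alg psi.e_coeff) / of_nat d) \<cdot>\<^sub>m 1\<^sub>m d"
    by (intro psi.schur_trace self.e_psi_commute) auto
  also have "mat_trace (psi.alg psi.e_coeff) = of_nat d / of_nat N * (\<Sum>x\<in>carrier G. psi.\<chi> (inv x) * psi.\<chi> (x \<otimes> \<one>))"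
    unfolding psi.trace_alg psi.e_coeff_def sum_distrib_left by (intro sum.cong) auto
  also have "\<dots> = of_nat d" using psi.n_pos N_pos by (subst psi.chi_convolution) auto
  finally have "psi.alg psi.e_coeff = 1 \<cdot>\<^sub>m 1\<^sub>m d" using psi.n_pos by simp
  also have "\<dots> = 1\<^sub>m d" by (rule eq_matI) auto
  finally show ?thesis .
qed

text \<open>An intertwining matrix \<open>J\<close> is fixed by \<open>e_psi\<close>, which acts as the identity on \<open>\<psi>\<close>.\<close>

lemma e_psi_nonzero:
  assumes J: "J \<in> carrier_mat n d" "J \<noteq> 0\<^sub>m n d" and int: "\<And>g. g \<in> carrier G \<Longrightarrow> \<rho> g * J = J * \<psi> g"
  shows "e_psi \<noteq> 0\<^sub>m n n"
proof
  assume 0: "e_psi = 0\<^sub>m n n"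
  have "e_psi * J = msum n d (\<lambda>x. psi.e_coeff x \<cdot>\<^sub>m (J * \<psi> x)) (carrier G)"
    using int by (subst alg_mult_right[OF J(1)]) (auto intro!: msum_cong)
  also have "\<dots> = J * psi.alg psi.e_coeff" by (rule psi.alg_mult_left[OF J(1), symmetric])
  finally have "e_psi * J = J" using psi_alg_e_coeff J by simp
  then show False using 0 J by simp
qed

lemma e_psi_conj_sum:
  assumes y: "y \<in> carrier G"
  shows "e_psi * conj_sum (\<rho> y) = (of_nat N / of_nat d * psi.\<chi> y) \<cdot>\<^sub>m e_psi"
proof -
  have "e_psi * (\<rho> (inv u) * \<rho> y * \<rho> u) = alg (\<lambda>z. psi.e_coeff (z \<otimes> (inv u \<otimes> inv y \<otimes> u)))"
    if u: "u \<in> carrier G" for u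
  proof -
    define t where "t = inv u \<otimes> y \<otimes> u"
    have t: "t \<in> carrier G" "inv t = inv u \<otimes> inv y \<otimes> u"
      using u y by (auto simp: t_def inv_mult_group m_assoc)
    have "e_psi * \<rho> t = msum n n (\<lambda>x. psi.e_coeff x \<cdot>\<^sub>m \<rho> (x \<otimes> t)) (carrier G)"
      using t by (subst alg_mult_right) (auto intro!: msum_cong simp: rho_mult)
    also have "\<dots> = msum n n (\<lambda>z. psi.e_coeff (z \<otimes> inv t) \<cdot>\<^sub>m \<rho> (z \<otimes> inv t \<otimes> t)) (carrier G)"
      using t(1) by (intro msum_reindex_bij bij_mult_right) auto
    also have "\<dots> = alg (\<lambda>z. psi.e_coeff (z \<otimes> inv t))"
      unfolding alg_def using t(1) by (intro msum_cong) (auto simp: m_assoc)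
    also have "\<rho> t = \<rho> (inv u) * \<rho> y * \<rho> u" unfolding t_def using u y by (simp add: rho_mult)
    finally show ?thesis unfolding t(2) .
  qed
  then have "e_psi * conj_sum (\<rho> y) = msum n n (\<lambda>u. alg (\<lambda>z. psi.e_coeff (z \<otimes> (inv u \<otimes> inv y \<otimes> u)))) (carrier G)"
    unfolding conj_sum_def using y by (subst msum_mult_left) (auto intro!: msum_cong sq_mult)
  also have "\<dots> = alg (\<lambda>z. \<Sum>u\<in>carrier G. psi.e_coeff (z \<otimes> (inv u \<otimes> inv y \<otimes> u)))"
    by (rule eq_matI) (auto simp: alg_index sum_distrib_right intro: sum.swap)
  also have "\<dots> = alg (\<lambda>z. of_nat N / of_nat d * psi.\<chi> y * psi.e_coeff z)"
  proof (rule alg_cong)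
    fix z assume z: "z \<in> carrier G"
    have "psi.e_coeff (z \<otimes> (inv u \<otimes> inv y \<otimes> u)) = of_nat d / of_nat N * psi.\<chi> (inv u \<otimes> y \<otimes> u \<otimes> inv z)"
      if u: "u \<in> carrier G" for u
      unfolding psi.e_coeff_def using u y z by (simp add: inv_mult_group m_assoc)
    then have "(\<Sum>u\<in>carrier G. psi.e_coeff (z \<otimes> (inv u \<otimes> inv y \<otimes> u)))
        = of_nat d / of_nat N * (\<Sum>u\<in>carrier G. psi.\<chi> (inv u \<otimes> y \<otimes> u \<otimes> inv z))"
      by (simp add: sum_distrib_left)
    also have "\<dots> = of_nat N / of_nat d * psi.\<chi> y * psi.e_coeff z"
      using psi.chi_conj_sum[OF y, of "inv z"] z by (simp add: psi.e_coeff_def)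
    finally show "(\<Sum>u\<in>carrier G. psi.e_coeff (z \<otimes> (inv u \<otimes> inv y \<otimes> u)))
      = of_nat N / of_nat d * psi.\<chi> y * psi.e_coeff z" .
  qed
  finally show ?thesis unfolding alg_smult by simp
qed

text \<open>The idempotent \<open>e_psi\<close> is primitive in the centre of the image of the group algebra: a central
  element \<open>alg f\<close> is the average of its conjugates, and on the conjugate sums \<open>e_psi\<close> acts by scalars.\<close>

lemma e_psi_primitive:
  assumes comm: "\<And>g. g \<in> carrier G \<Longrightarrow> alg f * \<rho> g = \<rho> g * alg f"
  shows "\<exists>c. e_psi * alg f = c \<cdot>\<^sub>m e_psi"
proof -
  let ?c = "of_nat N / of_nat d :: complex"
  have "conj_sum (alg f) = msum n n (\<lambda>u. alg f) (carrier G)"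
    unfolding conj_sum_def
  proof (rule msum_cong[OF refl])
    fix u assume u: "u \<in> carrier G"
    have "\<rho> (inv u) * alg f * \<rho> u = alg f * (\<rho> (inv u) * \<rho> u)"
      using comm[of "inv u", symmetric] u by (simp add: sq_assoc[of _ n])
    then show "\<rho> (inv u) * alg f * \<rho> u = alg f" using rho_inv[OF u] alg_carrier by simp
  qed
  also have "\<dots> = of_nat N \<cdot>\<^sub>m alg f"
    by (rule eq_matI) auto
  finally have 1: "conj_sum (alg f) = of_nat N \<cdot>\<^sub>m alg f" .
  have "conj_sum (alg f) = msum n n (\<lambda>u. msum n n (\<lambda>x. f x \<cdot>\<^sub>m (\<rho> (inv u) * \<rho> x * \<rho> u)) (carrier G)) (carrier G)"
    unfolding conj_sum_def
  proof (rule msum_cong[OF refl])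
    fix u assume u: "u \<in> carrier G"
    have "\<rho> (inv u) * alg f * \<rho> u = msum n n (\<lambda>x. (f x \<cdot>\<^sub>m (\<rho> (inv u) * \<rho> x)) * \<rho> u) (carrier G)"
      using u by (simp add: alg_mult_left[of _ n] msum_mult_right[of _ n n _ _ n] sq_mult[of _ n])
    also have "\<dots> = msum n n (\<lambda>x. f x \<cdot>\<^sub>m (\<rho> (inv u) * \<rho> x * \<rho> u)) (carrier G)"
      using u by (intro msum_cong refl smult_mult_mat[of _ n n _ n]) (auto intro: sq_mult)
    finally show "\<rho> (inv u) * alg f * \<rho> u = msum n n (\<lambda>x. f x \<cdot>\<^sub>m (\<rho> (inv u) * \<rho> x * \<rho> u)) (carrier G)" .
  qed
  also have "\<dots> = msum n n (\<lambda>x. msum n n (\<lambda>u. f x \<cdot>\<^sub>m (\<rho> (inv u) * \<rho> x * \<rho> u)) (carrier G)) (carrier G)"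
    by (rule msum_swap)
  also have "\<dots> = msum n n (\<lambda>x. f x \<cdot>\<^sub>m conj_sum (\<rho> x)) (carrier G)"
    unfolding conj_sum_def by (intro msum_cong refl msum_smult[symmetric]) (auto intro: sq_mult)
  finally have "e_psi * conj_sum (alg f) = msum n n (\<lambda>x. e_psi * (f x \<cdot>\<^sub>m conj_sum (\<rho> x))) (carrier G)"
    by (simp add: msum_mult_left[OF alg_carrier])
  also have "\<dots> = msum n n (\<lambda>x. (f x * (?c * psi.\<chi> x)) \<cdot>\<^sub>m e_psi) (carrier G)"
    by (intro msum_cong refl) (simp add: smult_mult_mat(2)[OF alg_carrier conj_sum_carrier] e_psi_conj_sum smult_smult_mat)
  also have "\<dots> = (\<Sum>x\<in>carrier G. f x * (?c * psi.\<chi> x)) \<cdot>\<^sub>m e_psi" by (rule msum_smult_const) simp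
  finally have 2: "e_psi * conj_sum (alg f) = (\<Sum>x\<in>carrier G. f x * (?c * psi.\<chi> x)) \<cdot>\<^sub>m e_psi" .
  have "of_nat N \<cdot>\<^sub>m (e_psi * alg f) = (\<Sum>x\<in>carrier G. f x * (?c * psi.\<chi> x)) \<cdot>\<^sub>m e_psi"
    using 1 2 by (simp add: smult_mult_mat(2)[OF alg_carrier alg_carrier])
  then have "(1 / of_nat N) \<cdot>\<^sub>m (of_nat N \<cdot>\<^sub>m (e_psi * alg f)) = (1 / of_nat N) \<cdot>\<^sub>m ((\<Sum>x\<in>carrier G. f x * (?c * psi.\<chi> x)) \<cdot>\<^sub>m e_psi)"
    by simp
  then have "e_psi * alg f = ((1 / of_nat N) * (\<Sum>x\<in>carrier G. f x * (?c * psi.\<chi> x))) \<cdot>\<^sub>m e_psi"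
    unfolding smult_smult_mat using N_nonzero by (simp del: of_nat_eq_0_iff card_eq_0_iff)
  then show ?thesis by blast
qed

lemma homogeneous_chi:
  assumes one: "e_psi = 1\<^sub>m n" and y: "y \<in> carrier G"
  shows "\<chi> y = of_nat n / of_nat d * psi.\<chi> y"
proof -
  have "conj_sum (\<rho> y) = (of_nat N / of_nat d * psi.\<chi> y) \<cdot>\<^sub>m 1\<^sub>m n"
    using e_psi_conj_sum[OF y] unfolding one by (metis conj_sum_carrier left_mult_one_mat)
  then have "of_nat N * \<chi> y = of_nat N / of_nat d * psi.\<chi> y * of_nat n"
    using trace_conj_sum[OF rho_carrier[OF y]] by (simp add: mat_trace_smult[of _ n])
  then have "of_nat N * \<chi> y = of_nat N * (of_nat n / of_nat d * psi.\<chi> y)" by (simp add: mult_ac)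
  then show ?thesis unfolding mult_left_cancel[OF N_nonzero] .
qed

text \<open>If \<open>\<chi>\<close> is a rational multiple of an irreducible character, it is an integer multiple. The
  multiplicity is the trace of the idempotent that acts on each copy of \<open>\<psi>\<close> as the
  matrix unit with index \<open>(0, 0)\<close>.\<close>

lemma proportional_degree_dvd:
  assumes chi_psi: "\<And>y. y \<in> carrier G \<Longrightarrow> \<chi> y = of_nat n / of_nat d * psi.\<chi> y"
  shows "d dvd n"
proof -
  define f where "f x = of_nat d / of_nat N * \<psi> (inv x) $$ (0, 0)" for x
  have d0: "0 < d" by (rule psi.n_pos)
  have conv: "(\<Sum>x\<in>carrier G. f x * f (inv x \<otimes> z)) = f z" if z: "z \<in> carrier G" for z
  proof -
    have "f (inv x \<otimes> z) = of_nat d / of_nat N * (\<Sum>l<d. \<psi> (inv z) $$ (0, l) * \<psi> x $$ (l, 0))" if x: "x \<in> carrier G" for x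
    proof -
      have "\<psi> (inv (inv x \<otimes> z)) = \<psi> (inv z) * \<psi> x" using x z by (simp add: inv_mult_group psi.rho_mult)
      also have "\<dots> $$ (0, 0) = (\<Sum>l<d. \<psi> (inv z) $$ (0, l) * \<psi> x $$ (l, 0))"
        using x z d0 by (auto simp: scalar_prod_def atLeast0LessThan)
      finally show ?thesis unfolding f_def by simp
    qed
    then have "(\<Sum>x\<in>carrier G. f x * f (inv x \<otimes> z))
        = (\<Sum>x\<in>carrier G. \<Sum>l<d. (of_nat d / of_nat N)\<^sup>2 * \<psi> (inv z) $$ (0, l) * (\<psi> (inv x) $$ (0, 0) * \<psi> x $$ (l, 0)))"
      by (intro sum.cong refl) (simp add: f_def sum_distrib_left power2_eq_square mult_ac)
    also have "\<dots> = (\<Sum>l<d. (of_nat d / of_nat N)\<^sup>2 * \<psi> (inv z) $$ (0, l) * (\<Sum>x\<in>carrier G. \<psi> (inv x) $$ (0, 0) * \<psi> x $$ (l, 0)))"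
      by (subst sum.swap) (simp add: sum_distrib_left)
    also have "\<dots> = (\<Sum>l<d. (of_nat d / of_nat N)\<^sup>2 * \<psi> (inv z) $$ (0, l) * (if l = 0 then of_nat N / of_nat d else 0))"
      using d0 by (intro sum.cong refl arg_cong2[where f = "(*)"]) (auto simp: psi.coeff_orthogonality)
    also have "\<dots> = (\<Sum>l\<in>{0}. (of_nat d / of_nat N)\<^sup>2 * \<psi> (inv z) $$ (0, l) * (if l = 0 then of_nat N / of_nat d else 0))"
      using d0 by (intro sum.mono_neutral_right) auto
    also have "\<dots> = f z" using d0 N_pos by (simp add: f_def power2_eq_square)
    finally show ?thesis .
  qed
  have "alg f * alg f = alg f" unfolding alg_mult by (intro alg_cong conv)
  then obtain k where k: "mat_trace (alg f) = of_nat k" using idempotent_trace_nat[OF alg_carrier] by blast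
  have "mat_trace (alg f) = (\<Sum>x\<in>carrier G. \<Sum>i<d. of_nat n / of_nat N * (\<psi> (inv x) $$ (0, 0) * \<psi> x $$ (i, i)))"
    unfolding trace_alg
  proof (rule sum.cong[OF refl])
    fix x assume x: "x \<in> carrier G"
    have tr: "psi.\<chi> x = (\<Sum>i<d. \<psi> x $$ (i, i))" using x by (simp add: mat_trace_def)
    show "f x * \<chi> x = (\<Sum>i<d. of_nat n / of_nat N * (\<psi> (inv x) $$ (0, 0) * \<psi> x $$ (i, i)))"
      unfolding chi_psi[OF x] tr f_def sum_distrib_left[symmetric] using d0 by simp
  qed
  also have "\<dots> = (\<Sum>i<d. of_nat n / of_nat N * (\<Sum>x\<in>carrier G. \<psi> (inv x) $$ (0, 0) * \<psi> x $$ (i, i)))"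
    by (subst sum.swap) (simp add: sum_distrib_left)
  also have "\<dots> = (\<Sum>i<d. of_nat n / of_nat N * (if i = 0 then of_nat N / of_nat d else 0))"
    using d0 by (intro sum.cong refl arg_cong2[where f = "(*)"]) (auto simp: psi.coeff_orthogonality)
  also have "\<dots> = (\<Sum>i\<in>{0::nat}. of_nat n / of_nat N * (if i = 0 then of_nat N / of_nat d else 0))"
    using d0 by (intro sum.mono_neutral_right) auto
  also have "\<dots> = of_nat n / of_nat d" using N_nonzero by simp
  finally have "of_nat n = (of_nat (k * d) :: complex)" using k d0 by (simp add: field_simps)
  then have "n = k * d" by (rule of_nat_eq_iff[THEN iffD1])
  then show ?thesis by simp
qed

end

context fin_rep
begin

lemma restrict_fin_rep:
  assumes H: "subgroup H G"
  shows "fin_rep (G\<lparr>carrier := H\<rparr>) n \<rho>"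
proof -
  have g: "group (G\<lparr>carrier := H\<rparr>)" by (rule subgroup.subgroup_is_group[OF H is_group])
  have sub: "H \<subseteq> carrier G" by (rule subgroup.subset[OF H])
  have "is_rep (G\<lparr>carrier := H\<rparr>) n \<rho>"
    by (rule is_repI[OF g n_pos]) (use sub in \<open>auto intro: rho_mult\<close>)
  then show ?thesis
    using g sub finite_subset[OF sub fin] by (simp add: fin_rep_def fin_rep_axioms_def)
qed

text \<open>Conjugation of a matrix by a group element.\<close>

definition cj :: "'a \<Rightarrow> complex mat \<Rightarrow> complex mat" where
  "cj t A = \<rho> (inv t) * A * \<rho> t"

lemma cj_carrier [simp, intro]: "t \<in> carrier G \<Longrightarrow> A \<in> carrier_mat n n \<Longrightarrow> cj t A \<in> carrier_mat n n"
  by (auto simp: cj_def intro: sq_mult)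

lemma rho_inv_cancel:
  assumes "t \<in> carrier G" "A \<in> carrier_mat n n"
  shows "\<rho> t * (\<rho> (inv t) * A) = A" "\<rho> (inv t) * (\<rho> t * A) = A"
  using assms by (simp_all add: sq_assoc[of _ n, symmetric] rho_inv)

lemma cj_mult:
  assumes "t \<in> carrier G" "A \<in> carrier_mat n n" "B \<in> carrier_mat n n"
  shows "cj t A * cj t B = cj t (A * B)"
  using assms unfolding cj_def
  by (simp add: sq_assoc[of _ n] sq_mult[of _ n] rho_inv_cancel)

lemma cj_cj:
  assumes "s \<in> carrier G" "t \<in> carrier G" "A \<in> carrier_mat n n"
  shows "cj t (cj s A) = cj (s \<otimes> t) A"
  using assms unfolding cj_def
  by (simp add: sq_assoc[of _ n] sq_mult[of _ n] rho_mult inv_mult_group)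

lemma cj_one: "A \<in> carrier_mat n n \<Longrightarrow> cj \<one> A = A"
  by (simp add: cj_def)

lemma cj_smult:
  assumes "t \<in> carrier G" "A \<in> carrier_mat n n"
  shows "cj t (c \<cdot>\<^sub>m A) = c \<cdot>\<^sub>m cj t A"
  using assms unfolding cj_def
  by (simp add: smult_mult_mat[of _ n n _ n] sq_mult[of _ n])

lemma rho_cj: "t \<in> carrier G \<Longrightarrow> A \<in> carrier_mat n n \<Longrightarrow> \<rho> t * cj t A = A * \<rho> t"
  unfolding cj_def by (simp add: sq_assoc[of _ n] sq_mult[of _ n] rho_inv_cancel)

lemma trace_rho_cj:
  assumes "g \<in> carrier G" "t \<in> carrier G" "A \<in> carrier_mat n n"
  shows "mat_trace (\<rho> g * cj t A) = mat_trace (\<rho> (t \<otimes> g \<otimes> inv t) * A)"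
proof -
  have "\<rho> g * cj t A = (\<rho> g * (\<rho> (inv t) * A)) * \<rho> t"
    unfolding cj_def using assms by (simp add: sq_assoc[of _ n] sq_mult[of _ n])
  also have "mat_trace \<dots> = mat_trace (\<rho> t * (\<rho> g * (\<rho> (inv t) * A)))"
    using assms by (intro mat_trace_mult_comm[of _ n n] sq_mult) auto
  also have "\<rho> t * (\<rho> g * (\<rho> (inv t) * A)) = \<rho> (t \<otimes> g \<otimes> inv t) * A"
    using assms by (simp add: rho_mult sq_assoc[of _ n] sq_mult[of _ n])
  finally show ?thesis .
qed

lemma conj_sum_cj: "conj_sum B = msum n n (\<lambda>t. cj t B) (carrier G)"
  by (simp add: conj_sum_def cj_def)

end

context irr_rep
begin

text \<open>The hypotheses on \<open>e\<close> in this lemma and the next hold for the projection onto an isotypic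
  component of the restriction to a normal subgroup.\<close>

lemma idempotent_dichotomy:
  assumes e: "e \<in> carrier_mat n n" "e * e = e" "e \<noteq> 0\<^sub>m n n"
    and prim: "\<And>t. t \<in> carrier G \<Longrightarrow> \<exists>c. e * cj t e = c \<cdot>\<^sub>m e"
    and comm: "\<And>t. t \<in> carrier G \<Longrightarrow> e * cj t e = cj t e * e"
    and t: "t \<in> carrier G"
  shows "cj t e = e \<or> e * cj t e = 0\<^sub>m n n"
proof -
  define f where "f = cj t e"
  have f: "f \<in> carrier_mat n n" "f * f = f"
    using e t cj_mult[OF t e(1) e(1)] by (auto simp: f_def)
  obtain c where c: "e * f = c \<cdot>\<^sub>m e" using prim[OF t] unfolding f_def by blast
  obtain c' where c': "e * cj (inv t) e = c' \<cdot>\<^sub>m e" using prim[of "inv t"] t by blast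
  have "cj t (e * cj (inv t) e) = f * cj t (cj (inv t) e)"
    unfolding f_def using e t by (intro cj_mult[symmetric]) auto
  also have "cj t (cj (inv t) e) = e" using e t by (simp add: cj_cj cj_one)
  finally have fe: "f * e = c' \<cdot>\<^sub>m f" unfolding c' f_def using e t by (simp add: cj_smult)
  have "c \<cdot>\<^sub>m (c \<cdot>\<^sub>m e) = (c \<cdot>\<^sub>m e) * f" using c e f by (simp add: smult_mult_mat[of _ n n _ n])
  also have "\<dots> = e * (f * f)" unfolding c[symmetric] using e f by (simp add: sq_assoc[of _ n])
  also have "\<dots> = c \<cdot>\<^sub>m e" using f c by simp
  finally have cc: "c * c = c"
    using smult_cancel_mat[of "c * c" e c n n] e by (simp add: smult_smult_mat)
  show ?thesis
  proof (cases "c = 0")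
    case True
    then show ?thesis using c e unfolding f_def by (simp add: zero_smult_mat)
  next
    case False
    then have "c = 1" using cc by simp
    then have ef: "e = f * e" using c comm[OF t] unfolding f_def by simp
    then have e': "e = c' \<cdot>\<^sub>m f" using fe by simp
    have f0: "f \<noteq> 0\<^sub>m n n"
    proof
      assume "f = 0\<^sub>m n n"
      then have "e = 0\<^sub>m n n" using ef e by simp
      then show False using e by simp
    qed
    have "e * e = c' \<cdot>\<^sub>m (f * e)" using e' f e by (metis smult_mult_mat(1))
    then have "e = c' \<cdot>\<^sub>m e" using ef e(2) by simp
    then have "c' = 1" using smult_eq_self[OF e(1,3), of c'] by simp
    then show ?thesis using e' unfolding f_def by simp
  qed
qed

text \<open>Clifford's argument: if the conjugates of a nontrivial idempotent \<open>e\<close> are equal or orthogonal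
  to it, then the character is induced from the stabiliser of \<open>e\<close>, namely from the character
  of the stabiliser on the image of \<open>e\<close>.\<close>

lemma induced_from_stabiliser:
  assumes e: "e \<in> carrier_mat n n" "e * e = e" "e \<noteq> 0\<^sub>m n n" "e \<noteq> 1\<^sub>m n"
    and prim: "\<And>t. t \<in> carrier G \<Longrightarrow> \<exists>c. e * cj t e = c \<cdot>\<^sub>m e"
    and comm: "\<And>t. t \<in> carrier G \<Longrightarrow> e * cj t e = cj t e * e"
  shows "\<not> primitive G (rep_char G \<rho>)"
proof -
  define T where "T = {t \<in> carrier G. cj t e = e}"
  have orth: "e * cj t e = 0\<^sub>m n n" if "t \<in> carrier G" "t \<notin> T" for t
    using idempotent_dichotomy[OF e(1-3) prim comm that(1)] that unfolding T_def by blast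
  have sub: "subgroup T G"
  proof (rule subgroupI)
    show "T \<noteq> {}" unfolding T_def using cj_one[OF e(1)] by blast
    fix s t assume st: "s \<in> T" "t \<in> T"
    then show "s \<otimes> t \<in> T" using cj_cj[of s t e] e(1) unfolding T_def by auto
  next
    fix s assume s: "s \<in> T"
    then have sc: "s \<in> carrier G" "cj s e = e" unfolding T_def by auto
    have "cj (inv s) (cj s e) = e" using sc(1) e(1) by (simp add: cj_cj cj_one)
    then show "inv s \<in> T" using sc unfolding T_def by simp
  qed (auto simp: T_def)
  have Tsub: "T \<subseteq> carrier G" by (auto simp: T_def)
  then have finT: "finite T" using fin finite_subset by blast
  have Tpos: "card T > 0" using finT subgroup.one_closed[OF sub] card_gt_0_iff by blast
  \<comment> \<open>By Schur's lemma the conjugates of \<open>e\<close> add up to a scalar, which is found to be \<open>card T\<close> by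
    multiplication with \<open>e\<close>.\<close>
  define s where "s = of_nat N * mat_trace e / (of_nat n :: complex)"
  have S: "conj_sum e = s \<cdot>\<^sub>m 1\<^sub>m n" unfolding s_def by (rule conj_sum_eq[OF e(1)])
  have "s \<cdot>\<^sub>m e = e * conj_sum e" unfolding S using e(1) by (simp add: smult_mult_mat[of _ n n _ n])
  also have "\<dots> = msum n n (\<lambda>t. e * cj t e) (carrier G)"
    unfolding conj_sum_cj using e(1) by (intro msum_mult_left) auto
  also have "\<dots> = msum n n (\<lambda>t. (if t \<in> T then 1 else 0) \<cdot>\<^sub>m e) (carrier G)"
  proof (rule msum_cong[OF refl])
    fix t assume t: "t \<in> carrier G"
    show "e * cj t e = (if t \<in> T then 1 else 0) \<cdot>\<^sub>m e"
      using orth[OF t] e by (auto simp: zero_smult_mat T_def)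
  qed
  also have "\<dots> = (\<Sum>t\<in>carrier G. if t \<in> T then 1 else 0) \<cdot>\<^sub>m e" by (rule msum_smult_const[OF e(1)])
  also have "(\<Sum>t\<in>carrier G. if t \<in> T then 1 else (0::complex)) = of_nat (card T)"
    using Tsub by (simp add: sum.If_cases Int_absorb1)
  finally have "s = of_nat (card T)" using smult_cancel_mat e(1,3) by blast
  then have S: "conj_sum e = of_nat (card T) \<cdot>\<^sub>m 1\<^sub>m n" using S by simp
  have Tneq: "T \<noteq> carrier G"
  proof
    assume TG: "T = carrier G"
    have "conj_sum e = msum n n (\<lambda>t. 1 \<cdot>\<^sub>m e) (carrier G)"
      unfolding conj_sum_cj using TG unfolding T_def by (intro msum_cong) auto
    also have "\<dots> = (\<Sum>t\<in>carrier G. 1) \<cdot>\<^sub>m e" by (rule msum_smult_const[OF e(1)])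
    finally have "of_nat N \<cdot>\<^sub>m e = of_nat N \<cdot>\<^sub>m 1\<^sub>m n" using S TG by simp
    then have "(1 / of_nat N) \<cdot>\<^sub>m (of_nat N \<cdot>\<^sub>m e) = (1 / of_nat N) \<cdot>\<^sub>m (of_nat N \<cdot>\<^sub>m 1\<^sub>m n)" by simp
    then have "e = 1\<^sub>m n" unfolding smult_smult_mat using N_nonzero by (simp del: of_nat_eq_0_iff card_eq_0_iff)
    then show False using e by simp
  qed
  have tr0: "mat_trace (\<rho> h * e) = 0" if h: "h \<in> carrier G" "h \<notin> T" for h
  proof -
    have "mat_trace (\<rho> h * e) = mat_trace ((\<rho> h * e) * e)" using h e by (simp add: sq_assoc[of _ n])
    also have "\<dots> = mat_trace (e * (\<rho> h * e))" using h e by (intro mat_trace_mult_comm[of _ n n] sq_mult) auto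
    also have "e * (\<rho> h * e) = (\<rho> h * cj h e) * e" using h e by (simp add: rho_cj sq_assoc[of _ n])
    also have "\<dots> = \<rho> h * (e * cj h e)" using h e comm[OF h(1)] by (simp add: sq_assoc[of _ n])
    also have "\<dots> = 0\<^sub>m n n" using orth[OF h] h by simp
    finally show ?thesis by (simp add: mat_trace_def)
  qed
  define W where "W = {v \<in> carrier_vec n. e *\<^sub>v v = v}"
  obtain m J K where J: "J \<in> carrier_mat n m" and K: "K \<in> carrier_mat m n" and KJ: "K * J = 1\<^sub>m m"
    and W: "W = (\<lambda>v. J *\<^sub>v v) ` carrier_vec m"
  proof (rule subspace_basis_matrix[of W n])
    show "c \<cdot>\<^sub>v v \<in> W" if "v \<in> W" for c v using that e(1) mult_mat_vec[OF e(1)] by (auto simp: W_def)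
    show "v + w \<in> W" if "v \<in> W" "w \<in> W" for v w using that e(1) by (auto simp: W_def mult_add_distrib_mat_vec)
  qed (use e(1) in \<open>auto simp: W_def\<close>)
  have eJ: "e * J = J"
  proof (rule mat_eqI_mult_vec[of _ n m])
    fix v :: "complex vec" assume v: "v \<in> carrier_vec m"
    then have "J *\<^sub>v v \<in> W" using W by blast
    then have "e *\<^sub>v (J *\<^sub>v v) = J *\<^sub>v v" by (simp add: W_def)
    then show "(e * J) *\<^sub>v v = J *\<^sub>v v" using e(1) J v by simp
  qed (use e(1) J in auto)
  have JKe: "J * (K * e) = e"
  proof (rule mat_eqI_mult_vec[of _ n n])
    fix v :: "complex vec" assume v: "v \<in> carrier_vec n"
    have ev: "e *\<^sub>v v \<in> carrier_vec n" using e(1) v by auto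
    have "e *\<^sub>v (e *\<^sub>v v) = (e * e) *\<^sub>v v" using e(1) v by (intro assoc_mult_mat_vec[symmetric]) auto
    then have "e *\<^sub>v v \<in> W" using e(2) ev by (simp add: W_def)
    then obtain v' where v': "v' \<in> carrier_vec m" "e *\<^sub>v v = J *\<^sub>v v'" unfolding W by blast
    have "(J * (K * e)) *\<^sub>v v = J *\<^sub>v ((K * e) *\<^sub>v v)" using e(1) J K v by (intro assoc_mult_mat_vec) auto
    also have "(K * e) *\<^sub>v v = K *\<^sub>v (e *\<^sub>v v)" using e(1) K v by (intro assoc_mult_mat_vec) auto
    also have "\<dots> = (K * J) *\<^sub>v v'" unfolding v'(2) using K J v' by (intro assoc_mult_mat_vec[symmetric]) auto
    finally show "(J * (K * e)) *\<^sub>v v = e *\<^sub>v v" unfolding KJ using v' by simp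
  qed (use e(1) J K in auto)
  have m: "m > 0"
  proof (rule ccontr)
    assume "\<not> m > 0"
    have "J * (K * e) = 0\<^sub>m n n"
      using \<open>\<not> m > 0\<close> J K e(1) by (intro eq_matI) (auto simp: scalar_prod_def)
    then show False using JKe e(3) by simp
  qed
  have ecomm: "e * \<rho> h = \<rho> h * e" if "h \<in> T" for h
    using that rho_cj[of h e] e(1) unfolding T_def by auto
  interpret T: fin_rep "G\<lparr>carrier := T\<rparr>" n \<rho> by (rule restrict_fin_rep[OF sub])
  define \<theta> where "\<theta> h = K * (\<rho> h * J)" for h
  have "J * (K * (\<rho> h * J)) = \<rho> h * J" if h: "h \<in> T" for h
  proof -
    have hc: "h \<in> carrier G" using h Tsub by auto
    have "\<rho> h * J = \<rho> h * (e * J)" using eJ by simp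
    also have "\<dots> = (\<rho> h * e) * J" using hc e(1) J by (intro assoc_mult_mat[symmetric, of _ n n _ n _ m]) auto
    also have "\<dots> = e * (\<rho> h * J)" unfolding ecomm[OF h, symmetric] using hc e(1) J by (intro assoc_mult_mat[of _ n n _ n _ m]) auto
    finally have 1: "\<rho> h * J = e * (\<rho> h * J)" .
    have c: "\<rho> h * J \<in> carrier_mat n m" "K * e \<in> carrier_mat m n" using hc J K e(1) by auto
    have "J * (K * (\<rho> h * J)) = J * (K * (e * (\<rho> h * J)))" using 1 by simp
    also have "K * (e * (\<rho> h * J)) = (K * e) * (\<rho> h * J)"
      using K e(1) c by (intro assoc_mult_mat[symmetric, of _ m n _ n _ m]) auto
    also have "J * \<dots> = (J * (K * e)) * (\<rho> h * J)"
      using J c by (intro assoc_mult_mat[symmetric, of _ n m _ n _ m]) auto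
    finally show ?thesis unfolding JKe using 1 by simp
  qed
  then have rep_theta: "is_rep (G\<lparr>carrier := T\<rparr>) m \<theta>"
    unfolding \<theta>_def by (intro T.compress_rep[OF J K KJ m]) auto
  have tr_theta: "mat_trace (\<theta> h) = mat_trace (\<rho> h * e)" if h: "h \<in> T" for h
  proof -
    have hc: "h \<in> carrier G" using h Tsub by auto
    have c: "\<rho> h * J \<in> carrier_mat n m" "K * e \<in> carrier_mat m n" using hc J K e(1) by auto
    have "\<rho> h * e = \<rho> h * (J * (K * e))" using JKe by simp
    also have "\<dots> = (\<rho> h * J) * (K * e)" using hc J c by (intro assoc_mult_mat[symmetric, of _ n n _ m _ n]) auto
    also have "mat_trace \<dots> = mat_trace ((K * e) * (\<rho> h * J))" by (rule mat_trace_mult_comm[OF c])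
    also have "(K * e) * (\<rho> h * J) = K * (e * (\<rho> h * J))" using K e(1) c by (intro assoc_mult_mat[of _ m n _ n _ m]) auto
    also have "e * (\<rho> h * J) = (e * \<rho> h) * J" using hc e(1) J by (intro assoc_mult_mat[symmetric, of _ n n _ n _ m]) auto
    also have "\<dots> = \<rho> h * (e * J)" unfolding ecomm[OF h] using hc e(1) J by (intro assoc_mult_mat[of _ n n _ n _ m]) auto
    finally show ?thesis unfolding eJ \<theta>_def by simp
  qed
  have "rep_char G \<rho> = induced_char G T (rep_char (G\<lparr>carrier := T\<rparr>) \<theta>)"
    unfolding rep_char_def induced_char_def
  proof (rule restrict_ext)
    fix g assume g: "g \<in> carrier G"
    have "of_nat (card T) * \<chi> g = mat_trace (\<rho> g * conj_sum e)"
      unfolding S using g by (simp add: smult_mult_mat[of _ n n _ n] mat_trace_smult[of _ n])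
    also have "\<rho> g * conj_sum e = msum n n (\<lambda>t. \<rho> g * cj t e) (carrier G)"
      unfolding conj_sum_cj using g e(1) by (intro msum_mult_left) auto
    also have "mat_trace \<dots> = (\<Sum>t\<in>carrier G. mat_trace (\<rho> g * cj t e))"
      using g e(1) by (intro mat_trace_msum) (auto intro: sq_mult)
    also have "\<dots> = (\<Sum>t\<in>carrier G. mat_trace (\<rho> (t \<otimes> g \<otimes> inv t) * e))"
      using g e(1) by (intro sum.cong refl trace_rho_cj)
    also have "\<dots> = (\<Sum>t\<in>{t \<in> carrier G. t \<otimes> g \<otimes> inv t \<in> T}. mat_trace (\<rho> (t \<otimes> g \<otimes> inv t) * e))"
      using g tr0 by (intro sum.mono_neutral_right) auto
    also have "\<dots> = (\<Sum>t\<in>{t \<in> carrier G. t \<otimes> g \<otimes> inv t \<in> T}.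
        (\<lambda>g\<in>carrier (G\<lparr>carrier := T\<rparr>). mat_trace (\<theta> g)) (t \<otimes> g \<otimes> inv t))"
      by (intro sum.cong refl) (simp add: tr_theta)
    finally have eq: "of_nat (card T) * \<chi> g = (\<Sum>t\<in>{t \<in> carrier G. t \<otimes> g \<otimes> inv t \<in> T}.
        (\<lambda>g\<in>carrier (G\<lparr>carrier := T\<rparr>). mat_trace (\<theta> g)) (t \<otimes> g \<otimes> inv t))" .
    have T0: "of_nat (card T) \<noteq> (0::complex)" using Tpos by (metis less_irrefl of_nat_eq_0_iff)
    show "\<chi> g = 1 / of_nat (card T) * (\<Sum>t\<in>{t \<in> carrier G. t \<otimes> g \<otimes> inv t \<in> T}.
        (\<lambda>g\<in>carrier (G\<lparr>carrier := T\<rparr>). mat_trace (\<theta> g)) (t \<otimes> g \<otimes> inv t))"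
      unfolding eq[symmetric] using T0 by (simp del: of_nat_eq_0_iff card_eq_0_iff)
  qed
  moreover have "rep_char (G\<lparr>carrier := T\<rparr>) \<theta> \<in> characters (G\<lparr>carrier := T\<rparr>)"
    unfolding characters_def using rep_theta by blast
  ultimately show ?thesis unfolding primitive_def using sub Tneq by blast
qed

text \<open>Each irreducible constituent \<open>\<psi>\<close> of the restriction to \<open>L\<close> has the whole space as its isotypic
  component, since otherwise the character would be induced from a proper subgroup.\<close>

theorem primitive_imp_homogeneous:
  assumes prim: "primitive G (rep_char G \<rho>)" and L: "L \<lhd> G"
  obtains d \<psi> where "irr_rep (G\<lparr>carrier := L\<rparr>) d \<psi>" "d dvd n"
    "\<And>x. x \<in> L \<Longrightarrow> mat_trace (\<rho> x) = of_nat n / of_nat d * mat_trace (\<psi> x)"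
proof -
  have sub: "subgroup L G" using L by (rule normal_imp_subgroup)
  have Lc: "L \<subseteq> carrier G" by (rule subgroup.subset[OF sub])
  interpret L: fin_rep "G\<lparr>carrier := L\<rparr>" n \<rho> by (rule restrict_fin_rep[OF sub])
  obtain d \<psi> J where psi: "irreducible_rep (G\<lparr>carrier := L\<rparr>) d \<psi>" and J: "J \<in> carrier_mat n d" "J \<noteq> 0\<^sub>m n d"
    "\<And>g. g \<in> carrier (G\<lparr>carrier := L\<rparr>) \<Longrightarrow> \<rho> g * J = J * \<psi> g"
    by (rule L.irreducible_constituent) blast
  have "is_rep (G\<lparr>carrier := L\<rparr>) d \<psi>" using psi unfolding irreducible_rep_def by blast
  then interpret psi: irr_rep "G\<lparr>carrier := L\<rparr>" d \<psi>
    using psi L.fin by unfold_locales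
  interpret LP: rep_with_irr "G\<lparr>carrier := L\<rparr>" n \<rho> d \<psi> by unfold_locales
  define e where "e = LP.e_psi"
  have e: "e \<in> carrier_mat n n" "e * e = e" "e \<noteq> 0\<^sub>m n n"
    unfolding e_def using LP.e_psi_idem LP.e_psi_nonzero[OF J] by auto
  have ecomm: "e * \<rho> x = \<rho> x * e" if "x \<in> L" for x
    unfolding e_def using LP.e_psi_commute[of x] that by simp
  have cj_alg: "\<exists>f. cj t e = L.alg f" if t: "t \<in> carrier G" for t
  proof
    have bij: "bij_betw (\<lambda>x. t \<otimes> x \<otimes> inv t) L L"
    proof (rule bij_betw_byWitness[where f' = "\<lambda>x. inv t \<otimes> x \<otimes> t"])
      show "\<forall>a\<in>L. inv t \<otimes> (t \<otimes> a \<otimes> inv t) \<otimes> t = a"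
      proof
        fix a assume "a \<in> L"
        then have "a \<in> carrier G" using Lc by auto
        then have "inv t \<otimes> (t \<otimes> a \<otimes> inv t) \<otimes> t = (inv t \<otimes> t) \<otimes> a \<otimes> (inv t \<otimes> t)"
          using t by (simp only: m_assoc m_closed inv_closed)
        then show "inv t \<otimes> (t \<otimes> a \<otimes> inv t) \<otimes> t = a" using t \<open>a \<in> carrier G\<close> by simp
      qed
      show "\<forall>a\<in>L. t \<otimes> (inv t \<otimes> a \<otimes> t) \<otimes> inv t = a"
      proof
        fix a assume "a \<in> L"
        then have "a \<in> carrier G" using Lc by auto
        then have "t \<otimes> (inv t \<otimes> a \<otimes> t) \<otimes> inv t = (t \<otimes> inv t) \<otimes> a \<otimes> (t \<otimes> inv t)"
          using t by (simp only: m_assoc m_closed inv_closed)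
        then show "t \<otimes> (inv t \<otimes> a \<otimes> t) \<otimes> inv t = a" using t \<open>a \<in> carrier G\<close> by simp
      qed
      show "(\<lambda>x. t \<otimes> x \<otimes> inv t) ` L \<subseteq> L" using normal.inv_op_closed2[OF L t] by auto
      show "(\<lambda>x. inv t \<otimes> x \<otimes> t) ` L \<subseteq> L" using normal.inv_op_closed1[OF L t] by auto
    qed
    have "cj t e = (msum n n (\<lambda>x. psi.e_coeff x \<cdot>\<^sub>m (\<rho> (inv t) * \<rho> x)) L) * \<rho> t"
      unfolding cj_def e_def using t by (simp add: L.alg_mult_left[of _ n])
    also have "\<dots> = msum n n (\<lambda>x. (psi.e_coeff x \<cdot>\<^sub>m (\<rho> (inv t) * \<rho> x)) * \<rho> t) L"
      using t Lc by (intro msum_mult_right) (auto intro!: sq_mult)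
    also have "\<dots> = msum n n (\<lambda>x. psi.e_coeff x \<cdot>\<^sub>m \<rho> (inv t \<otimes> x \<otimes> t)) L"
    proof (rule msum_cong[OF refl])
      fix x assume "x \<in> L"
      then have x: "x \<in> carrier G" using Lc by auto
      then show "(psi.e_coeff x \<cdot>\<^sub>m (\<rho> (inv t) * \<rho> x)) * \<rho> t = psi.e_coeff x \<cdot>\<^sub>m \<rho> (inv t \<otimes> x \<otimes> t)"
        using t by (simp add: rho_mult smult_mult_mat(1)[of _ n n _ n] sq_mult[of _ n])
    qed
    also have "\<dots> = msum n n (\<lambda>x. psi.e_coeff (t \<otimes> x \<otimes> inv t) \<cdot>\<^sub>m \<rho> (inv t \<otimes> (t \<otimes> x \<otimes> inv t) \<otimes> t)) L"
      by (rule msum_reindex_bij[OF bij])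
    also have "\<dots> = L.alg (\<lambda>x. psi.e_coeff (t \<otimes> x \<otimes> inv t))"
      unfolding L.alg_def
    proof (rule msum_cong)
      fix x assume "x \<in> carrier (G\<lparr>carrier := L\<rparr>)"
      then have x: "x \<in> carrier G" using Lc by auto
      have "inv t \<otimes> (t \<otimes> x \<otimes> inv t) \<otimes> t = (inv t \<otimes> t) \<otimes> x \<otimes> (inv t \<otimes> t)"
        using t x by (simp only: m_assoc m_closed inv_closed)
      then show "psi.e_coeff (t \<otimes> x \<otimes> inv t) \<cdot>\<^sub>m \<rho> (inv t \<otimes> (t \<otimes> x \<otimes> inv t) \<otimes> t) = psi.e_coeff (t \<otimes> x \<otimes> inv t) \<cdot>\<^sub>m \<rho> x"
        using t x by simp
    qed simp
    finally show "cj t e = L.alg (\<lambda>x. psi.e_coeff (t \<otimes> x \<otimes> inv t))" .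
  qed
  have cj_comm: "cj t e * \<rho> x = \<rho> x * cj t e" if t: "t \<in> carrier G" and x: "x \<in> L" for t x
  proof -
    have xc: "x \<in> carrier G" using x Lc by auto
    define y where "y = t \<otimes> x \<otimes> inv t"
    have y: "y \<in> L" "y \<in> carrier G" using normal.inv_op_closed2[OF L t x] Lc unfolding y_def by auto
    have ty: "inv t \<otimes> y = x \<otimes> inv t" "y \<otimes> t = t \<otimes> x"
      using t xc unfolding y_def by (simp_all add: m_assoc[symmetric], simp add: m_assoc)
    have "cj t e * \<rho> x = \<rho> (inv t) * (e * \<rho> (t \<otimes> x))"
      unfolding cj_def using t xc e(1) by (simp add: sq_assoc[of _ n] sq_mult[of _ n] rho_mult)
    also have "e * \<rho> (t \<otimes> x) = (e * \<rho> y) * \<rho> t"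
      unfolding ty(2)[symmetric] using t y e(1) by (simp add: sq_assoc[of _ n] rho_mult)
    also have "\<dots> = \<rho> y * (e * \<rho> t)"
      unfolding ecomm[OF y(1)] using t y e(1) by (simp add: sq_assoc[of _ n])
    also have "\<rho> (inv t) * (\<rho> y * (e * \<rho> t)) = \<rho> (inv t \<otimes> y) * (e * \<rho> t)"
      using t y e(1) by (simp add: sq_assoc[of _ n] sq_mult[of _ n] rho_mult)
    also have "\<dots> = \<rho> x * cj t e"
      unfolding ty(1) cj_def using t xc e(1) by (simp add: sq_assoc[of _ n] sq_mult[of _ n] rho_mult)
    finally show ?thesis .
  qed
  have one: "e = 1\<^sub>m n"
  proof (rule ccontr)
    assume "e \<noteq> 1\<^sub>m n"
    moreover have "\<exists>c. e * cj t e = c \<cdot>\<^sub>m e" if t: "t \<in> carrier G" for t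
    proof -
      obtain f where f: "cj t e = L.alg f" using cj_alg[OF t] by blast
      show ?thesis unfolding f unfolding e_def
        by (rule LP.e_psi_primitive) (use cj_comm[OF t] f in simp)
    qed
    moreover have "e * cj t e = cj t e * e" if t: "t \<in> carrier G" for t
    proof -
      obtain f where f: "cj t e = L.alg f" using cj_alg[OF t] by blast
      show ?thesis unfolding f by (rule L.alg_commute[OF e(1)]) (use ecomm in simp)
    qed
    ultimately have "\<not> primitive G (rep_char G \<rho>)" by (intro induced_from_stabiliser[OF e]) auto
    then show False using prim by simp
  qed
  have pr: "mat_trace (\<rho> x) = of_nat n / of_nat d * mat_trace (\<psi> x)" if "x \<in> L" for x
    using LP.homogeneous_chi[of x] one that unfolding e_def by simp
  have "d dvd n" by (rule LP.proportional_degree_dvd) (use pr in simp)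
  then show thesis using that[OF psi.irr_rep_axioms] pr by blast
qed

end

section \<open>A p'-by-p normal section of a solvable group\<close>

context group
begin

lemma subgroup_pow_card:
  assumes "subgroup H G" "finite H" "x \<in> H"
  shows "x [^] card H = \<one>"
proof -
  interpret H: group "G\<lparr>carrier := H\<rparr>" by (rule subgroup.subgroup_is_group[OF assms(1) is_group])
  have "x [^]\<^bsub>G\<lparr>carrier := H\<rparr>\<^esub> card H = \<one>"
    using H.pow_order_eq_1[of x] assms unfolding Coset.order_def by simp
  then show ?thesis by (simp add: nat_pow_consistent[symmetric])
qed

lemma coprime_powers_trivial:
  assumes "x \<in> carrier G" "x [^] (a::nat) = \<one>" "x [^] (b::nat) = \<one>" "coprime a b"
  shows "x = \<one>"
proof -
  have "ord x dvd a" "ord x dvd b" using assms pow_eq_id by auto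
  then have "ord x = 1" using assms(4) by (metis coprime_common_divisor_nat)
  then show ?thesis using assms(1) ord_eq_1 by blast
qed

lemma exists_abelian_normal:
  assumes "solvable G" "carrier G \<noteq> {\<one>}"
  obtains A where "A \<lhd> G" "A \<noteq> {\<one>}" "\<And>x y. x \<in> A \<Longrightarrow> y \<in> A \<Longrightarrow> x \<otimes> y = y \<otimes> x"
proof -
  obtain k where k: "(derived G ^^ k) (carrier G) = {\<one>}"
    using assms(1) solvable_iff_trivial_derived_seq by blast
  define m where "m = (LEAST k. (derived G ^^ k) (carrier G) = {\<one>})"
  have m: "(derived G ^^ m) (carrier G) = {\<one>}" unfolding m_def using k by (rule LeastI)
  obtain l where l: "m = Suc l" using m assms(2) by (cases m) auto
  define A where "A = (derived G ^^ l) (carrier G)"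
  have An: "(derived G ^^ i) (carrier G) \<lhd> G" for i
  proof (induction i)
    case 0
    show ?case using normal_inv_iff subgroup_self by auto
  qed (simp add: derived_is_normal)
  have "A \<noteq> {\<one>}" unfolding A_def
    using not_less_Least[of l "\<lambda>k. (derived G ^^ k) (carrier G) = {\<one>}"] l unfolding m_def by simp
  moreover have "x \<otimes> y = y \<otimes> x" if x: "x \<in> A" and y: "y \<in> A" for x y
  proof -
    have c: "x \<in> carrier G" "y \<in> carrier G"
      using x y exp_of_derived_in_carrier[of "carrier G" l] unfolding A_def by auto
    have "x \<otimes> y \<otimes> inv x \<otimes> inv y \<in> derived G A"
      unfolding derived_def by (rule generate.incl) (use x y in blast)
    also have "derived G A = {\<one>}" using m unfolding l A_def by simp
    finally have "x \<otimes> y \<otimes> inv x \<otimes> inv y = \<one>" by simp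
    then have "x \<otimes> y \<otimes> inv (y \<otimes> x) = \<one>" using c by (simp add: inv_mult_group m_assoc)
    then show ?thesis using c by (metis inv_closed inv_equality inv_inv m_closed)
  qed
  ultimately show thesis using that An unfolding A_def by blast
qed

text \<open>The witness is the \<open>p\<close>-torsion of \<open>A\<close>.\<close>

lemma exists_normal_p_subgroup:
  fixes p :: nat
  assumes fin: "finite (carrier G)" and p: "prime p" and A: "A \<lhd> G"
    and ab: "\<And>x y. x \<in> A \<Longrightarrow> y \<in> A \<Longrightarrow> x \<otimes> y = y \<otimes> x" and dvd: "p dvd card A"
  obtains B b where "B \<lhd> G" "card B = p ^ b" "b > 0"
proof -
  have subA: "subgroup A G" using A by (rule normal_imp_subgroup)
  have Ac: "A \<subseteq> carrier G" by (rule subgroup.subset[OF subA])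
  have finA: "finite A" using Ac fin finite_subset by blast
  \<comment> \<open>Large enough for \<open>p ^ k\<close> to annihilate all \<open>p\<close>-elements of \<open>A\<close>.\<close>
  define k where "k = card A"
  define B where "B = {x \<in> A. x [^] (p ^ k) = \<one>}"
  have comm_pow: "(x \<otimes> y) [^] (i::nat) = x [^] i \<otimes> y [^] i" if "x \<in> A" "y \<in> A" for x y i
    using pow_mult_distrib[OF ab[OF that]] that Ac by auto
  have subB: "subgroup B G"
  proof (rule subgroupI)
    show "B \<subseteq> carrier G" using Ac by (auto simp: B_def)
    show "B \<noteq> {}" using subgroup.one_closed[OF subA] by (auto simp: B_def)
    show "inv x \<in> B" if "x \<in> B" for x
      using that Ac subgroup.m_inv_closed[OF subA] by (auto simp: B_def nat_pow_inv)
    show "x \<otimes> y \<in> B" if "x \<in> B" "y \<in> B" for x y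
      using that comm_pow subgroup.m_closed[OF subA] by (auto simp: B_def)
  qed
  have Bn: "B \<lhd> G" unfolding normal_inv_iff
  proof (intro conjI subB ballI)
    fix x h assume x: "x \<in> carrier G" and h: "h \<in> B"
    then have "x \<otimes> h \<otimes> inv x \<in> A" using normal.inv_op_closed2[OF A x] by (simp add: B_def)
    moreover have "(x \<otimes> h \<otimes> inv x) [^] (p ^ k) = \<one>"
      using conj_pow[of x h "p ^ k"] x h Ac by (auto simp: B_def)
    ultimately show "x \<otimes> h \<otimes> inv x \<in> B" by (simp add: B_def)
  qed
  have finB: "finite B" using finA by (simp add: B_def)
  have no_other: "r = p" if r: "prime r" "r dvd card B" for r
  proof (rule ccontr)
    assume "r \<noteq> p"
    interpret B: group "G\<lparr>carrier := B\<rparr>" by (rule subgroup.subgroup_is_group[OF subB is_group])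
    obtain s where "card B = r ^ 1 * s" using r(2) by auto
    then obtain Q where Q: "subgroup Q (G\<lparr>carrier := B\<rparr>)" "card Q = r ^ 1"
      using sylow_thm[OF r(1) B.is_group, of 1 s] finB unfolding Coset.order_def by auto
    have QB: "Q \<subseteq> B" using subgroup.subset[OF Q(1)] by simp
    have subQ: "subgroup Q G" by (rule incl_subgroup[OF subB Q(1)])
    have "\<not> Q \<subseteq> {\<one>}"
    proof
      assume "Q \<subseteq> {\<one>}"
      then have "card Q \<le> 1" using card_mono[of "{\<one>}" Q] by simp
      then show False using Q(2) prime_gt_1_nat[OF r(1)] by simp
    qed
    then obtain x where x: "x \<in> Q" "x \<noteq> \<one>" by auto
    have "x [^] r = \<one>" using subgroup_pow_card[OF subQ _ x(1)] finite_subset[OF QB finB] Q(2) by simp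
    moreover have "x [^] (p ^ k) = \<one>" "x \<in> carrier G" using x QB Ac by (auto simp: B_def)
    moreover have "coprime r (p ^ k)" using \<open>r \<noteq> p\<close> r(1) p by (simp add: primes_coprime)
    ultimately show False using coprime_powers_trivial x(2) by blast
  qed
  have cB: "card B \<noteq> 0" using subgroup.one_closed[OF subB] finB by auto
  obtain b where b: "card B = p ^ b"
  proof -
    obtain s where s: "card B = p ^ multiplicity p (card B) * s" "\<not> p dvd s"
      using multiplicity_decompose'[of "card B" p] cB p by (metis not_prime_unit)
    have "s = 1"
    proof (rule ccontr)
      assume "s \<noteq> 1"
      then obtain r where r: "prime r" "r dvd s" using prime_factor_nat by blast
      then have "r dvd card B" using s(1) by (metis dvd_mult)
      then show False using no_other r s(2) by blast
    qed
    then show thesis using s(1) that by simp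
  qed
  have "b > 0"
  proof (rule ccontr)
    assume "\<not> b > 0"
    then have "card B = 1" using b by simp
    then have B1: "B = {\<one>}" using subgroup.one_closed[OF subB] by (metis card_1_singletonE singletonD)
    interpret A: group "G\<lparr>carrier := A\<rparr>" by (rule subgroup.subgroup_is_group[OF subA is_group])
    obtain s where "card A = p ^ 1 * s" using dvd by auto
    then obtain Q where Q: "subgroup Q (G\<lparr>carrier := A\<rparr>)" "card Q = p ^ 1"
      using sylow_thm[OF p A.is_group, of 1 s] finA unfolding Coset.order_def by auto
    have QA: "Q \<subseteq> A" using subgroup.subset[OF Q(1)] by simp
    have subQ: "subgroup Q G" by (rule incl_subgroup[OF subA Q(1)])
    have k: "k > 0" unfolding k_def using subgroup.one_closed[OF subA] finA card_gt_0_iff by blast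
    have "Q \<subseteq> B"
    proof
      fix x assume x: "x \<in> Q"
      have "x [^] p = \<one>" using subgroup_pow_card[OF subQ _ x] finite_subset[OF QA finA] Q(2) by simp
      moreover have "p ^ k = p * p ^ (k - 1)" using k by (metis Suc_pred' power_Suc)
      ultimately have "x [^] (p ^ k) = \<one>" using x QA Ac by (auto simp: nat_pow_pow[symmetric])
      then show "x \<in> B" using x QA by (auto simp: B_def)
    qed
    then have "card Q \<le> 1" using card_mono[of "{\<one>}" Q] B1 by simp
    then show False using Q(2) prime_gt_1_nat[OF p] by simp
  qed
  then show thesis using that Bn b by blast
qed

lemma preimage_FactGroup_normal:
  assumes fin: "finite (carrier G)" and N: "N \<lhd> G" and B: "B \<lhd> G Mod N"
  obtains M where "M \<lhd> G" "N \<subseteq> M" "card M = card N * card B"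
proof -
  have subN: "subgroup N G" using N by (rule normal_imp_subgroup)
  have Nc: "N \<subseteq> carrier G" by (rule subgroup.subset[OF subN])
  interpret F: group "G Mod N" by (rule normal.factorgroup_is_group[OF N])
  interpret pr: group_hom G "G Mod N" "\<lambda>a. N #> a"
    using normal.r_coset_hom_Mod[OF N] F.is_group is_group by (simp add: group_hom_def group_hom_axioms_def)
  have subB: "subgroup B (G Mod N)" by (rule normal_imp_subgroup[OF B])
  have Bc: "B \<subseteq> rcosets N" using subgroup.subset[OF subB] by (simp add: FactGroup_def)
  define M where "M = {x \<in> carrier G. N #> x \<in> B}"
  have subM: "subgroup M G"
  proof (rule subgroupI)
    show "M \<noteq> {}" using subgroup.one_closed[OF subB] pr.hom_one one_closed unfolding M_def by force
    show "inv x \<in> M" if "x \<in> M" for x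
      using that subgroup.m_inv_closed[OF subB, of "N #> x"] pr.hom_inv[of x] by (auto simp: M_def)
    show "x \<otimes> y \<in> M" if "x \<in> M" "y \<in> M" for x y
      using that subgroup.m_closed[OF subB, of "N #> x" "N #> y"] pr.hom_mult[of x y] by (auto simp: M_def)
  qed (auto simp: M_def)
  have "M \<lhd> G" unfolding normal_inv_iff
  proof (intro conjI subM ballI)
    fix x h assume x: "x \<in> carrier G" and h: "h \<in> M"
    then have hc: "h \<in> carrier G" "N #> h \<in> B" by (auto simp: M_def)
    have "(N #> x) \<otimes>\<^bsub>G Mod N\<^esub> (N #> h) \<otimes>\<^bsub>G Mod N\<^esub> inv\<^bsub>G Mod N\<^esub> (N #> x) \<in> B"
      by (rule normal.inv_op_closed2[OF B _ hc(2)]) (use x pr.hom_closed in blast)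
    also have "(N #> x) \<otimes>\<^bsub>G Mod N\<^esub> (N #> h) \<otimes>\<^bsub>G Mod N\<^esub> inv\<^bsub>G Mod N\<^esub> (N #> x) = N #> (x \<otimes> h \<otimes> inv x)"
      using x hc by (simp del: mult_FactGroup)
    finally show "x \<otimes> h \<otimes> inv x \<in> M" using x hc by (simp add: M_def)
  qed
  moreover have "N \<subseteq> M"
  proof
    fix x assume x: "x \<in> N"
    have "N #> x = \<one>\<^bsub>G Mod N\<^esub>" using coset_join2[OF _ subN x] x Nc by (auto simp: FactGroup_def)
    then show "x \<in> M" using x Nc subgroup.one_closed[OF subB] by (auto simp: M_def)
  qed
  moreover have "card M = card N * card B"
  proof -
    have "M = \<Union>B"
    proof (intro equalityI subsetI)
      fix x assume "x \<in> M"
      then show "x \<in> \<Union>B" using rcos_self[OF _ subN, of x] by (auto simp: M_def)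
    next
      fix y assume "y \<in> \<Union>B"
      then obtain X where X: "X \<in> B" "y \<in> X" by blast
      then obtain x where x: "x \<in> carrier G" "X = N #> x" using Bc unfolding RCOSETS_def by blast
      have "N #> x = N #> y" by (rule repr_independence[OF _ x(1) subN]) (use X x in simp)
      moreover have "y \<in> carrier G" using X x r_coset_subset_G[OF Nc x(1)] by auto
      ultimately show "y \<in> M" using X x by (simp add: M_def)
    qed
    also have "card (\<Union>B) = sum card B"
    proof (rule card_Union_disjoint)
      show "pairwise disjnt B" using rcos_disjoint[OF subN] Bc by (rule pairwise_subset)
      show "finite X" if "X \<in> B" for X
        using that Bc rcosets_part_G[OF subN] fin by (metis Union_upper finite_subset subsetD)
    qed
    also have "\<dots> = sum (\<lambda>X. card N) B"
      using Bc card_rcosets_equal Nc by (intro sum.cong) auto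
    finally show ?thesis by simp
  qed
  ultimately show thesis using that by blast
qed

text \<open>Here \<open>N\<close> is a normal subgroup of largest order prime to \<open>p\<close>. An abelian normal subgroup of the
  quotient then has order divisible by \<open>p\<close>, and \<open>M\<close> is the preimage of its \<open>p\<close>-torsion.\<close>

lemma exists_p'_by_p_section:
  fixes p :: nat
  assumes fin: "finite (carrier G)" and solv: "solvable G" and p: "prime p" and dvd: "p dvd Coset.order G"
  obtains N M b where "N \<lhd> G" "M \<lhd> G" "N \<subseteq> M" "\<not> p dvd card N" "b > 0" "card M = card N * p ^ b"
proof -
  define P where "P N \<longleftrightarrow> N \<lhd> G \<and> \<not> p dvd card N" for N
  have P1: "P {\<one>}" unfolding P_def using one_is_normal prime_gt_1_nat[OF p] by simp
  have "{N. P N} \<subseteq> Pow (carrier G)"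
    unfolding P_def using subgroup.subset[OF normal_imp_subgroup] by blast
  then have finP: "finite {N. P N}" by (rule finite_subset) (simp add: fin)
  define c where "c = Max (card ` {N. P N})"
  have "c \<in> card ` {N. P N}" unfolding c_def using finP P1 by (intro Max_in) auto
  then obtain N where N: "P N" "card N = c" by auto
  have max: "card N' \<le> card N" if "P N'" for N'
    unfolding N(2) c_def using finP that by (intro Max_ge) auto
  have Nn: "N \<lhd> G" and pN: "\<not> p dvd card N" using N(1) by (auto simp: P_def)
  have subN: "subgroup N G" using Nn by (rule normal_imp_subgroup)
  have N0: "card N > 0"
    using subgroup.one_closed[OF subN] finite_subset[OF subgroup.subset[OF subN] fin] card_gt_0_iff by blast
  interpret F: group "G Mod N" by (rule normal.factorgroup_is_group[OF Nn])
  interpret pr: group_hom G "G Mod N" "\<lambda>a. N #> a"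
    using normal.r_coset_hom_Mod[OF Nn] F.is_group is_group by (simp add: group_hom_def group_hom_axioms_def)
  have img: "(\<lambda>a. N #> a) ` carrier G = carrier (G Mod N)"
    by (auto simp: FactGroup_def RCOSETS_def)
  have solvF: "solvable (G Mod N)" by (rule pr.surj_hom_imp_solvable[OF img solv])
  have finF: "finite (carrier (G Mod N))" using fin unfolding img[symmetric] by simp
  have cF: "card (carrier (G Mod N)) * card N = Coset.order G"
    using lagrange[OF subN] by (simp add: FactGroup_def)
  have "carrier (G Mod N) \<noteq> {\<one>\<^bsub>G Mod N\<^esub>}"
  proof
    assume "carrier (G Mod N) = {\<one>\<^bsub>G Mod N\<^esub>}"
    then have "card (carrier (G Mod N)) = 1" by simp
    then show False using cF dvd pN by simp
  qed
  then obtain A where A: "A \<lhd> G Mod N" "A \<noteq> {\<one>\<^bsub>G Mod N\<^esub>}"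
    "\<And>x y. x \<in> A \<Longrightarrow> y \<in> A \<Longrightarrow> x \<otimes>\<^bsub>G Mod N\<^esub> y = y \<otimes>\<^bsub>G Mod N\<^esub> x"
    using F.exists_abelian_normal[OF solvF] by metis
  have subA: "subgroup A (G Mod N)" by (rule normal_imp_subgroup[OF A(1)])
  have finA: "finite A" using finite_subset[OF subgroup.subset[OF subA] finF] .
  have cA: "card A > 1"
  proof -
    have one: "\<one>\<^bsub>G Mod N\<^esub> \<in> A" by (rule subgroup.one_closed[OF subA])
    have "card A \<noteq> 1" using one A(2) by (metis card_1_singletonE singletonD)
    moreover have "card A \<noteq> 0" using one finA by auto
    ultimately show ?thesis by linarith
  qed
  have "p dvd card A"
  proof (rule ccontr)
    assume npA: "\<not> p dvd card A"
    obtain M where M: "M \<lhd> G" "N \<subseteq> M" "card M = card N * card A"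
      by (rule preimage_FactGroup_normal[OF fin Nn A(1)])
    have "P M" unfolding P_def using M pN npA p by (simp add: prime_dvd_mult_iff)
    then show False using max[of M] M(3) N0 cA by simp
  qed
  then obtain B b where B: "B \<lhd> G Mod N" "card B = p ^ b" "b > 0"
    using F.exists_normal_p_subgroup[OF finF p A(1) A(3)] by metis
  obtain M where M: "M \<lhd> G" "N \<subseteq> M" "card M = card N * card B"
    by (rule preimage_FactGroup_normal[OF fin Nn B(1)])
  show thesis using that[OF Nn M(1,2) pN B(3)] M(3) B(2) by simp
qed

end

section \<open>Primitive characters of solvable groups\<close>

text \<open>The complex numbers that are divisible by \<open>p ^ k\<close> in the localisation of \<open>cyc_ints m\<close> at the
  integers prime to \<open>p\<close>.\<close>

definition locally_divisible :: "nat \<Rightarrow> nat \<Rightarrow> nat \<Rightarrow> complex set" where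
  "locally_divisible m p k = {x. \<exists>s r. coprime s p \<and> r \<in> cyc_ints m \<and> of_nat s * x = of_nat (p ^ k) * r}"

lemma locally_divisible_add:
  assumes m: "m > 0" and "x \<in> locally_divisible m p k" "y \<in> locally_divisible m p k"
  shows "x + y \<in> locally_divisible m p k"
proof -
  obtain s r s' r' where x: "coprime s p" "r \<in> cyc_ints m" "of_nat s * x = of_nat (p ^ k) * r"
    and y: "coprime s' p" "r' \<in> cyc_ints m" "of_nat s' * y = of_nat (p ^ k) * r'"
    using assms(2,3) unfolding locally_divisible_def by blast
  have "of_nat (s * s') * (x + y) = of_nat s' * (of_nat s * x) + of_nat s * (of_nat s' * y)"
    by (simp add: algebra_simps)
  also have "\<dots> = of_nat (p ^ k) * (of_nat s' * r + of_nat s * r')"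
    unfolding x(3) y(3) by (simp add: algebra_simps)
  finally have "of_nat (s * s') * (x + y) = of_nat (p ^ k) * (of_nat s' * r + of_nat s * r')" .
  moreover have "coprime (s * s') p" using x y by simp
  moreover have "of_nat s' * r + of_nat s * r' \<in> cyc_ints m"
    by (intro cyc_ints_add cyc_ints_mult[OF m] cyc_ints_of_nat[OF m] x y)
  ultimately show ?thesis unfolding locally_divisible_def by blast
qed

lemma locally_divisible_0: "0 \<in> locally_divisible m p k"
proof -
  have "coprime 1 p \<and> (0::complex) \<in> cyc_ints m \<and> of_nat 1 * 0 = of_nat (p ^ k) * (0::complex)" by simp
  then show ?thesis unfolding locally_divisible_def by blast
qed

lemma locally_divisible_sum:
  "m > 0 \<Longrightarrow> (\<And>i. i \<in> A \<Longrightarrow> f i \<in> locally_divisible m p k)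
    \<Longrightarrow> (\<Sum>i\<in>A. f i) \<in> locally_divisible m p k"
  by (induction A rule: infinite_finite_induct) (auto intro: locally_divisible_add locally_divisible_0)

lemma int_locally_divisible_imp_0:
  assumes p: "prime p" and m: "m > 0" and div: "\<And>k. of_int z \<in> locally_divisible m p k"
  shows "z = 0"
proof -
  have "int p ^ k dvd z" for k
  proof -
    obtain s r where sr: "coprime s p" "r \<in> cyc_ints m" "of_nat s * of_int z = of_nat (p ^ k) * r"
      using div[of k] unfolding locally_divisible_def by blast
    have "of_int (int s * z) = of_int (int p ^ k) * r" using sr(3) by simp
    then have "int p ^ k dvd int s * z" by (rule cyc_ints_of_int_dvd[OF m sr(2)])
    moreover have "coprime (int p ^ k) (int s)" using sr(1) by (simp add: coprime_commute)
    ultimately show ?thesis by (simp add: coprime_dvd_mult_right_iff)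
  qed
  then have dv: "int p ^ nat \<bar>z\<bar> dvd z" .
  show ?thesis
  proof (rule ccontr)
    assume "z \<noteq> 0"
    then have "\<bar>int p ^ nat \<bar>z\<bar>\<bar> \<le> \<bar>z\<bar>" using dv by (rule dvd_imp_le_int)
    then have "int (p ^ nat \<bar>z\<bar>) \<le> int (nat \<bar>z\<bar>)" by simp
    then have "p ^ nat \<bar>z\<bar> \<le> nat \<bar>z\<bar>" by (rule of_nat_le_iff[THEN iffD1])
    moreover have "nat \<bar>z\<bar> < p ^ nat \<bar>z\<bar>" using prime_gt_1_nat[OF p] by (simp add: power_gt_expt)
    ultimately show False by simp
  qed
qed

text \<open>The average of a character over the group is the trace of the projection onto the fixed
  vectors.\<close>

lemma (in fin_rep) sum_chi_dvd:
  obtains k where "(\<Sum>x\<in>carrier G. \<chi> x) = of_nat (N * k)"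
proof -
  define f :: "'a \<Rightarrow> complex" where "f x = 1 / of_nat N" for x
  have "alg f * alg f = alg f"
    unfolding alg_mult by (intro alg_cong) (simp add: f_def)
  then obtain k where k: "mat_trace (alg f) = of_nat k" using idempotent_trace_nat[OF alg_carrier] by blast
  have "mat_trace (alg f) = 1 / of_nat N * (\<Sum>x\<in>carrier G. \<chi> x)"
    unfolding trace_alg f_def by (simp add: sum_distrib_left)
  then have "(\<Sum>x\<in>carrier G. \<chi> x) = of_nat N * of_nat k"
    unfolding k using N_nonzero by (simp add: field_simps del: of_nat_eq_0_iff card_eq_0_iff)
  then have "(\<Sum>x\<in>carrier G. \<chi> x) = of_nat (N * k)" by simp
  then show thesis using that by blast
qed

context irr_rep
begin

text \<open>In the proof, \<open>\<psi>\<close> and \<open>\<theta>\<close>, of degrees \<open>d\<close> and \<open>c\<close>, are irreducible representations of the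
  normal subgroups \<open>M\<close> and \<open>L\<close> with \<open>\<chi>\<close> proportional to their characters, and \<open>P\<close> is a Sylow subgroup
  of \<open>M\<close> of order \<open>p ^ b\<close>.\<close>

theorem primitive_codegree_dvd:
  assumes prim: "primitive G (rep_char G \<rho>)" and solv: "solvable G"
    and p: "prime p" "p dvd N" and q: "N = q * n"
  shows "p dvd q"
proof (rule ccontr)
  assume nq: "\<not> p dvd q"
  obtain L M b where L: "L \<lhd> G" and M: "M \<lhd> G" and LM: "L \<subseteq> M" and pL: "\<not> p dvd card L"
    and b: "b > 0" and cM: "card M = card L * p ^ b"
    using exists_p'_by_p_section[OF fin solv p(1)] p(2) unfolding Coset.order_def by blast
  have subL: "subgroup L G" and subM: "subgroup M G" using L M by (auto intro: normal_imp_subgroup)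
  have Mc: "M \<subseteq> carrier G" by (rule subgroup.subset[OF subM])
  have finM: "finite M" using Mc fin by (rule finite_subset)
  obtain d \<psi> where psi: "irr_rep (G\<lparr>carrier := M\<rparr>) d \<psi>" "d dvd n"
    "\<And>x. x \<in> M \<Longrightarrow> \<chi> x = of_nat n / of_nat d * mat_trace (\<psi> x)"
    using primitive_imp_homogeneous[OF prim M] by blast
  obtain c \<theta> where theta: "irr_rep (G\<lparr>carrier := L\<rparr>) c \<theta>" "c dvd n"
    "\<And>x. x \<in> L \<Longrightarrow> \<chi> x = of_nat n / of_nat c * mat_trace (\<theta> x)"
    using primitive_imp_homogeneous[OF prim L] by blast
  interpret psi: irr_rep "G\<lparr>carrier := M\<rparr>" d \<psi> by fact
  interpret theta: irr_rep "G\<lparr>carrier := L\<rparr>" c \<theta> by fact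
  have n0: "of_nat n \<noteq> (0::complex)" using n_pos by simp
  have d0: "of_nat d \<noteq> (0::complex)" using psi.n_pos by simp
  have c0: "of_nat c \<noteq> (0::complex)" using theta.n_pos by simp
  have psi_theta: "mat_trace (\<psi> x) = of_nat d / of_nat c * mat_trace (\<theta> x)" if x: "x \<in> L" for x
  proof -
    have "of_nat n / of_nat d * mat_trace (\<psi> x) = of_nat n / of_nat c * mat_trace (\<theta> x)"
      using psi(3)[of x] theta(3)[OF x] x LM by auto
    then show ?thesis using n0 d0 c0 by (simp add: field_simps)
  qed
  have subLM: "subgroup L (G\<lparr>carrier := M\<rparr>)" by (rule subgroup_incl[OF subL subM LM])
  have "fin_rep (G\<lparr>carrier := L\<rparr>) d \<psi>" using psi.restrict_fin_rep[OF subLM] by simp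
  then interpret PT: rep_with_irr "G\<lparr>carrier := L\<rparr>" d \<psi> c \<theta>
    using theta(1) by (simp add: rep_with_irr_def)
  have "c dvd d" by (rule PT.proportional_degree_dvd) (use psi_theta in simp)
  then obtain e where e: "d = c * e" by blast
  obtain P where P: "subgroup P (G\<lparr>carrier := M\<rparr>)" "card P = p ^ b"
    using sylow_thm[OF p(1) psi.is_group, of b "card L"] cM finM
    unfolding Coset.order_def by (auto simp: mult.commute)
  have PM: "P \<subseteq> M" using subgroup.subset[OF P(1)] by simp
  have subP: "subgroup P G" by (rule incl_subgroup[OF subM P(1)])
  have finP: "finite P" using PM finM by (rule finite_subset)
  interpret PP: fin_rep "G\<lparr>carrier := P\<rparr>" d \<psi> using psi.restrict_fin_rep[OF P(1)] by simp
  obtain k where k: "(\<Sum>x\<in>P. mat_trace (\<psi> x)) = of_nat (p ^ b * k)"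
    using PP.sum_chi_dvd P(2) by auto
  obtain f where f: "n = d * f" using psi(2) by blast
  have onep: "\<one> \<in> P" by (rule subgroup.one_closed[OF subP])
  have "(\<Sum>u\<in>P - {\<one>}. \<chi> u) = (\<Sum>u\<in>P - {\<one>}. of_nat f * mat_trace (\<psi> u))"
    using psi(3) PM d0 by (intro sum.cong refl) (auto simp: f)
  also have "\<dots> = of_nat f * (of_nat (p ^ b * k) - of_nat d)"
    unfolding sum_distrib_left[symmetric] k[symmetric]
    using sum.remove[OF finP onep, of "\<lambda>x. mat_trace (\<psi> x)"] psi.rho_one by simp
  also have "\<dots> = of_int (int f * (int (p ^ b * k) - int d))" by simp
  finally have X: "(\<Sum>u\<in>P - {\<one>}. \<chi> u) = of_int (int f * (int (p ^ b * k) - int d))" .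
  have "of_int (int f * (int (p ^ b * k) - int d)) \<in> locally_divisible N p j" for j
    unfolding X[symmetric]
  proof (rule locally_divisible_sum[OF N_pos])
    fix u assume u: "u \<in> P - {\<one>}"
    have "u [^] (p ^ b) = \<one>" using subgroup_pow_card[OF subP finP, of u] u P(2) by simp
    then show "\<chi> u \<in> locally_divisible N p j"
      unfolding locally_divisible_def
      using vanishing_on_p_elements[OF p(1) q nq, of u b j] u PM Mc by blast
  qed
  then have "int f * (int (p ^ b * k) - int d) = 0" by (rule int_locally_divisible_imp_0[OF p(1) N_pos])
  moreover have "f \<noteq> 0" using f n_pos by (intro notI) simp
  ultimately have "d = p ^ b * k" by (simp del: of_nat_mult of_nat_power)
  then have "p ^ b dvd c * e" using e by simp
  moreover have "coprime (p ^ b) c"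
  proof -
    have "\<not> p dvd c" using theta.degree_dvd_order pL by (auto dest: dvd_trans)
    then show ?thesis using prime_imp_coprime[OF p(1)] by simp
  qed
  ultimately have "p ^ b dvd e" by (simp add: coprime_dvd_mult_right_iff)
  moreover have "e > 0" using e psi.n_pos by (metis gr0I mult_0_right less_irrefl)
  ultimately have le1: "p ^ b \<le> e" by (rule dvd_imp_le)
  have "real (e\<^sup>2 * card L) = (\<Sum>x\<in>L. (cmod (mat_trace (\<psi> x)))\<^sup>2)"
  proof -
    have "(\<Sum>x\<in>L. (cmod (mat_trace (\<psi> x)))\<^sup>2) = (\<Sum>x\<in>L. (real e)\<^sup>2 * (cmod (mat_trace (\<theta> x)))\<^sup>2)"
      using psi_theta c0 by (intro sum.cong refl) (simp add: e norm_mult power_mult_distrib)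
    also have "\<dots> = (real e)\<^sup>2 * real (card L)"
      using theta.chi_norm by (simp add: sum_distrib_left[symmetric])
    finally show ?thesis by simp
  qed
  also have "\<dots> \<le> (\<Sum>x\<in>M. (cmod (mat_trace (\<psi> x)))\<^sup>2)"
    using LM finM by (intro sum_mono2) auto
  also have "\<dots> = real (p ^ b * card L)" using psi.chi_norm cM by simp
  finally have "e\<^sup>2 * card L \<le> p ^ b * card L" by (simp only: of_nat_le_iff)
  then have "e\<^sup>2 \<le> p ^ b" using theta.N_pos by simp
  then have "e * e \<le> 1 * e" using le1 unfolding power2_eq_square by linarith
  then have "e \<le> 1" using \<open>e > 0\<close> by (rule mult_right_le_imp_le)
  moreover have "p ^ b > 1" using prime_gt_1_nat[OF p(1)] b by (rule one_less_power)
  ultimately show False using le1 by simp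
qed

end

theorem theorem2p2:
  fixes G :: "('a, 'b) monoid_scheme" and \<chi> :: "'a \<Rightarrow> complex"
  assumes "group G" and "finite (carrier G)" and "solvable G"
    and "\<chi> \<in> Irr G" and "faithful G \<chi>" and "primitive G \<chi>"
  shows "\<exists>c::nat. cod G \<chi> = of_nat c \<and>
           (\<forall>p. prime p \<and> p dvd Coset.order G \<longrightarrow> p dvd c) \<and>
           prime_factors c = prime_factors (Coset.order G)"
proof -
  obtain n \<rho> where irr: "irreducible_rep G n \<rho>" and chi: "\<chi> = rep_char G \<rho>"
    using assms(4) unfolding Irr_def by blast
  interpret group G by fact
  have rep: "is_rep G n \<rho>" using irr unfolding irreducible_rep_def by blast
  interpret irr_rep G n \<rho> using assms(2) rep irr by unfold_locales
  obtain q where q: "N = q * n" using degree_dvd_order by (metis dvdE mult.commute)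
  have chi1: "rep_char G \<rho> \<one>\<^bsub>G\<^esub> = of_nat n" by (simp add: rep_char_def)
  have ker: "char_kernel G (rep_char G \<rho>) = {\<one>\<^bsub>G\<^esub>}"
    using assms(5) unfolding faithful_def chi .
  have "card (rcosets\<^bsub>G\<^esub> {\<one>\<^bsub>G\<^esub>}) = N"
    using lagrange[OF normal_imp_subgroup[OF one_is_normal]] by (simp add: Coset.order_def)
  then have cod: "cod G \<chi> = of_nat q"
    unfolding cod_def chi ker chi1 using n_pos by (simp add: q)
  have dvd: "p dvd q" if "prime p" "p dvd N" for p
    using primitive_codegree_dvd[OF _ assms(3) that q] assms(6) unfolding chi by blast
  have q0: "q \<noteq> 0" using q N_pos by (intro notI) simp
  have "prime_factors q = prime_factors N"
  proof (intro equalityI subsetI)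
    fix p assume "p \<in> prime_factors q"
    then show "p \<in> prime_factors N" unfolding q using n_pos by (auto simp: prime_factors_dvd q0)
  next
    fix p assume "p \<in> prime_factors N"
    then have "prime p" "p dvd N" by (auto simp: prime_factors_dvd)
    then show "p \<in> prime_factors q" using dvd q0 by (auto simp: prime_factors_dvd)
  qed
  then show ?thesis using cod dvd unfolding Coset.order_def by blast
qed

end
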